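(* Let $\alpha>\beta>0$ be constants with $\sqrt{\alpha}-\sqrt{\beta}>\sqrt{2}$. Let $A$ be the adjacency matrix of a random graph generated according to the binary symmetric stochastic block model with parameters $(n,p,q)$ and label $x^*$, where $p=\alpha\log n/n$ and $q=\beta\log n/n$. Then there is a choice of the input parameter $N=\Theta(\log n/\log\log n)$ (depending only on $n,\alpha,\beta$) such that, for all sufficiently large $n$, the probability that the Algorithm described in the context, run on input $(A,N)$, outputs $x^*$ or $-x^*$ in $\mathcal{O}(n\log^2 n/\log\log n)$ time is at least $1-n^{-\Omega(1)}$.
   Context: **Model.** $n\ge 2$ is an even integer, $\log$ is the natural logarithm, $p,q\in[0,1]$, $p>q$, and $x^*\in\{-1,+1\}^n$ is a label vector with $\mathbf{1}^Tx^*=0$, where $\mathbf{1}$ is the all-one vector. A random graph on vertex set $[n]=\{1,\dots,n\}$ is generated according to the binary symmetric stochastic block model with parameters $(n,p,q)$ and label $x^*$ if the entries $\{a_{ij}\}_{1\le i\le j\le n}$ of its (symmetric) adjacency matrix $A$ are independent with $a_{ij}\sim\mathrm{Bern}(p)$ if $x_i^*x_j^*=1$ and $a_{ij}\sim\mathrm{Bern}(q)$ if $x_i^*x_j^*=-1$ (self-loops allowed). **Projection.** $\mathcal{F}=\{x\in\mathbb{R}^n:\mathbf{1}^Tx=0,\ x_i\in\{\pm1\}\ \forall i\in[n]\}$, and for $c\in\mathbb{R}^n$, $\mathcal{P}(c)$ denotes the set of minimizers of $\|u-c\|_2^2$ over $u\in\mathcal{F}$. **Algorithm** (input: $A$ and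 a positive integer $N$). Draw $Y\in\mathbb{R}^{n\times 2}$ with i.i.d. standard normal entries, independent of $A$. Stage 1 (orthogonal iterations with Ritz acceleration): set $Q^{(0)}=Y(Y^TY)^{-1/2}$. For $k=1,\dots,N$, compute a QR decomposition $AQ^{(k-1)}=Q^{(k)}R^{(k)}$, where $Q^{(k)}\in\mathbb{R}^{n\times2}$ has orthonormal columns and $R^{(k)}\in\mathbb{R}^{2\times 2}$ is upper triangular. Compute an eigendecomposition $Q^{(N)T}AQ^{(N)}=H^{(N)}D^{(N)}H^{(N)T}$ with $H^{(N)}$ orthogonal and $D^{(N)}=\mathrm{diag}(d_1^{(N)},d_2^{(N)})$, $|d_1^{(N)}|\ge|d_2^{(N)}|$; set $\bar Q^{(N)}=Q^{(N)}H^{(N)}$; let $\tilde y$ be the $i^*$-th column of $\bar Q^{(N)}$, where $i^*=\arg\min_{i\in\{1,2\}}d_i^{(N)}$; set $y=\tilde y-(\mathbf{1}^T\tilde y/n)\mathbf{1}$. Stage 2 (projected power iterations): set $x^{(0)}=\sqrt n\,y/\|y\|_2$. For $k=1,2,\dots$, choose $x^{(k)}\in\mathcal{P}(Ax^{(k-1)})$; if $x^{(k)}=x^{(k-1)}$, terminate and output $x^{(k)}$. **Conventions.** Time counts elementary real arithmetic operations and comparisons; $A$ is stored sparsely, so that a product $Av$ costs time proportional to the number of non-zero entries of $A$ (plus $\mathcal{O}(n)$); a QR decomposition of an $n\times2$ matrix costs $\mathcal{O}(n)$, an eigendecomposition of a $2\times2$ symmetric matrix costs $\mathcal{O}(1)$,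 and the $(n/2)$-th largest entry of a vector in $\mathbb{R}^n$ can be found in $\mathcal{O}(n)$ time. "Probability at least $1-n^{-\Omega(1)}$" means probability at least $1-n^{-c}$ for all sufficiently large $n$, for some constant $c>0$ independent of $n$; the probability is over $A$ and the random choices in the Algorithm. Implied constants may depend on $\alpha,\beta$ only. *)

theory Defs
  imports
    "HOL-Probability.Probability"
    "HOL-Library.Landau_Symbols"
    "Jordan_Normal_Form.Matrix"
begin

unbundle no inner_syntax
unbundle no vec_syntax
hide_type (open) Finite_Cartesian_Product.vec
hide_const (open) Finite_Cartesian_Product.vec Finite_Cartesian_Product.mat
  Finite_Cartesian_Product.row

text \<open>
  The dimension is a term-level natural number, so vectors and matrices are those of
  Jordan-Normal-Form; vertices and coordinates are indexed from 0.
\<close>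

section \<open>Labels, stochastic block model, Gaussian start\<close>

definition balanced_labels :: "nat \<Rightarrow> real vec set" where
  "balanced_labels n = {x \<in> carrier_vec n. (\<Sum>i<n. x $ i) = 0 \<and> (\<forall>i<n. x $ i \<in> {-1, 1})}"

text \<open>
  Only the entries on and above the diagonal are drawn. The law \<^term>\<open>bernoulli_pmf r\<close> is the
  intended one for \<open>r\<close> in the unit interval only.
\<close>

definition sbm :: "nat \<Rightarrow> real \<Rightarrow> real \<Rightarrow> real vec \<Rightarrow> real mat pmf" where
  "sbm n p q x =
     map_pmf (\<lambda>a. mat n n (\<lambda>(i, j). of_bool (a (min i j, max i j))))
       (Pi_pmf {(i, j). i \<le> j \<and> j < n} False
         (\<lambda>(i, j). bernoulli_pmf (if x $ i * x $ j = 1 then p else q)))"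

definition gaussian_entries :: "nat \<Rightarrow> (nat \<times> nat \<Rightarrow> real) measure" where
  "gaussian_entries n =
     PiM ({..<n} \<times> {..<2}) (\<lambda>_. density lborel (\<lambda>t. ennreal (std_normal_density t)))"


section \<open>The algorithm\<close>

text \<open>
  QR and eigendecompositions, ties in the choice of an eigenvector, and projections are not
  unique. The algorithm is therefore described by relations.
\<close>

definition is_inv_sqrt :: "real mat \<Rightarrow> real mat \<Rightarrow> bool" where
  "is_inv_sqrt M S \<longleftrightarrow>
     S \<in> carrier_mat (dim_row M) (dim_row M) \<and> transpose_mat S = S \<and>
     (\<forall>v \<in> carrier_vec (dim_row M). v \<noteq> 0\<^sub>v (dim_row M) \<longrightarrow> v \<bullet> (S *\<^sub>v v) > 0) \<and>
     inverts_mat M (S * S) \<and> inverts_mat (S * S) M"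

definition is_qr :: "nat \<Rightarrow> real mat \<Rightarrow> real mat \<Rightarrow> real mat \<Rightarrow> bool" where
  "is_qr n M Q R \<longleftrightarrow>
     Q \<in> carrier_mat n 2 \<and> R \<in> carrier_mat 2 2 \<and>
     transpose_mat Q * Q = 1\<^sub>m 2 \<and> upper_triangular R \<and> M = Q * R"

definition is_eigendecomp :: "real mat \<Rightarrow> real mat \<Rightarrow> real mat \<Rightarrow> bool" where
  "is_eigendecomp B H D \<longleftrightarrow>
     H \<in> carrier_mat 2 2 \<and> D \<in> carrier_mat 2 2 \<and>
     transpose_mat H * H = 1\<^sub>m 2 \<and> diagonal_mat D \<and> \<bar>D $$ (0, 0)\<bar> \<ge> \<bar>D $$ (1, 1)\<bar> \<and>
     B = H * D * transpose_mat H"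

definition centre :: "nat \<Rightarrow> real vec \<Rightarrow> real vec" where
  "centre n y = vec n (\<lambda>i. y $ i - (\<Sum>j<n. y $ j) / real n)"

definition stage1 :: "nat \<Rightarrow> real mat \<Rightarrow> real mat \<Rightarrow> nat \<Rightarrow> real vec \<Rightarrow> bool" where
  "stage1 n A Y N y \<longleftrightarrow>
     (\<exists>S Q R H D i.
        is_inv_sqrt (transpose_mat Y * Y) S \<and> Q 0 = Y * S \<and>
        (\<forall>k\<in>{1..N}. is_qr n (A * Q (k - 1)) (Q k) (R k)) \<and>
        is_eigendecomp (transpose_mat (Q N) * A * Q N) H D \<and>
        is_arg_min (\<lambda>i. D $$ (i, i)) (\<lambda>i. i \<in> {0, 1}) i \<and>
        y = centre n (col (Q N * H) i))"

definition projection :: "nat \<Rightarrow> real vec \<Rightarrow> real vec set" where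
  "projection n c = {u. is_arg_min (\<lambda>u. (u - c) \<bullet> (u - c)) (\<lambda>u. u \<in> balanced_labels n) u}"

text \<open>
  The sequences below are continued past the stopping index. Since \<^const>\<open>projection\<close> is never
  empty for even \<open>n\<close>, the runs of the second stage are exactly their initial segments.
\<close>

definition power_iterates :: "nat \<Rightarrow> real mat \<Rightarrow> real vec \<Rightarrow> (nat \<Rightarrow> real vec) \<Rightarrow> bool" where
  "power_iterates n A y x \<longleftrightarrow>
     x 0 = (sqrt (real n) / sqrt (y \<bullet> y)) \<cdot>\<^sub>v y \<and>
     (\<forall>k\<ge>1. x k \<in> projection n (A *\<^sub>v x (k - 1)))"

definition stops_at :: "(nat \<Rightarrow> real vec) \<Rightarrow> nat \<Rightarrow> bool" where
  "stops_at x K \<longleftrightarrow> K \<ge> 1 \<and> x K = x (K - 1) \<and> (\<forall>k. 1 \<le> k \<and> k < K \<longrightarrow> x k \<noteq> x (k - 1))"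


section \<open>Running time\<close>

text \<open>
  Elementary real operations (including square roots and normal draws) and comparisons cost one
  unit. The prices of the remaining subroutines are parameters, about which only the bounds of
  \<open>admissible_costs\<close> are known. The second argument of \<open>matvec_cost\<close> is the number of nonzero
  entries of the sparse matrix.
\<close>

record cost_model =
  matvec_cost :: "nat \<Rightarrow> nat \<Rightarrow> nat"
  qr_cost :: "nat \<Rightarrow> nat"
  eig_cost :: nat
  select_cost :: "nat \<Rightarrow> nat"

definition admissible_costs :: "cost_model \<Rightarrow> bool" where
  "admissible_costs cm \<longleftrightarrow>
     (\<exists>\<kappa>. \<forall>n\<ge>1. (\<forall>m. matvec_cost cm n m \<le> \<kappa> * (m + n)) \<and>
                  qr_cost cm n \<le> \<kappa> * n \<and> select_cost cm n \<le> \<kappa> * n)"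

definition nnz :: "real mat \<Rightarrow> nat" where
  "nnz A = card {(i, j). i < dim_row A \<and> j < dim_col A \<and> A $$ (i, j) \<noteq> 0}"

text \<open>Dense product of an \<open>a\<close> by \<open>b\<close> with a \<open>b\<close> by \<open>c\<close> matrix.\<close>

definition dense_mult_time :: "nat \<Rightarrow> nat \<Rightarrow> nat \<Rightarrow> nat" where
  "dense_mult_time a b c = a * c * (2 * b - 1)"

text \<open>
  The inverse square root is obtained from an eigendecomposition: two square roots, two
  reciprocals, a scaling of the columns, and one product.
\<close>

definition init_time :: "cost_model \<Rightarrow> nat \<Rightarrow> nat" where
  "init_time cm n =
     2 * n + dense_mult_time 2 n 2 + (eig_cost cm + 8 + dense_mult_time 2 2 2)
       + dense_mult_time n 2 2"

definition orth_iter_time :: "cost_model \<Rightarrow> nat \<Rightarrow> nat \<Rightarrow> nat" where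
  "orth_iter_time cm n m = 2 * matvec_cost cm n m + qr_cost cm n"

text \<open>
  The 4 accounts for sorting the two eigenvalues by modulus and for the final choice of the
  smaller one; \<open>2 * n\<close> is the centring.
\<close>

definition ritz_time :: "cost_model \<Rightarrow> nat \<Rightarrow> nat \<Rightarrow> nat" where
  "ritz_time cm n m =
     2 * matvec_cost cm n m + dense_mult_time 2 n 2 + eig_cost cm + 4
       + dense_mult_time n 2 2 + 2 * n"

text \<open>The norm takes \<open>2 * n\<close> operations.\<close>

definition normalise_time :: "nat \<Rightarrow> nat" where
  "normalise_time n = 2 * n + 2 + n"

text \<open>
  A projection is computed by selecting the \<open>n div 2\<close>-th largest entry, comparing each entry with
  it (greater, equal, smaller), and counting while assigning the ties; then the new iterate is
  compared with the old one.
\<close>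

definition power_iter_time :: "cost_model \<Rightarrow> nat \<Rightarrow> nat \<Rightarrow> nat" where
  "power_iter_time cm n m = matvec_cost cm n m + select_cost cm n + 3 * n + n"

definition run_time :: "cost_model \<Rightarrow> nat \<Rightarrow> nat \<Rightarrow> nat \<Rightarrow> nat \<Rightarrow> nat" where
  "run_time cm n m N K =
     init_time cm n + N * orth_iter_time cm n m + ritz_time cm n m
       + normalise_time n + K * power_iter_time cm n m"


section \<open>Recovery\<close>

text \<open>
  The first stage can be carried out, and whatever choices are made, the start of the second stage
  is well defined and the second stage stops with \<open>xs\<close> or \<open>- xs\<close> within total time \<open>T\<close>.
\<close>

definition recovers_within ::
  "cost_model \<Rightarrow> nat \<Rightarrow> nat \<Rightarrow> real vec \<Rightarrow> real \<Rightarrow> real mat \<Rightarrow> real mat \<Rightarrow> bool" where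
  "recovers_within cm n N xs T A Y \<longleftrightarrow>
     (\<exists>y. stage1 n A Y N y) \<and>
     (\<forall>y. stage1 n A Y N y \<longrightarrow>
        y \<noteq> 0\<^sub>v n \<and>
        (\<forall>x. power_iterates n A y x \<longrightarrow>
           (\<exists>K. stops_at x K \<and> (x K = xs \<or> x K = - xs) \<and>
                real (run_time cm n (nnz A) N K) \<le> T)))"

text \<open>
  As \<open>recovers_within\<close> quantifies over all choices of the algorithm, probabilities are bounded from
  below through measurable subsets.
\<close>

definition prob_at_least :: "'a measure \<Rightarrow> 'a set \<Rightarrow> real \<Rightarrow> bool" where
  "prob_at_least M S r \<longleftrightarrow> (\<exists>E \<in> sets M. E \<subseteq> S \<and> measure M E \<ge> r)"

end

(*
  Write L = ln n, U for the plane spanned by the all-one vector and the label x, and W for the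
  centred adjacency matrix. Chernoff bounds over pairs of vertex sets show that
  |W(S, T)| <= L^(3/4) sqrt(|S| |T|) for all S, T, and a layer-cake decomposition turns this
  discrepancy into an operator norm bound w = O(L^(11/12)), which is already o(L); the optimal
  bound O(L^(1/2)) is not needed because N may be a large multiple of L / ln L.

  No spectral theorem is used for the first stage: the leading eigenspace is replaced by A^N U.
  A vector r orthogonal to A^N U satisfies A^N r orthogonal to U by self-adjointness, so its orbit
  never enters the cone around U that A maps into itself, and it grows at most by 2w per step,
  whereas vectors of A^N U grow at least by a constant multiple of L. The factor (w / L)^N beats the
  polynomial lower bound on the Gaussian 2 x 2 determinant that measures the start against A^N U. In
  a Ritz pair, orthogonality of the image of one vector to the other and the order of the Ritz
  values force the chosen vector close to a multiple of x.

  In the second stage the margin min_i x_i (A x)_i >= kappa L, the place where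
  sqrt alpha - sqrt beta > sqrt 2 enters, and the bound on W make each projected step shrink the
  squared error by a factor O((w / L)^2), so that O(L / ln L) steps suffice.
*)

theory Submission
  imports Defs "HOL-Real_Asymp.Real_Asymp"
begin

section \<open>From discrepancy to the operator norm\<close>

text \<open>The exponents come from one balance. A cut-off ratio \<open>R\<close> between level sets
  costs \<open>L^(3/4) R^2\<close> through the discrepancy and a multiple of \<open>L / R\<close>
  through the absolute row sums; \<open>R = L^(1/12)\<close> makes both of order
  \<open>L^(11/12)\<close>. So \<open>w / L\<close> is of order \<open>L^(-1/12)\<close>, and half
  of this exponent is spent on absorbing constants.

  The loss to be beaten in the first stage is \<open>8 n^7\<close>: with high probability the
  starting columns have norm at most \<open>n^2\<close> and the determinant is at least
  \<open>n^(-3)\<close>.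

  Square roots, QR factors and Ritz vectors are not unique, so the iterates are followed through
  their column spaces; the conclusions then hold for all choices at once. The bilinear form that
  measures the start is fixed by the graph before the start is drawn, and a graph takes finitely
  many values, so a finite union of rectangles serves as the measurable event.\<close>

lemma layer_sum:
  fixes a :: "'a \<Rightarrow> nat" and f :: "'a \<Rightarrow> real"
  assumes "finite I" "\<And>i. i \<in> I \<Longrightarrow> a i \<le> M"
  shows "(\<Sum>i\<in>I. real (a i) * f i) = (\<Sum>s=1..M. \<Sum>i\<in>{i\<in>I. s \<le> a i}. f i)"
proof -
  have "(\<Sum>i\<in>I. real (a i) * f i) = (\<Sum>i\<in>I. \<Sum>s=1..M. if s \<le> a i then f i else 0)"
  proof (rule sum.cong[OF refl])
    fix i assume "i \<in> I"
    then have "{1..M} \<inter> {s. s \<le> a i} = {1..a i}" using assms(2)[of i] by auto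
    then show "real (a i) * f i = (\<Sum>s=1..M. if s \<le> a i then f i else 0)"
      by (simp add: sum.If_cases)
  qed
  also have "\<dots> = (\<Sum>s=1..M. \<Sum>i\<in>I. if s \<le> a i then f i else 0)"
    by (rule sum.swap)
  also have "\<dots> = (\<Sum>s=1..M. \<Sum>i\<in>{i\<in>I. s \<le> a i}. f i)"
    by (rule sum.cong[OF refl]) (rule sum.inter_filter[OF assms(1), symmetric])
  finally show ?thesis .
qed

text \<open>Each \<open>i\<close> contributes \<open>1 + ... + a i\<close>, which is at most the
  square of \<open>a i\<close>. This is how weighted level-set sizes return to Euclidean
  norms.\<close>

lemma sum_level_cards_le:
  fixes a :: "'a \<Rightarrow> nat"
  assumes "finite I" "\<And>i. i \<in> I \<Longrightarrow> a i \<le> M"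
  shows "(\<Sum>s=1..M. real s * real (card {i\<in>I. s \<le> a i})) \<le> (\<Sum>i\<in>I. (real (a i))\<^sup>2)"
proof -
  have "(\<Sum>s=1..M. real s * real (card {i\<in>I. s \<le> a i}))
      = (\<Sum>s=1..M. \<Sum>i\<in>I. if s \<le> a i then real s else 0)"
    by (intro sum.cong refl) (simp add: sum.inter_filter[OF assms(1), symmetric])
  also have "\<dots> = (\<Sum>i\<in>I. \<Sum>s=1..M. if s \<le> a i then real s else 0)"
    by (rule sum.swap)
  also have "\<dots> \<le> (\<Sum>i\<in>I. (real (a i))\<^sup>2)"
  proof (rule sum_mono)
    fix i assume "i \<in> I"
    then have "{1..M} \<inter> {s. s \<le> a i} = {1..a i}" using assms(2)[of i] by auto
    then have "(\<Sum>s=1..M. if s \<le> a i then real s else 0) = (\<Sum>s=1..a i. real s)"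
      by (simp add: sum.If_cases)
    also have "\<dots> \<le> (\<Sum>s=1..a i. real (a i))"
      by (rule sum_mono) auto
    finally show "(\<Sum>s=1..M. if s \<le> a i then real s else 0) \<le> (real (a i))\<^sup>2"
      by (simp add: power2_eq_square)
  qed
  finally show ?thesis .
qed

text \<open>
  Pairs of level sets whose indices differ by a factor at most \<open>R\<close> are estimated by the discrepancy,
  the others by the row and column sums.
\<close>

lemma discrepancy_bilinear_nat:
  fixes W :: "'a \<Rightarrow> 'a \<Rightarrow> real" and a b :: "'a \<Rightarrow> nat" and R :: nat
  assumes fin: "finite I" and R: "R > 0" and g0: "\<gamma> \<ge> 0" and D0: "D \<ge> 0"
    and disc: "\<And>S T. S \<subseteq> I \<Longrightarrow> T \<subseteq> I \<Longrightarrow>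
       \<bar>\<Sum>i\<in>S. \<Sum>j\<in>T. W i j\<bar> \<le> \<gamma> * sqrt (real (card S) * real (card T))"
    and rows: "\<And>i. i \<in> I \<Longrightarrow> (\<Sum>j\<in>I. \<bar>W i j\<bar>) \<le> D"
    and cols: "\<And>j. j \<in> I \<Longrightarrow> (\<Sum>i\<in>I. \<bar>W i j\<bar>) \<le> D"
  shows "\<bar>\<Sum>i\<in>I. \<Sum>j\<in>I. real (a i) * W i j * real (b j)\<bar>
     \<le> (\<gamma> * (real R)\<^sup>2 + D / real R) * ((\<Sum>i\<in>I. (real (a i))\<^sup>2) + (\<Sum>j\<in>I. (real (b j))\<^sup>2))"
proof -
  \<comment> \<open>The inserted \<open>0\<close> keeps \<open>Max\<close> meaningful when
    \<open>I\<close> is empty.\<close>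
  define M where "M = Max (insert 0 (a ` I \<union> b ` I))"
  have Ma: "a i \<le> M" if "i \<in> I" for i using that fin by (auto simp: M_def)
  have Mb: "b i \<le> M" if "i \<in> I" for i using that fin by (auto simp: M_def)
  define S where "S s = {i\<in>I. s \<le> a i}" for s
  define T where "T t = {i\<in>I. t \<le> b i}" for t
  define w where "w s t = (\<Sum>i\<in>S s. \<Sum>j\<in>T t. W i j)" for s t
  have SI: "S s \<subseteq> I" "T s \<subseteq> I" for s by (auto simp: S_def T_def)
  have finST: "finite (S s)" "finite (T s)" for s using fin by (simp_all add: S_def T_def)
  have eq: "(\<Sum>i\<in>I. \<Sum>j\<in>I. real (a i) * W i j * real (b j)) = (\<Sum>s=1..M. \<Sum>t=1..M. w s t)"
  proof -
    have "(\<Sum>i\<in>I. \<Sum>j\<in>I. real (a i) * W i j * real (b j))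
        = (\<Sum>i\<in>I. real (a i) * (\<Sum>j\<in>I. real (b j) * W i j))"
      by (simp add: sum_distrib_left ac_simps)
    also have "\<dots> = (\<Sum>s=1..M. \<Sum>i\<in>S s. \<Sum>j\<in>I. real (b j) * W i j)"
      unfolding S_def by (rule layer_sum[OF fin Ma])
    also have "\<dots> = (\<Sum>s=1..M. \<Sum>i\<in>S s. \<Sum>t=1..M. \<Sum>j\<in>T t. W i j)"
      unfolding T_def by (intro sum.cong refl layer_sum[OF fin Mb])
    also have "\<dots> = (\<Sum>s=1..M. \<Sum>t=1..M. w s t)"
      unfolding w_def by (intro sum.cong refl sum.swap)
    finally show ?thesis .
  qed
  have w1: "\<bar>w s t\<bar> \<le> \<gamma> * sqrt (real (card (S s)) * real (card (T t)))" for s t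
    unfolding w_def by (rule disc[OF SI])
  have w2: "\<bar>w s t\<bar> \<le> D * real (card (S s))" for s t
  proof -
    have "\<bar>w s t\<bar> \<le> (\<Sum>i\<in>S s. \<bar>\<Sum>j\<in>T t. W i j\<bar>)" unfolding w_def by (rule sum_abs)
    also have "\<dots> \<le> (\<Sum>i\<in>S s. D)"
    proof (rule sum_mono)
      fix i assume "i \<in> S s" then have i: "i \<in> I" using SI by auto
      have "\<bar>\<Sum>j\<in>T t. W i j\<bar> \<le> (\<Sum>j\<in>T t. \<bar>W i j\<bar>)" by (rule sum_abs)
      also have "\<dots> \<le> (\<Sum>j\<in>I. \<bar>W i j\<bar>)" by (rule sum_mono2) (use fin SI in auto)
      finally show "\<bar>\<Sum>j\<in>T t. W i j\<bar> \<le> D" using rows[OF i] by simp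
    qed
    finally show ?thesis by (simp add: mult.commute)
  qed
  have w3: "\<bar>w s t\<bar> \<le> D * real (card (T t))" for s t
  proof -
    have "w s t = (\<Sum>j\<in>T t. \<Sum>i\<in>S s. W i j)" unfolding w_def by (rule sum.swap)
    then have "\<bar>w s t\<bar> \<le> (\<Sum>j\<in>T t. \<bar>\<Sum>i\<in>S s. W i j\<bar>)" by (simp add: sum_abs)
    also have "\<dots> \<le> (\<Sum>j\<in>T t. D)"
    proof (rule sum_mono)
      fix j assume "j \<in> T t" then have j: "j \<in> I" using SI by auto
      have "\<bar>\<Sum>i\<in>S s. W i j\<bar> \<le> (\<Sum>i\<in>S s. \<bar>W i j\<bar>)" by (rule sum_abs)
      also have "\<dots> \<le> (\<Sum>i\<in>I. \<bar>W i j\<bar>)" by (rule sum_mono2) (use fin SI in auto)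
      finally show "\<bar>\<Sum>i\<in>S s. W i j\<bar> \<le> D" using cols[OF j] by simp
    qed
    finally show ?thesis by (simp add: mult.commute)
  qed
  \<comment> \<open>A Schur-test kernel: \<open>k s t\<close> is the part of the estimate for the
    pair of levels \<open>(s, t)\<close> that is charged to level \<open>s\<close>. Comparable
    levels are charged to both sides, the others to the higher level.\<close>
  define k where "k s t = (if s \<le> R * t \<and> t \<le> R * s then \<gamma> / real t else 0)
       + (if R * t < s then D / real s else 0)" for s t :: nat
  have half: "x / 2 \<le> x" if "x \<ge> 0" for x :: real using that by simp
  have k0: "k s t \<ge> 0" for s t using g0 D0 by (auto simp: k_def)
  have pt: "\<bar>w s t\<bar> \<le> real s * real (card (S s)) * k s t + real t * real (card (T t)) * k t s"
    if st: "s \<ge> 1" "t \<ge> 1" for s t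
  proof -
    consider (mid) "s \<le> R * t \<and> t \<le> R * s" | (hi) "R * t < s" | (lo) "R * s < t" by linarith
    then show ?thesis
    proof cases
      case mid
      let ?A = "real (card (S s))" and ?B = "real (card (T t))"
      \<comment> \<open>The product is reweighted by \<open>s / t\<close> before the means
        inequality, so that each share carries its level times its size.\<close>
      have "sqrt (?A * ?B) = sqrt ((?A * real s / real t) * (?B * real t / real s))"
        using st by simp
      also have "\<dots> \<le> ((?A * real s / real t) + (?B * real t / real s)) / 2"
        by (rule arith_geo_mean_sqrt) auto
      also have "\<dots> \<le> (?A * real s / real t) + (?B * real t / real s)"
        by (rule half) simp
      finally have "\<gamma> * sqrt (?A * ?B) \<le> \<gamma> * ((?A * real s / real t) + (?B * real t / real s))"
        using g0 by (rule mult_left_mono)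
      also have "\<dots> = real s * ?A * (\<gamma> / real t) + real t * ?B * (\<gamma> / real s)"
        by (simp add: algebra_simps)
      also have "\<dots> \<le> real s * ?A * k s t + real t * ?B * k t s"
        by (intro add_mono mult_left_mono) (use mid D0 in \<open>auto simp: k_def\<close>)
      finally show ?thesis using w1[of s t] by linarith
    next
      case hi
      have "D * real (card (S s)) = real s * real (card (S s)) * (D / real s)" using st by simp
      also have "\<dots> \<le> real s * real (card (S s)) * k s t"
        by (intro mult_left_mono) (use hi g0 in \<open>auto simp: k_def\<close>)
      finally show ?thesis using w2[of s t] mult_nonneg_nonneg[OF _ k0[of t s], of "real t * real (card (T t))"]
        by simp
    next
      case lo
      have "D * real (card (T t)) = real t * real (card (T t)) * (D / real t)" using st by simp
      also have "\<dots> \<le> real t * real (card (T t)) * k t s"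
        by (intro mult_left_mono) (use lo g0 in \<open>auto simp: k_def\<close>)
      finally show ?thesis using w3[of s t] mult_nonneg_nonneg[OF _ k0[of s t], of "real s * real (card (S s))"]
        by simp
    qed
  qed
  define c where "c = \<gamma> * (real R)\<^sup>2 + D / real R"
  \<comment> \<open>Comparable levels: at most \<open>R * s\<close> values of \<open>t\<close>, each
    worth at most \<open>\<gamma> * R / s\<close>. Much lower levels: at most \<open>s / R\<close>
    values, each worth \<open>D / s\<close>.\<close>
  have ksum: "(\<Sum>t=1..M. k s t) \<le> c" if s: "s \<ge> 1" for s
  proof -
    have "(\<Sum>t=1..M. if s \<le> R * t \<and> t \<le> R * s then \<gamma> / real t else 0)
        = (\<Sum>t\<in>{1..M} \<inter> {t. s \<le> R * t \<and> t \<le> R * s}. \<gamma> / real t)"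
      by (simp add: sum.If_cases)
    also have "\<dots> \<le> (\<Sum>t\<in>{1..M} \<inter> {t. s \<le> R * t \<and> t \<le> R * s}. \<gamma> * real R / real s)"
    proof (rule sum_mono)
      fix t assume "t \<in> {1..M} \<inter> {t. s \<le> R * t \<and> t \<le> R * s}"
      then have t: "t \<ge> 1" "real s \<le> real R * real t"
        by (auto simp flip: of_nat_mult)
      have "\<gamma> * real s \<le> \<gamma> * (real R * real t)" using g0 t by (intro mult_left_mono) auto
      then show "\<gamma> / real t \<le> \<gamma> * real R / real s" using t s by (simp add: field_simps)
    qed
    also have "\<dots> \<le> (\<Sum>t\<in>{1..R * s}. \<gamma> * real R / real s)"
      by (rule sum_mono2) (use g0 in auto)
    also have "\<dots> = \<gamma> * (real R)\<^sup>2" using s by (simp add: power2_eq_square)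
    finally have 1: "(\<Sum>t=1..M. if s \<le> R * t \<and> t \<le> R * s then \<gamma> / real t else 0) \<le> \<gamma> * (real R)\<^sup>2" .
    have "(\<Sum>t=1..M. if R * t < s then D / real s else 0)
        = (\<Sum>t\<in>{1..M} \<inter> {t. R * t < s}. D / real s)"
      by (simp add: sum.If_cases)
    also have "\<dots> \<le> (\<Sum>t\<in>{1..s div R}. D / real s)"
    proof (rule sum_mono2)
      show "{1..M} \<inter> {t. R * t < s} \<subseteq> {1..s div R}"
        using R by (auto simp: less_eq_div_iff_mult_less_eq mult.commute)
    qed (use D0 in auto)
    also have "\<dots> = D * (real (s div R) / real s)" by simp
    also have "\<dots> \<le> D * (1 / real R)"
    proof (rule mult_left_mono[OF _ D0])
      have "real (s div R) \<le> real s / real R" by (rule of_nat_div_le_of_nat)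
      then show "real (s div R) / real s \<le> 1 / real R" using s R by (simp add: field_simps)
    qed
    finally have 2: "(\<Sum>t=1..M. if R * t < s then D / real s else 0) \<le> D / real R" by simp
    show ?thesis using 1 2 by (simp add: k_def c_def sum.distrib)
  qed
  have c0: "c \<ge> 0" using g0 D0 by (simp add: c_def)
  have "\<bar>\<Sum>s=1..M. \<Sum>t=1..M. w s t\<bar> \<le> (\<Sum>s=1..M. \<Sum>t=1..M. \<bar>w s t\<bar>)"
    by (rule order_trans[OF sum_abs sum_mono[OF sum_abs]])
  also have "\<dots> \<le> (\<Sum>s=1..M. \<Sum>t=1..M. real s * real (card (S s)) * k s t + real t * real (card (T t)) * k t s)"
    by (intro sum_mono pt) auto
  also have "\<dots> = (\<Sum>s=1..M. \<Sum>t=1..M. real s * real (card (S s)) * k s t)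
     + (\<Sum>t=1..M. \<Sum>s=1..M. real t * real (card (T t)) * k t s)"
    unfolding sum.distrib by (rule arg_cong2[of _ _ _ _ "(+)", OF refl sum.swap])
  also have "\<dots> = (\<Sum>s=1..M. real s * real (card (S s)) * (\<Sum>t=1..M. k s t))
     + (\<Sum>t=1..M. real t * real (card (T t)) * (\<Sum>s=1..M. k t s))"
    by (simp add: sum_distrib_left)
  also have "\<dots> \<le> (\<Sum>s=1..M. real s * real (card (S s)) * c) + (\<Sum>t=1..M. real t * real (card (T t)) * c)"
    by (intro add_mono sum_mono mult_left_mono ksum) auto
  also have "\<dots> = c * ((\<Sum>s=1..M. real s * real (card (S s))) + (\<Sum>t=1..M. real t * real (card (T t))))"
    by (simp only: sum_distrib_right[symmetric] distrib_left mult.commute[of c])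
  also have "\<dots> \<le> c * ((\<Sum>i\<in>I. (real (a i))\<^sup>2) + (\<Sum>j\<in>I. (real (b j))\<^sup>2))"
    unfolding S_def T_def
    by (intro mult_left_mono[OF _ c0] add_mono sum_level_cards_le fin Ma Mb)
  finally show ?thesis unfolding eq c_def .
qed

text \<open>Both sides are homogeneous of degree two, so the integer inequality holds for multiples
  of \<open>1 / m\<close>. Rounding down does not increase the right-hand side, and \<open>m\<close>
  tends to infinity.\<close>

lemma bilinear_bound_nonneg:
  fixes W :: "'a \<Rightarrow> 'a \<Rightarrow> real" and x y :: "'a \<Rightarrow> real"
  assumes nat: "\<And>a b :: 'a \<Rightarrow> nat. \<bar>\<Sum>i\<in>I. \<Sum>j\<in>I. real (a i) * W i j * real (b j)\<bar>
     \<le> c * ((\<Sum>i\<in>I. (real (a i))\<^sup>2) + (\<Sum>j\<in>I. (real (b j))\<^sup>2))"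
    and c: "c \<ge> 0" and x: "\<And>i. x i \<ge> 0" and y: "\<And>i. y i \<ge> 0"
  shows "\<bar>\<Sum>i\<in>I. \<Sum>j\<in>I. x i * W i j * y j\<bar> \<le> c * ((\<Sum>i\<in>I. (x i)\<^sup>2) + (\<Sum>j\<in>I. (y j)\<^sup>2))"
proof -
  define r where "r m (t::real) = real (nat \<lfloor>t * real m\<rfloor>) / real m" for m t
  have r_le: "0 \<le> r m t" "r m t \<le> t" if "t \<ge> 0" for m t
  proof -
    show "0 \<le> r m t" by (simp add: r_def)
    have "real (nat \<lfloor>t * real m\<rfloor>) \<le> t * real m" using that by (simp add: of_nat_nat)
    then show "r m t \<le> t" using that by (cases "m = 0") (auto simp: r_def field_simps)
  qed
  have r_lim: "(\<lambda>m. r m t) \<longlonglongrightarrow> t" if "t \<ge> 0" for t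
  proof (rule tendsto_sandwich[of "\<lambda>m. t - 1 / real m" _ _ "\<lambda>_. t"])
    show "\<forall>\<^sub>F m in sequentially. t - 1 / real m \<le> r m t"
    proof (rule eventually_mono[OF eventually_gt_at_top[of 0]])
      fix m :: nat assume m: "m > 0"
      have "t * real m - 1 \<le> real (nat \<lfloor>t * real m\<rfloor>)" using that by (simp add: of_nat_nat)
      then have "(t * real m - 1) / real m \<le> real (nat \<lfloor>t * real m\<rfloor>) / real m"
        by (rule divide_right_mono) simp
      then show "t - 1 / real m \<le> r m t" using m by (simp add: r_def diff_divide_distrib)
    qed
    show "(\<lambda>m. t - 1 / real m) \<longlonglongrightarrow> t"
      using tendsto_diff[OF tendsto_const[of t] lim_1_over_n] by simp
  qed (use r_le that in auto)
  have "(\<lambda>m. \<bar>\<Sum>i\<in>I. \<Sum>j\<in>I. r m (x i) * W i j * r m (y j)\<bar>) \<longlonglongrightarrow> \<bar>\<Sum>i\<in>I. \<Sum>j\<in>I. x i * W i j * y j\<bar>"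
    by (intro tendsto_intros r_lim x y)
  then show ?thesis
  proof (rule LIMSEQ_le_const2, intro exI allI impI)
    fix m :: nat assume m: "1 \<le> m"
    define a where "a i = nat \<lfloor>x i * real m\<rfloor>" for i
    define b where "b i = nat \<lfloor>y i * real m\<rfloor>" for i
    have "\<bar>\<Sum>i\<in>I. \<Sum>j\<in>I. r m (x i) * W i j * r m (y j)\<bar>
       = \<bar>(\<Sum>i\<in>I. \<Sum>j\<in>I. real (a i) * W i j * real (b j)) / (real m)\<^sup>2\<bar>"
      by (simp add: r_def a_def b_def sum_divide_distrib power2_eq_square)
    also have "\<dots> \<le> c * ((\<Sum>i\<in>I. (real (a i))\<^sup>2) + (\<Sum>j\<in>I. (real (b j))\<^sup>2)) / (real m)\<^sup>2"
      using nat[of a b] by (simp add: abs_divide divide_right_mono)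
    also have "\<dots> = c * ((\<Sum>i\<in>I. (r m (x i))\<^sup>2) + (\<Sum>j\<in>I. (r m (y j))\<^sup>2))"
      by (simp add: r_def a_def b_def power_divide add_divide_distrib distrib_left flip: sum_divide_distrib)
    also have "\<dots> \<le> c * ((\<Sum>i\<in>I. (x i)\<^sup>2) + (\<Sum>j\<in>I. (y j)\<^sup>2))"
      by (intro mult_left_mono add_mono sum_mono power_mono r_le x y c)
    finally show "\<bar>\<Sum>i\<in>I. \<Sum>j\<in>I. r m (x i) * W i j * r m (y j)\<bar>
       \<le> c * ((\<Sum>i\<in>I. (x i)\<^sup>2) + (\<Sum>j\<in>I. (y j)\<^sup>2))" .
  qed
qed

text \<open>Positive and negative parts have disjoint supports, so their squared norms add up. Of
  the four resulting forms each part enters two, whence the factor 2.\<close>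

lemma bilinear_bound_signed:
  fixes W :: "'a \<Rightarrow> 'a \<Rightarrow> real" and x y :: "'a \<Rightarrow> real"
  assumes nn: "\<And>x y. (\<And>i. x i \<ge> 0) \<Longrightarrow> (\<And>i. y i \<ge> 0) \<Longrightarrow>
     \<bar>\<Sum>i\<in>I. \<Sum>j\<in>I. x i * W i j * y j\<bar> \<le> c * ((\<Sum>i\<in>I. (x i)\<^sup>2) + (\<Sum>j\<in>I. (y j)\<^sup>2))"
  shows "\<bar>\<Sum>i\<in>I. \<Sum>j\<in>I. x i * W i j * y j\<bar> \<le> 2 * c * ((\<Sum>i\<in>I. (x i)\<^sup>2) + (\<Sum>j\<in>I. (y j)\<^sup>2))"
proof -
  define p where "p z i = max 0 (z i)" for z :: "'a \<Rightarrow> real" and i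
  define m where "m z i = max 0 (- z i)" for z :: "'a \<Rightarrow> real" and i
  have z: "z i = p z i - m z i" for z i by (simp add: p_def m_def)
  have sq: "(\<Sum>i\<in>I. (z i)\<^sup>2) = (\<Sum>i\<in>I. (p z i)\<^sup>2) + (\<Sum>i\<in>I. (m z i)\<^sup>2)" for z
    by (simp add: p_def m_def max_def power2_eq_square flip: sum.distrib)
       (intro sum.cong refl, auto)
  define F where "F x y = (\<Sum>i\<in>I. \<Sum>j\<in>I. x i * W i j * y j)" for x y :: "'a \<Rightarrow> real"
  have "F x y = F (p x) (p y) - F (p x) (m y) - F (m x) (p y) + F (m x) (m y)"
    unfolding F_def
    by (simp add: z[of x] z[of y] algebra_simps sum.distrib sum_subtractf)
  moreover have "\<bar>F (f x) (g y)\<bar> \<le> c * ((\<Sum>i\<in>I. (f x i)\<^sup>2) + (\<Sum>j\<in>I. (g y j)\<^sup>2))"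
    if "f = p \<or> f = m" "g = p \<or> g = m" for f g
    unfolding F_def by (rule nn) (use that in \<open>auto simp: p_def m_def\<close>)
  then have "\<bar>F (p x) (p y)\<bar> \<le> c * ((\<Sum>i\<in>I. (p x i)\<^sup>2) + (\<Sum>j\<in>I. (p y j)\<^sup>2))"
    "\<bar>F (p x) (m y)\<bar> \<le> c * ((\<Sum>i\<in>I. (p x i)\<^sup>2) + (\<Sum>j\<in>I. (m y j)\<^sup>2))"
    "\<bar>F (m x) (p y)\<bar> \<le> c * ((\<Sum>i\<in>I. (m x i)\<^sup>2) + (\<Sum>j\<in>I. (p y j)\<^sup>2))"
    "\<bar>F (m x) (m y)\<bar> \<le> c * ((\<Sum>i\<in>I. (m x i)\<^sup>2) + (\<Sum>j\<in>I. (m y j)\<^sup>2))"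
    by blast+
  ultimately have "\<bar>F x y\<bar> \<le> 2 * c * ((\<Sum>i\<in>I. (p x i)\<^sup>2) + (\<Sum>i\<in>I. (m x i)\<^sup>2)
      + ((\<Sum>j\<in>I. (p y j)\<^sup>2) + (\<Sum>j\<in>I. (m y j)\<^sup>2)))"
    by (simp add: algebra_simps abs_le_iff)
  then show ?thesis unfolding F_def sq[of x] sq[of y] .
qed

text \<open>The form is tested on \<open>s\<close> times the image of \<open>z\<close> against
  \<open>z\<close> itself. The choice \<open>s = sqrt (Z / V)\<close> makes the two squared norms on
  the right equal and turns the sum into a product.\<close>

lemma operator_bound_of_bilinear:
  fixes W :: "'a \<Rightarrow> 'a \<Rightarrow> real" and z :: "'a \<Rightarrow> real"
  assumes bil: "\<And>x y. \<bar>\<Sum>i\<in>I. \<Sum>j\<in>I. x i * W i j * y j\<bar> \<le> c * ((\<Sum>i\<in>I. (x i)\<^sup>2) + (\<Sum>j\<in>I. (y j)\<^sup>2))"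
  shows "(\<Sum>i\<in>I. (\<Sum>j\<in>I. W i j * z j)\<^sup>2) \<le> (2 * c)\<^sup>2 * (\<Sum>j\<in>I. (z j)\<^sup>2)"
proof -
  define v where "v i = (\<Sum>j\<in>I. W i j * z j)" for i
  define V where "V = (\<Sum>i\<in>I. (v i)\<^sup>2)"
  define Z where "Z = (\<Sum>j\<in>I. (z j)\<^sup>2)"
  have V0: "V \<ge> 0" and Z0: "Z \<ge> 0" by (auto simp: V_def Z_def sum_nonneg)
  have key: "\<bar>s * V\<bar> \<le> c * (s\<^sup>2 * V + Z)" for s
  proof -
    have "(\<Sum>i\<in>I. \<Sum>j\<in>I. (s * v i) * W i j * z j) = s * V"
      by (simp add: V_def v_def power2_eq_square sum_distrib_left sum_distrib_right ac_simps)
    moreover have "(\<Sum>i\<in>I. (s * v i)\<^sup>2) = s\<^sup>2 * V"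
      by (simp add: V_def power_mult_distrib sum_distrib_left)
    ultimately show ?thesis using bil[of "\<lambda>i. s * v i" z] by (simp add: Z_def)
  qed
  have "V \<le> (2 * c)\<^sup>2 * Z"
  proof (cases "V = 0 \<or> Z = 0")
    case True
    then show ?thesis
    proof
      \<comment> \<open>Testing with \<open>s = 1\<close> shows \<open>c \<ge> 1\<close> if
        \<open>V\<close> is positive; then \<open>s = 1 / (2 * c)\<close> is contradictory, as the
        right-hand side is quadratic in \<open>s\<close>.\<close>
      assume Z: "Z = 0"
      have "V \<le> 0"
      proof (rule ccontr)
        assume "\<not> V \<le> 0"
        then have V: "V > 0" by simp
        have k1: "V \<le> c * V" using key[of 1] Z V by simp
        then have c: "c \<ge> 1" using V by (simp add: mult_le_cancel_right2)
        have "1 / (2 * c) * V \<le> c * ((1 / (2 * c))\<^sup>2 * V)" using key[of "1 / (2 * c)"] Z V c by simp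
        then show False using V c by (simp add: field_simps power2_eq_square)
      qed
      then show ?thesis using Z by simp
    qed (use Z0 in auto)
  next
    case False
    then have V: "V > 0" and Z: "Z > 0" using V0 Z0 by auto
    define s where "s = sqrt (Z / V)"
    have s: "s > 0" "s\<^sup>2 * V = Z" using V Z by (auto simp: s_def)
    have "s * V \<le> 2 * c * Z" using key[of s] s V by simp
    then have "(s * V)\<^sup>2 \<le> (2 * c * Z)\<^sup>2" using s V by (intro power_mono) auto
    moreover have "(s * V)\<^sup>2 = Z * V" using s(2) by (simp add: power_mult_distrib power2_eq_square ac_simps)
    moreover have "(2 * c * Z)\<^sup>2 = Z * ((2 * c)\<^sup>2 * Z)" by (simp add: power2_eq_square)
    ultimately show ?thesis using Z by (simp add: mult_le_cancel_left)
  qed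
  then show ?thesis by (simp add: V_def Z_def v_def)
qed

text \<open>The factor 4 collects a 2 from the splitting into signs and a 2 from the passage from
  forms to the operator norm.\<close>

lemma discrepancy_operator_bound:
  fixes W :: "'a \<Rightarrow> 'a \<Rightarrow> real" and z :: "'a \<Rightarrow> real" and R :: nat
  assumes fin: "finite I" and R: "R > 0" and g0: "\<gamma> \<ge> 0" and D0: "D \<ge> 0"
    and disc: "\<And>S T. S \<subseteq> I \<Longrightarrow> T \<subseteq> I \<Longrightarrow>
       \<bar>\<Sum>i\<in>S. \<Sum>j\<in>T. W i j\<bar> \<le> \<gamma> * sqrt (real (card S) * real (card T))"
    and rows: "\<And>i. i \<in> I \<Longrightarrow> (\<Sum>j\<in>I. \<bar>W i j\<bar>) \<le> D"
    and cols: "\<And>j. j \<in> I \<Longrightarrow> (\<Sum>i\<in>I. \<bar>W i j\<bar>) \<le> D"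
  shows "(\<Sum>i\<in>I. (\<Sum>j\<in>I. W i j * z j)\<^sup>2)
    \<le> (4 * (\<gamma> * (real R)\<^sup>2 + D / real R))\<^sup>2 * (\<Sum>j\<in>I. (z j)\<^sup>2)"
proof -
  let ?c = "\<gamma> * (real R)\<^sup>2 + D / real R"
  have c: "?c \<ge> 0" using g0 D0 by simp
  note 1 = discrepancy_bilinear_nat[OF fin R g0 D0 disc rows cols]
  have 2: "\<bar>\<Sum>i\<in>I. \<Sum>j\<in>I. x i * W i j * y j\<bar> \<le> ?c * ((\<Sum>i\<in>I. (x i)\<^sup>2) + (\<Sum>j\<in>I. (y j)\<^sup>2))"
    if "\<And>i. x i \<ge> 0" "\<And>i. y i \<ge> 0" for x y
    by (rule bilinear_bound_nonneg[OF 1 c that])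
  have 3: "\<bar>\<Sum>i\<in>I. \<Sum>j\<in>I. x i * W i j * y j\<bar> \<le> 2 * ?c * ((\<Sum>i\<in>I. (x i)\<^sup>2) + (\<Sum>j\<in>I. (y j)\<^sup>2))" for x y
    by (rule bilinear_bound_signed[OF 2])
  show ?thesis using operator_bound_of_bilinear[OF 3, of z] by (simp add: mult.assoc)
qed

section \<open>Finitely supported sequences as an inner product space\<close>

text \<open>A single inner product space containing all Euclidean spaces, as the dimension is a term.\<close>

typedef fvec = "{f :: nat \<Rightarrow> real. finite {i. f i \<noteq> 0}}"
  morphisms coord Abs_fvec
  by (rule exI[of _ "\<lambda>_. 0"]) simp

setup_lifting type_definition_fvec

lemma finite_coord [simp]: "finite {i. coord x i \<noteq> 0}"
  using coord[of x] by simp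

instantiation fvec :: real_inner
begin

lift_definition zero_fvec :: fvec is "\<lambda>_. 0" by simp
lift_definition plus_fvec :: "fvec \<Rightarrow> fvec \<Rightarrow> fvec" is "\<lambda>f g i. f i + g i"
proof -
  fix f g :: "nat \<Rightarrow> real"
  assume "finite {i. f i \<noteq> 0}" "finite {i. g i \<noteq> 0}"
  then have "finite ({i. f i \<noteq> 0} \<union> {i. g i \<noteq> 0})" by simp
  then show "finite {i. f i + g i \<noteq> 0}" by (rule finite_subset[rotated]) auto
qed
lift_definition uminus_fvec :: "fvec \<Rightarrow> fvec" is "\<lambda>f i. - f i" by simp
lift_definition minus_fvec :: "fvec \<Rightarrow> fvec \<Rightarrow> fvec" is "\<lambda>f g i. f i - g i"
proof -
  fix f g :: "nat \<Rightarrow> real"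
  assume "finite {i. f i \<noteq> 0}" "finite {i. g i \<noteq> 0}"
  then have "finite ({i. f i \<noteq> 0} \<union> {i. g i \<noteq> 0})" by simp
  then show "finite {i. f i - g i \<noteq> 0}" by (rule finite_subset[rotated]) auto
qed
lift_definition scaleR_fvec :: "real \<Rightarrow> fvec \<Rightarrow> fvec" is "\<lambda>c f i. c * f i"
  by (rule finite_subset[rotated]) auto

definition inner_fvec :: "fvec \<Rightarrow> fvec \<Rightarrow> real" where
  "inner_fvec x y = (\<Sum>i | coord x i \<noteq> 0. coord x i * coord y i)"
definition norm_fvec :: "fvec \<Rightarrow> real" where "norm_fvec x = sqrt (inner x x)"
definition dist_fvec :: "fvec \<Rightarrow> fvec \<Rightarrow> real" where "dist_fvec x y = norm (x - y)"
definition sgn_fvec :: "fvec \<Rightarrow> fvec" where "sgn_fvec x = inverse (norm x) *\<^sub>R x"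
definition uniformity_fvec :: "(fvec \<times> fvec) filter" where
  "uniformity_fvec = (INF e\<in>{0 <..}. principal {(x, y). dist x y < e})"
definition open_fvec :: "fvec set \<Rightarrow> bool" where
  "open_fvec U \<longleftrightarrow> (\<forall>x\<in>U. eventually (\<lambda>(x', y). x' = x \<longrightarrow> y \<in> U) uniformity)"

lemma inner_fvec_superset:
  assumes "finite J" "{i. coord x i \<noteq> 0} \<subseteq> J"
  shows "inner x y = (\<Sum>i\<in>J. coord x i * coord y i)"
  unfolding inner_fvec_def by (rule sum.mono_neutral_left) (use assms in auto)

instance
proof
  fix x y z :: fvec and a b :: real
  show "x + y + z = x + (y + z)" "x + y = y + x" "0 + x = x" "- x + x = 0" "x - y = x + - y"
    "a *\<^sub>R (x + y) = a *\<^sub>R x + a *\<^sub>R y" "(a + b) *\<^sub>R x = a *\<^sub>R x + b *\<^sub>R x"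
    "a *\<^sub>R b *\<^sub>R x = (a * b) *\<^sub>R x" "1 *\<^sub>R x = x"
    by (transfer; simp add: algebra_simps fun_eq_iff)+
  let ?J = "{i. coord x i \<noteq> 0} \<union> {i. coord y i \<noteq> 0} \<union> {i. coord z i \<noteq> 0}"
  have J: "finite ?J" by simp
  have 1: "inner u v = (\<Sum>i\<in>?J. coord u i * coord v i)" if "u \<in> {x, y, x + y, a *\<^sub>R x}" for u v
    by (rule inner_fvec_superset[OF J])
       (use that in \<open>auto simp: plus_fvec.rep_eq scaleR_fvec.rep_eq\<close>)
  show "inner x y = inner y x" by (simp add: 1 mult.commute)
  show "inner (x + y) z = inner x z + inner y z"
    by (simp add: 1 plus_fvec.rep_eq algebra_simps sum.distrib)
  show "inner (a *\<^sub>R x) y = a * inner x y"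
    by (simp add: 1 scaleR_fvec.rep_eq sum_distrib_left mult.assoc)
  show "0 \<le> inner x x" by (simp add: inner_fvec_def sum_nonneg)
  have "inner x x = 0 \<longleftrightarrow> (\<forall>i\<in>{i. coord x i \<noteq> 0}. coord x i * coord x i = 0)"
    unfolding inner_fvec_def by (rule sum_nonneg_eq_0_iff) auto
  also have "\<dots> \<longleftrightarrow> (\<forall>i. coord x i = 0)" by auto
  also have "\<dots> \<longleftrightarrow> x = 0" by (metis coord_inject ext zero_fvec.rep_eq)
  finally show "inner x x = 0 \<longleftrightarrow> x = 0" .
qed (simp_all add: norm_fvec_def dist_fvec_def sgn_fvec_def uniformity_fvec_def open_fvec_def)

end

definition fv :: "nat \<Rightarrow> (nat \<Rightarrow> real) \<Rightarrow> fvec" where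
  "fv n f = Abs_fvec (\<lambda>i. if i < n then f i else 0)"

lemma coord_fv: "coord (fv n f) i = (if i < n then f i else 0)"
  unfolding fv_def by (subst Abs_fvec_inverse) auto

lemma fvec_eqI: "(\<And>i. coord x i = coord y i) \<Longrightarrow> x = y"
  by (metis coord_inject ext)

lemma coord_simps:
  "coord (x + y) i = coord x i + coord y i" "coord (x - y) i = coord x i - coord y i"
  "coord (c *\<^sub>R x) i = c * coord x i" "coord 0 i = 0" "coord (- x) i = - coord x i"
  by (simp_all add: plus_fvec.rep_eq minus_fvec.rep_eq scaleR_fvec.rep_eq zero_fvec.rep_eq uminus_fvec.rep_eq)

lemma inner_fv: "inner (fv n f) x = (\<Sum>i<n. f i * coord x i)"
  by (subst inner_fvec_superset[of "{..<n}"]) (auto simp: coord_fv split: if_splits)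

lemma inner_fv2: "inner (fv n f) (fv n g) = (\<Sum>i<n. f i * g i)"
  by (simp add: inner_fv coord_fv)

lemma norm_fv_sq: "(norm (fv n f))\<^sup>2 = (\<Sum>i<n. (f i)\<^sup>2)"
  unfolding power2_norm_eq_inner by (simp add: inner_fv2 power2_eq_square)

lemma fv_coord: "(\<And>i. i \<ge> n \<Longrightarrow> coord x i = 0) \<Longrightarrow> fv n (coord x) = x"
  by (rule fvec_eqI) (auto simp: coord_fv)

lemma sum_coord_sq_le: "(\<Sum>i<n. (coord x i)\<^sup>2) \<le> (norm x)\<^sup>2"
proof -
  have "(\<Sum>i<n. (coord x i)\<^sup>2) \<le> (\<Sum>i\<in>{..<n} \<union> {i. coord x i \<noteq> 0}. (coord x i)\<^sup>2)"
    by (rule sum_mono2) auto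
  also have "\<dots> = (norm x)\<^sup>2"
    unfolding power2_norm_eq_inner
    by (subst inner_fvec_superset[of "{..<n} \<union> {i. coord x i \<noteq> 0}"]) (auto simp: power2_eq_square)
  finally show ?thesis .
qed

text \<open>Coordinates from \<open>n\<close> on are ignored in the argument and vanish in the
  value. Entries are a function so that the adjacency matrix and its centred version are treated
  alike.\<close>

definition mat_op :: "nat \<Rightarrow> (nat \<Rightarrow> nat \<Rightarrow> real) \<Rightarrow> fvec \<Rightarrow> fvec" where
  "mat_op n A z = fv n (\<lambda>i. \<Sum>j<n. A i j * coord z j)"

lemma linear_mat_op: "linear (mat_op n A)"
  by (rule linearI; rule fvec_eqI)
     (simp_all add: mat_op_def coord_fv coord_simps algebra_simps sum.distrib sum_distrib_left)

lemma mat_op_sym: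
  assumes "\<And>i j. i < n \<Longrightarrow> j < n \<Longrightarrow> A i j = A j i"
  shows "inner (mat_op n A x) y = inner x (mat_op n A y)"
proof -
  have "inner (mat_op n A x) y = (\<Sum>i<n. \<Sum>j<n. A i j * coord x j * coord y i)"
    by (simp add: mat_op_def inner_fv sum_distrib_right)
  also have "\<dots> = (\<Sum>j<n. \<Sum>i<n. A i j * coord x j * coord y i)" by (rule sum.swap)
  also have "\<dots> = (\<Sum>j<n. \<Sum>i<n. A j i * coord y i * coord x j)"
    by (intro sum.cong refl) (use assms in auto)
  also have "\<dots> = inner (mat_op n A y) x" by (simp add: mat_op_def inner_fv sum_distrib_right)
  finally show ?thesis by (simp add: inner_commute)
qed

section \<open>Block power iteration near an invariant plane\<close>

text \<open>In the application \<open>e1\<close> and \<open>e2\<close> are the normalised all-one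
  and label vectors, \<open>a = n (p + q) / 2\<close>, \<open>b = n (p - q) / 2\<close>, and
  \<open>W\<close> is the centred adjacency operator. The condition \<open>8 * w \<le> b\<close>
  makes the cone around the span of \<open>e1\<close> and \<open>e2\<close> invariant.\<close>

locale perturbed_rank_two =
  fixes T W :: "'a::real_inner \<Rightarrow> 'a" and e1 e2 :: 'a and a b w :: real
  assumes T: "\<And>z. T z = (a * inner e1 z) *\<^sub>R e1 + (b * inner e2 z) *\<^sub>R e2 + W z"
    and linear_W: "linear W"
    and W_sym: "\<And>x y. inner (W x) y = inner x (W y)"
    and W_bound: "\<And>z. norm (W z) \<le> w * norm z"
    and e: "norm e1 = 1" "norm e2 = 1" "inner e1 e2 = 0"
    and ab: "0 < b" "b < a" and w: "0 \<le> w" "8 * w \<le> b"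
begin

definition pU :: "'a \<Rightarrow> 'a" where "pU z = inner e1 z *\<^sub>R e1 + inner e2 z *\<^sub>R e2"
definition pV :: "'a \<Rightarrow> 'a" where "pV z = z - pU z"

lemma ee: "inner e1 e1 = 1" "inner e2 e2 = 1" "inner e2 e1 = 0"
  using e by (simp_all add: norm_eq_1 inner_commute)

lemma linear_T: "linear T"
  unfolding T
  by (rule linearI)
     (simp_all add: linear_add[OF linear_W] linear_cmul[OF linear_W] inner_simps algebra_simps)

lemma T_sym: "inner (T x) y = inner x (T y)"
  using W_sym[of x y] by (simp add: T inner_simps inner_commute)

lemma linear_Tn: "linear (T ^^ k)"
  by (induction k) (simp_all add: linear_id linear_compose[OF _ linear_T, unfolded comp_def] id_def[symmetric] comp_def)

lemma Tn_sym: "inner ((T ^^ k) x) y = inner x ((T ^^ k) y)"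
proof (induction k arbitrary: x y)
  case (Suc k)
  have "inner ((T ^^ Suc k) x) y = inner ((T ^^ k) x) (T y)" by (simp add: T_sym)
  also have "\<dots> = inner x ((T ^^ k) (T y))" by (rule Suc)
  finally show ?case by (simp add: funpow_swap1)
qed simp

lemma linear_pU: "linear pU"
  unfolding pU_def by (rule linearI) (simp_all add: inner_simps algebra_simps)

lemma linear_pV: "linear pV"
  unfolding pV_def by (rule linearI) (simp_all add: linear_add[OF linear_pU] linear_cmul[OF linear_pU] algebra_simps)

lemma inner_e_pV: "inner e1 (pV z) = 0" "inner e2 (pV z) = 0"
  by (simp_all add: pV_def pU_def inner_simps ee e)

lemma norm_pU_sq: "(norm (pU z))\<^sup>2 = (inner e1 z)\<^sup>2 + (inner e2 z)\<^sup>2"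
  unfolding power2_norm_eq_inner by (simp add: pU_def inner_simps ee e power2_eq_square)

lemma pU_pV_orth: "inner (pU x) (pV y) = 0"
  using inner_e_pV[of y] by (simp add: pU_def inner_simps)

lemma norm_sq_split: "(norm z)\<^sup>2 = (norm (pU z))\<^sup>2 + (norm (pV z))\<^sup>2"
proof -
  have "z = pU z + pV z" by (simp add: pV_def)
  then have "(norm z)\<^sup>2 = inner (pU z + pV z) (pU z + pV z)" by (simp add: power2_norm_eq_inner)
  also have "\<dots> = inner (pU z) (pU z) + inner (pV z) (pV z)"
    using pU_pV_orth[of z z] by (simp add: inner_simps inner_commute)
  finally show ?thesis by (simp add: power2_norm_eq_inner)
qed

lemma norm_pU_le: "norm (pU z) \<le> norm z" and norm_pV_le: "norm (pV z) \<le> norm z"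
  by (rule power2_le_imp_le; simp add: norm_sq_split[of z])+

lemma norm_le_split: "norm z \<le> norm (pU z) + norm (pV z)"
  using norm_triangle_ineq[of "pU z" "pV z"] by (simp add: pV_def)

lemma pV_T: "pV (T z) = pV (W z)"
proof -
  have "pU (T z) = (a * inner e1 z) *\<^sub>R e1 + (b * inner e2 z) *\<^sub>R e2 + pU (W z)"
    by (simp add: pU_def T inner_simps ee e algebra_simps)
  then show ?thesis by (simp add: pV_def T)
qed

lemma norm_pV_T: "norm (pV (T z)) \<le> w * norm z"
  using norm_pV_le[of "W z"] W_bound[of z] by (simp add: pV_T)

lemma norm_pU_T: "b * norm (pU z) - w * norm z \<le> norm (pU (T z))"
proof -
  define m where "m = (a * inner e1 z) *\<^sub>R e1 + (b * inner e2 z) *\<^sub>R e2"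
  have eq: "pU (T z) = m + pU (W z)"
    by (simp add: pU_def T m_def inner_simps ee e algebra_simps)
  have "(b * norm (pU z))\<^sup>2 \<le> (norm m)\<^sup>2"
  proof -
    have "(norm m)\<^sup>2 = a\<^sup>2 * (inner e1 z)\<^sup>2 + b\<^sup>2 * (inner e2 z)\<^sup>2"
      unfolding power2_norm_eq_inner by (simp add: m_def inner_simps ee e power2_eq_square)
    moreover have "b\<^sup>2 * (inner e1 z)\<^sup>2 \<le> a\<^sup>2 * (inner e1 z)\<^sup>2"
      using ab by (intro mult_right_mono power_mono) auto
    ultimately show ?thesis by (simp add: power_mult_distrib norm_pU_sq distrib_left)
  qed
  then have "b * norm (pU z) \<le> norm m" by (rule power2_le_imp_le) simp
  moreover have "norm (pU (W z)) \<le> w * norm z" using norm_pU_le[of "W z"] W_bound[of z] by simp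
  moreover have "norm m \<le> norm (pU (T z)) + norm (pU (W z))"
    using norm_triangle_ineq4[of "m + pU (W z)" "pU (W z)"] by (simp add: eq)
  ultimately show ?thesis by linarith
qed

text \<open>Inside the cone \<open>norm z\<close> is at most twice \<open>norm (pU z)\<close>, so
  the noise is at most a quarter of \<open>b * norm (pU z)\<close>, and a growth factor
  \<open>b / 2\<close> remains. The image even lies in a cone of slope \<open>4 * w / b\<close>,
  which is at most one half.\<close>

lemma cone_step:
  assumes "norm (pV z) \<le> norm (pU z)"
  shows "norm (pV (T z)) \<le> 4 * w / b * norm (pU (T z))"
    and "b / 2 * norm (pU z) \<le> norm (pU (T z))"
    and "norm (pV (T z)) \<le> norm (pU (T z))"
proof -
  have z: "norm z \<le> 2 * norm (pU z)" using norm_le_split[of z] assms by simp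
  then have wz: "w * norm z \<le> w * (2 * norm (pU z))" using w by (intro mult_left_mono) auto
  have "8 * w * norm (pU z) \<le> b * norm (pU z)" using w by (intro mult_right_mono) auto
  then have "w * (2 * norm (pU z)) \<le> b / 4 * norm (pU z)" by (simp add: algebra_simps)
  moreover have "b * norm (pU z) = b / 2 * norm (pU z) + 2 * (b / 4 * norm (pU z))" by simp
  moreover have "0 \<le> b / 4 * norm (pU z)" using ab by simp
  ultimately show 2: "b / 2 * norm (pU z) \<le> norm (pU (T z))"
    using wz norm_pU_T[of z] by linarith
  have "norm (pV (T z)) \<le> 2 * w * norm (pU z)" using norm_pV_T[of z] wz by simp
  also have "\<dots> = 4 * w / b * (b / 2 * norm (pU z))" using ab by simp
  also have "\<dots> \<le> 4 * w / b * norm (pU (T z))" using w ab by (intro mult_left_mono 2) auto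
  finally show 1: "norm (pV (T z)) \<le> 4 * w / b * norm (pU (T z))" .
  also have "\<dots> \<le> 1 * norm (pU (T z))" using w ab by (intro mult_right_mono) auto
  finally show "norm (pV (T z)) \<le> norm (pU (T z))" by simp
qed

lemma cone_funpow:
  assumes "norm (pV z) \<le> norm (pU z)"
  shows "norm (pV ((T ^^ k) z)) \<le> norm (pU ((T ^^ k) z)) \<and>
    (b / 2) ^ k * norm (pU z) \<le> norm (pU ((T ^^ k) z))"
proof (induction k)
  case (Suc k)
  have "b / 2 * ((b / 2) ^ k * norm (pU z)) \<le> b / 2 * norm (pU ((T ^^ k) z))"
    using Suc ab by (intro mult_left_mono) auto
  then show ?case using cone_step[of "(T ^^ k) z"] Suc by auto
qed (use assms in auto)

text \<open>A vector whose orbit ends outside the cone around the leading plane can never have been in it.\<close>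

lemma complement_decay:
  assumes "pU ((T ^^ m) r) = 0"
  shows "norm ((T ^^ m) r) \<le> (2 * w) ^ m * norm r"
proof -
  \<comment> \<open>An iterate strictly inside the cone has a nonzero component in the plane, and
    this component would survive until step \<open>m\<close>.\<close>
  have out: "norm (pU ((T ^^ k) r)) \<le> norm (pV ((T ^^ k) r))" if k: "k \<le> m" for k
  proof (rule ccontr)
    assume c: "\<not> ?thesis"
    have "(T ^^ (m - k)) ((T ^^ k) r) = (T ^^ m) r"
      using k by (metis comp_apply funpow_add le_add_diff_inverse2)
    then have "(b / 2) ^ (m - k) * norm (pU ((T ^^ k) r)) \<le> 0"
      using cone_funpow[of "(T ^^ k) r" "m - k"] c assms by simp
    moreover have "0 < norm (pU ((T ^^ k) r))" using c norm_ge_zero[of "pV ((T ^^ k) r)"] by linarith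
    moreover have "0 < (b / 2) ^ (m - k)" using ab by simp
    ultimately show False by (simp add: mult_le_0_iff)
  qed
  \<comment> \<open>Outside the cone \<open>pV\<close> carries at least half of the norm, and only
    \<open>W\<close> feeds it; hence the factor \<open>2 * w\<close> per step.\<close>
  have dec: "norm (pV ((T ^^ k) r)) \<le> (2 * w) ^ k * norm r" if "k \<le> m" for k
    using that
  proof (induction k)
    case 0
    then show ?case using norm_pV_le by simp
  next
    case (Suc k)
    have "norm ((T ^^ k) r) \<le> 2 * norm (pV ((T ^^ k) r))"
      using norm_le_split[of "(T ^^ k) r"] out[of k] Suc.prems by simp
    then have "w * norm ((T ^^ k) r) \<le> w * (2 * norm (pV ((T ^^ k) r)))"
      using w by (intro mult_left_mono) auto
    also have "\<dots> = 2 * w * norm (pV ((T ^^ k) r))" by simp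
    also have "\<dots> \<le> 2 * w * ((2 * w) ^ k * norm r)" using Suc w by (intro mult_left_mono) auto
    finally show ?case using norm_pV_T[of "(T ^^ k) r"] by simp
  qed
  have "norm ((T ^^ m) r) \<le> norm (pV ((T ^^ m) r))"
    using norm_le_split[of "(T ^^ m) r"] assms by simp
  then show ?thesis using dec[of m] by simp
qed

lemma pU_span:
  "pU (x *\<^sub>R e1 + y *\<^sub>R e2) = x *\<^sub>R e1 + y *\<^sub>R e2" "pV (x *\<^sub>R e1 + y *\<^sub>R e2) = 0"
  by (simp_all add: pV_def pU_def inner_simps ee e)

text \<open>
  The image of the leading plane under \<open>T ^^ N\<close> replaces the leading eigenspace: its orthogonal
  complement is mapped by \<open>T ^^ N\<close> into the complement of the leading plane, by self-adjointness.
\<close>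

lemma image_plane_basis:
  obtains g1 g2 where "norm g1 = 1" "norm g2 = 1" "inner g1 g2 = 0"
    "\<exists>x y. g1 = (T ^^ N) (x *\<^sub>R e1 + y *\<^sub>R e2)"
    "\<exists>x y. g2 = (T ^^ N) (x *\<^sub>R e1 + y *\<^sub>R e2)"
    "\<And>r. inner g1 r = 0 \<Longrightarrow> inner g2 r = 0 \<Longrightarrow> pU ((T ^^ N) r) = 0"
proof -
  note lin = linear_Tn[of N]
  define h1 where "h1 = (T ^^ N) e1"
  define h2 where "h2 = (T ^^ N) e2"
  have comb: "(T ^^ N) (x *\<^sub>R e1 + y *\<^sub>R e2) = x *\<^sub>R h1 + y *\<^sub>R h2" for x y
    by (simp add: h1_def h2_def linear_add[OF lin] linear_cmul[OF lin])
  \<comment> \<open>The plane lies in the cone, so \<open>T ^^ N\<close> expands it and is injective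
    on it.\<close>
  have indep: "x = 0 \<and> y = 0" if "x *\<^sub>R h1 + y *\<^sub>R h2 = 0" for x y
  proof -
    have "(b / 2) ^ N * norm (x *\<^sub>R e1 + y *\<^sub>R e2) \<le> norm (pU (x *\<^sub>R h1 + y *\<^sub>R h2))"
      using cone_funpow[of "x *\<^sub>R e1 + y *\<^sub>R e2" N] by (simp add: pU_span comb)
    then have "(b / 2) ^ N * norm (x *\<^sub>R e1 + y *\<^sub>R e2) \<le> 0" using that by (simp add: pU_def)
    moreover have "0 < (b / 2) ^ N" using ab by simp
    ultimately have "x *\<^sub>R e1 + y *\<^sub>R e2 = 0" by (simp add: mult_le_0_iff)
    then have "inner e1 (x *\<^sub>R e1 + y *\<^sub>R e2) = 0" "inner e2 (x *\<^sub>R e1 + y *\<^sub>R e2) = 0" by simp_all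
    then show ?thesis by (simp add: inner_simps ee e)
  qed
  have h1: "h1 \<noteq> 0" using indep[of 1 0] by auto
  define g1 where "g1 = (1 / norm h1) *\<^sub>R h1"
  define k where "k = h2 - inner g1 h2 *\<^sub>R g1"
  define g2 where "g2 = (1 / norm k) *\<^sub>R k"
  have g1: "norm g1 = 1" using h1 by (simp add: g1_def)
  then have g11: "inner g1 g1 = 1" by (simp add: norm_eq_1)
  have k_comb: "k = (- inner g1 h2 / norm h1) *\<^sub>R h1 + 1 *\<^sub>R h2" by (simp add: k_def g1_def)
  have k: "k \<noteq> 0" using indep[of "- inner g1 h2 / norm h1" 1] unfolding k_comb by auto
  have g2: "norm g2 = 1" using k by (simp add: g2_def)
  have orth: "inner g1 g2 = 0" by (simp add: g2_def k_def inner_simps g11)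
  have "g1 = (T ^^ N) ((1 / norm h1) *\<^sub>R e1 + 0 *\<^sub>R e2)" unfolding comb by (simp add: g1_def)
  moreover have "g2 = (T ^^ N) ((1 / norm k * (- inner g1 h2 / norm h1)) *\<^sub>R e1 + (1 / norm k) *\<^sub>R e2)"
    unfolding comb g2_def by (subst (2) k_comb) (simp add: scaleR_add_right scaleR_diff_right)
  moreover have "pU ((T ^^ N) r) = 0" if r: "inner g1 r = 0" "inner g2 r = 0" for r
  proof -
    have "h1 = norm h1 *\<^sub>R g1" using h1 by (simp add: g1_def)
    then have 1: "inner h1 r = 0" using r by (metis inner_scaleR_left mult_zero_right)
    have "h2 = norm k *\<^sub>R g2 + inner g1 h2 *\<^sub>R g1" using k by (simp add: g2_def k_def)
    then have 2: "inner h2 r = 0" using r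
      by (metis add.right_neutral inner_add_left inner_scaleR_left mult_zero_right)
    show ?thesis using 1 2 by (simp add: pU_def h1_def h2_def Tn_sym)
  qed
  ultimately show thesis using that[OF g1 g2 orth] by blast
qed

text \<open>Write \<open>z = h + r\<close> with \<open>h\<close> the projection to the image plane.
  The part from \<open>h\<close> grows at least like \<open>(b / 2) ^ N\<close>, the part from
  \<open>r\<close> at most like \<open>(2 * w) ^ N\<close>, and \<open>K\<close> compares the two at
  the start. The ratio is \<open>(4 * w / b) ^ N\<close>: one factor is kept for the conclusion and
  \<open>N - 1\<close> factors cancel \<open>2 * K\<close>. The slope \<open>8 * w / b\<close> is
  \<open>4 * w / b\<close> once for \<open>h\<close> and once for \<open>r\<close>.\<close>

lemma block_power_alignment:
  assumes N: "N \<ge> 1" and g: "norm g1 = 1" "norm g2 = 1" "inner g1 g2 = 0"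
    and img: "\<exists>x y. g1 = (T ^^ N) (x *\<^sub>R e1 + y *\<^sub>R e2)"
      "\<exists>x y. g2 = (T ^^ N) (x *\<^sub>R e1 + y *\<^sub>R e2)"
    and comp: "\<And>r. inner g1 r = 0 \<Longrightarrow> inner g2 r = 0 \<Longrightarrow> pU ((T ^^ N) r) = 0"
    and z: "norm z \<le> K * norm (inner g1 z *\<^sub>R g1 + inner g2 z *\<^sub>R g2)" "z \<noteq> 0"
    and K: "2 * K * (4 * w / b) ^ (N - 1) \<le> 1"
  shows "pU ((T ^^ N) z) \<noteq> 0" "norm (pV ((T ^^ N) z)) \<le> 8 * w / b * norm (pU ((T ^^ N) z))"
proof -
  note lin = linear_Tn[of N]
  have gg: "inner g1 g1 = 1" "inner g2 g2 = 1" "inner g2 g1 = 0"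
    using g by (simp_all add: norm_eq_1 inner_commute)
  define h where "h = inner g1 z *\<^sub>R g1 + inner g2 z *\<^sub>R g2"
  define r where "r = z - h"
  have r: "inner g1 r = 0" "inner g2 r = 0" by (simp_all add: r_def h_def inner_simps gg g)
  have "(norm z)\<^sup>2 = (norm h)\<^sup>2 + (norm r)\<^sup>2"
  proof -
    have "inner h r = 0" using r by (simp add: h_def inner_simps)
    then have "inner (h + r) (h + r) = inner h h + inner r r" by (simp add: inner_simps inner_commute)
    then show ?thesis by (simp add: power2_norm_eq_inner r_def)
  qed
  then have "(norm r)\<^sup>2 \<le> (norm z)\<^sup>2" by simp
  then have rz: "norm r \<le> norm z" by (rule power2_le_imp_le) (rule norm_ge_zero)
  have zh: "norm z \<le> K * norm h" using z(1) by (simp only: h_def)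
  have "h \<noteq> 0"
  proof
    assume "h = 0"
    then have "norm z \<le> 0" using zh by simp
    then show False using z(2) by simp
  qed
  then have h0: "norm h > 0" by simp
  have K0: "K \<ge> 0"
  proof (rule ccontr)
    assume "\<not> K \<ge> 0"
    then have "K * norm h < 0" using h0 by (simp add: mult_neg_pos)
    then show False using zh norm_ge_zero[of z] by linarith
  qed
  obtain x1 y1 x2 y2 where x: "g1 = (T ^^ N) (x1 *\<^sub>R e1 + y1 *\<^sub>R e2)" "g2 = (T ^^ N) (x2 *\<^sub>R e1 + y2 *\<^sub>R e2)"
    using img by blast
  \<comment> \<open>A preimage of \<open>h\<close> in the leading plane; it shows that
    \<open>h\<close> itself lies in the cone.\<close>
  define f where "f = (inner g1 z * x1 + inner g2 z * x2) *\<^sub>R e1 + (inner g1 z * y1 + inner g2 z * y2) *\<^sub>R e2"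
  have hf: "h = (T ^^ N) f"
  proof -
    have "h = inner g1 z *\<^sub>R (T ^^ N) (x1 *\<^sub>R e1 + y1 *\<^sub>R e2) + inner g2 z *\<^sub>R (T ^^ N) (x2 *\<^sub>R e1 + y2 *\<^sub>R e2)"
      unfolding h_def x[symmetric] ..
    also have "\<dots> = (T ^^ N) f"
      by (simp add: f_def linear_add[OF lin] linear_cmul[OF lin] scaleR_add_left scaleR_add_right)
    finally show ?thesis .
  qed
  have "norm (pV f) \<le> norm (pU f)" by (simp add: f_def pU_span)
  then have hc: "norm (pV h) \<le> norm (pU h)" unfolding hf by (rule cone_funpow[THEN conjunct1])
  define s where "s = (T ^^ N) z"
  have s: "s = (T ^^ N) h + (T ^^ N) r" by (simp add: s_def r_def linear_diff[OF lin])
  have pUr: "pU ((T ^^ N) r) = 0" by (rule comp[OF r])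
  have pUs: "pU s = pU ((T ^^ N) h)" by (simp add: s linear_add[OF linear_pU] pUr)
  have grow: "(b / 2) ^ N * norm (pU h) \<le> norm (pU s)" unfolding pUs by (rule cone_funpow[OF hc, THEN conjunct2])
  have hU: "norm h \<le> 2 * norm (pU h)" using norm_le_split[of h] hc by simp
  then have pUh: "norm (pU h) > 0" using h0 by linarith
  have "0 < (b / 2) ^ N * norm (pU h)" using ab pUh by simp
  then have "norm (pU s) > 0" using grow by linarith
  then show "pU ((T ^^ N) z) \<noteq> 0" unfolding s_def by auto
  \<comment> \<open>The last step is split off, since only a step taken inside the cone gives the
    narrow slope \<open>4 * w / b\<close>.\<close>
  obtain N' where N': "N = Suc N'" using N by (cases N) auto
  have 1: "norm (pV ((T ^^ N) h)) \<le> 4 * w / b * norm (pU s)"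
  proof -
    have "norm (pV ((T ^^ N') h)) \<le> norm (pU ((T ^^ N') h))" by (rule cone_funpow[OF hc, THEN conjunct1])
    from cone_step(1)[OF this] show ?thesis by (simp add: pUs N')
  qed
  have "norm (pV ((T ^^ N) r)) \<le> (2 * w) ^ N * norm r"
    using complement_decay[OF pUr] norm_pV_le[of "(T ^^ N) r"] by linarith
  also have "\<dots> \<le> (2 * w) ^ N * (K * (2 * norm (pU h)))"
  proof (intro mult_left_mono)
    have "norm r \<le> K * norm h" using rz zh by linarith
    also have "\<dots> \<le> K * (2 * norm (pU h))" using K0 hU by (intro mult_left_mono)
    finally show "norm r \<le> K * (2 * norm (pU h))" .
  qed (use w in auto)
  also have "\<dots> = (4 * w / b) * (2 * K * (4 * w / b) ^ (N - 1)) * ((b / 2) ^ N * norm (pU h))"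
  proof -
    have 1: "(2 * w) ^ N = (4 * w / b) ^ N * (b / 2) ^ N"
    proof -
      have "2 * w = 4 * w / b * (b / 2)" using ab by simp
      then show ?thesis by (simp only: power_mult_distrib[symmetric])
    qed
    have 2: "(4 * w / b) ^ N = (4 * w / b) * (4 * w / b) ^ (N - 1)" by (simp add: N')
    show ?thesis unfolding 1 2 by (simp only: ac_simps)
  qed
  also have "\<dots> \<le> (4 * w / b) * 1 * norm (pU s)"
    by (intro mult_mono K grow order_refl) (use w ab K0 in \<open>simp_all\<close>)
  finally have 2: "norm (pV ((T ^^ N) r)) \<le> 4 * w / b * norm (pU s)" by simp
  have "norm (pV s) \<le> norm (pV ((T ^^ N) h)) + norm (pV ((T ^^ N) r))"
    unfolding s linear_add[OF linear_pV] by (rule norm_triangle_ineq)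
  also have "\<dots> \<le> 8 * w / b * norm (pU s)"
  proof -
    have "8 * w / b * norm (pU s) = 4 * w / b * norm (pU s) + 4 * w / b * norm (pU s)" by simp
    then show ?thesis using add_mono[OF 1 2] by (simp only:)
  qed
  finally show "norm (pV ((T ^^ N) z)) \<le> 8 * w / b * norm (pU ((T ^^ N) z))"
    unfolding s_def .
qed

end

text \<open>Cramer's rule recovers \<open>c1\<close> and \<open>c2\<close> from the inner products
  of \<open>z\<close> with \<open>g1\<close> and \<open>g2\<close>, at the price of dividing by the
  determinant. The bound is uniform over the span of the start and supplies the \<open>K\<close> of
  \<open>block_power_alignment\<close>.\<close>

lemma projection_coefficients_bound:
  fixes g1 g2 y1 y2 :: "'a::real_inner"
  assumes g: "norm g1 = 1" "norm g2 = 1" "inner g1 g2 = 0"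
    and det: "\<bar>inner g1 y1 * inner g2 y2 - inner g2 y1 * inner g1 y2\<bar> \<ge> \<delta>" "\<delta> > 0"
    and y: "norm y1 \<le> B" "norm y2 \<le> B"
    and z: "z = c1 *\<^sub>R y1 + c2 *\<^sub>R y2"
  shows "norm z \<le> 4 * B\<^sup>2 / \<delta> * norm (inner g1 z *\<^sub>R g1 + inner g2 z *\<^sub>R g2)"
proof -
  define p q where "p = inner g1 z" "q = inner g2 z"
  define d where "d = inner g1 y1 * inner g2 y2 - inner g2 y1 * inner g1 y2"
  define h where "h = norm (p *\<^sub>R g1 + q *\<^sub>R g2)"
  have B0: "B \<ge> 0" using y norm_ge_zero order_trans by blast
  have h2: "h\<^sup>2 = p\<^sup>2 + q\<^sup>2"
  proof -
    have "inner g1 g1 = 1" "inner g2 g2 = 1" "inner g2 g1 = 0"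
      using g by (simp_all add: norm_eq_1 inner_commute)
    then show ?thesis unfolding h_def power2_norm_eq_inner
      using g by (simp add: inner_simps power2_eq_square)
  qed
  have h0: "h \<ge> 0" by (simp add: h_def)
  have p: "\<bar>p\<bar> \<le> h" and q: "\<bar>q\<bar> \<le> h"
    by (rule power2_le_imp_le[OF _ h0]; simp add: h2)+
  have d: "\<delta> \<le> \<bar>d\<bar>" using det by (simp add: d_def)
  have gy: "\<bar>inner g1 y1\<bar> \<le> B" "\<bar>inner g2 y1\<bar> \<le> B" "\<bar>inner g1 y2\<bar> \<le> B" "\<bar>inner g2 y2\<bar> \<le> B"
    using Cauchy_Schwarz_ineq2[of g1 y1] Cauchy_Schwarz_ineq2[of g2 y1]
      Cauchy_Schwarz_ineq2[of g1 y2] Cauchy_Schwarz_ineq2[of g2 y2] g y by auto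
  have c: "\<bar>c\<bar> \<le> 2 * B * h / \<delta>" if "d * c = p * u - q * v" "\<bar>u\<bar> \<le> B" "\<bar>v\<bar> \<le> B" for c u v
  proof -
    have "\<delta> * \<bar>c\<bar> \<le> \<bar>d\<bar> * \<bar>c\<bar>" using d by (intro mult_right_mono) auto
    also have "\<dots> = \<bar>p * u - q * v\<bar>" by (simp flip: abs_mult add: that(1))
    also have "\<dots> \<le> \<bar>p\<bar> * \<bar>u\<bar> + \<bar>q\<bar> * \<bar>v\<bar>" using abs_triangle_ineq4[of "p * u" "q * v"] by (simp add: abs_mult)
    also have "\<dots> \<le> h * B + h * B" using p q that h0 by (intro add_mono mult_mono) auto
    finally show ?thesis using det(2) by (simp add: field_simps)
  qed
  have "d * c1 = p * inner g2 y2 - q * inner g1 y2"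
    by (simp add: d_def p_q_def z inner_simps algebra_simps)
  then have c1: "\<bar>c1\<bar> \<le> 2 * B * h / \<delta>" using c gy by blast
  have "d * c2 = p * (- inner g2 y1) - q * (- inner g1 y1)"
    by (simp add: d_def p_q_def z inner_simps algebra_simps)
  then have c2: "\<bar>c2\<bar> \<le> 2 * B * h / \<delta>" using c[of c2] gy by (metis abs_minus_cancel)
  have "norm z \<le> \<bar>c1\<bar> * norm y1 + \<bar>c2\<bar> * norm y2"
    unfolding z by (rule norm_triangle_le) simp
  also have "\<dots> \<le> 2 * B * h / \<delta> * B + 2 * B * h / \<delta> * B"
    using c1 c2 y B0 h0 det(2) by (intro add_mono mult_mono) auto
  finally show ?thesis by (simp add: h_def p_q_def power2_eq_square field_simps)
qed

section \<open>Choice of the Ritz vector and start of the second stage\<close>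

context perturbed_rank_two begin

text \<open>Let \<open>x1, x2\<close> and \<open>y1, y2\<close> be the coefficients along
  \<open>e1\<close> and \<open>e2\<close>. Up to small errors \<open>x1 x2 + y1 y2 = 0\<close> by
  orthogonality and \<open>a x1 x2 + b y1 y2 = 0\<close> by \<open>off\<close>; as \<open>a\<close>
  exceeds \<open>b\<close>, the product \<open>x1 x2\<close> is small. The order of the Ritz values
  bounds the square of \<open>x1\<close> by that of \<open>x2\<close> plus \<open>\<eta>\<close>, so
  \<open>x1\<close> is the small factor. This compares fourth powers, hence the product of squares
  in the conclusion.\<close>

lemma ritz_selection:
  assumes q: "norm q1 = 1" "norm q2 = 1" "inner q1 q2 = 0"
    and t: "norm (pV q1) \<le> t" "norm (pV q2) \<le> t"
    and off: "inner q1 (T q2) = 0" and le: "inner q1 (T q1) \<le> inner q2 (T q2)"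
    and \<eta>: "\<eta> = (2 * w + b * t\<^sup>2) / (a - b)"
  shows "(inner e1 q1)\<^sup>2 * (inner e1 q1)\<^sup>2 \<le> \<eta>\<^sup>2 + \<eta>"
proof -
  define x1 x2 y1 y2 where xy: "x1 = inner e1 q1" "x2 = inner e1 q2" "y1 = inner e2 q1" "y2 = inner e2 q2"
  have t0: "t \<ge> 0" using t(1) norm_ge_zero order_trans by blast
  have ba: "a - b > 0" using ab by simp
  have T_inner: "inner x (T y) = a * inner e1 x * inner e1 y + b * inner e2 x * inner e2 y + inner x (W y)" for x y
    by (simp add: T inner_simps inner_commute[of x e1] inner_commute[of x e2])
  have W_inner: "\<bar>inner x (W y)\<bar> \<le> w" if "norm x = 1" "norm y = 1" for x y
    using Cauchy_Schwarz_ineq2[of x "W y"] W_bound[of y] that by simp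
  have orth: "x1 * x2 + y1 * y2 = - inner (pV q1) (pV q2)"
  proof -
    have "inner (pU q1 + pV q1) (pU q2 + pV q2) = 0" using q(3) by (simp add: pV_def)
    then have "inner (pU q1) (pU q2) + inner (pV q1) (pV q2) = 0"
      using pU_pV_orth[of q1 q2] pU_pV_orth[of q2 q1] by (simp add: inner_add_left inner_add_right inner_commute)
    moreover have "inner (pU q1) (pU q2) = x1 * x2 + y1 * y2"
      by (simp add: pU_def xy inner_simps ee e)
    ultimately show ?thesis by simp
  qed
  have vv: "\<bar>inner (pV q1) (pV q2)\<bar> \<le> t\<^sup>2"
    using Cauchy_Schwarz_ineq2[of "pV q1" "pV q2"] mult_mono[OF t t0 norm_ge_zero]
    by (simp add: power2_eq_square)
  have \<eta>0: "\<eta> \<ge> 0" using w ab by (simp add: \<eta>)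
  have x12: "\<bar>x1 * x2\<bar> \<le> \<eta>"
  proof -
    have "a * (x1 * x2) + b * (y1 * y2) + inner q1 (W q2) = 0"
      using off by (simp add: T_inner xy mult.assoc)
    moreover have "y1 * y2 = - inner (pV q1) (pV q2) - x1 * x2" using orth by simp
    ultimately have "(a - b) * (x1 * x2) = b * inner (pV q1) (pV q2) - inner q1 (W q2)"
      by (simp add: algebra_simps)
    then have "\<bar>(a - b) * (x1 * x2)\<bar> \<le> b * \<bar>inner (pV q1) (pV q2)\<bar> + \<bar>inner q1 (W q2)\<bar>"
      using ab abs_triangle_ineq4[of "b * inner (pV q1) (pV q2)" "inner q1 (W q2)"] by (simp add: abs_mult)
    also have "\<dots> \<le> b * t\<^sup>2 + w" using ab vv W_inner[of q1 q2] q by (intro add_mono mult_left_mono) auto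
    finally have "(a - b) * \<bar>x1 * x2\<bar> \<le> 2 * w + b * t\<^sup>2" using w ba by (simp add: abs_mult)
    then show ?thesis using ba by (simp add: \<eta> field_simps)
  qed
  have unit: "x1\<^sup>2 + y1\<^sup>2 = 1 - (norm (pV q1))\<^sup>2" "x2\<^sup>2 + y2\<^sup>2 = 1 - (norm (pV q2))\<^sup>2"
    using norm_sq_split[of q1] norm_sq_split[of q2] q by (simp_all add: norm_pU_sq xy)
  have "x1\<^sup>2 \<le> x2\<^sup>2 + \<eta>"
  proof -
    have le': "a * x1\<^sup>2 + b * y1\<^sup>2 + inner q1 (W q1) \<le> a * x2\<^sup>2 + b * y2\<^sup>2 + inner q2 (W q2)"
      using le by (simp add: T_inner xy power2_eq_square mult.assoc)
    have y: "y1\<^sup>2 = 1 - (norm (pV q1))\<^sup>2 - x1\<^sup>2" "y2\<^sup>2 = 1 - (norm (pV q2))\<^sup>2 - x2\<^sup>2"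
      using unit by simp_all
    have "(a - b) * (x1\<^sup>2 - x2\<^sup>2) \<le> b * (norm (pV q1))\<^sup>2 - b * (norm (pV q2))\<^sup>2 + inner q2 (W q2) - inner q1 (W q1)"
      using le' unfolding y by (simp add: algebra_simps)
    also have "\<dots> \<le> b * t\<^sup>2 - 0 + w + w"
    proof -
      have "b * (norm (pV q1))\<^sup>2 \<le> b * t\<^sup>2" using ab t by (intro mult_left_mono power_mono) auto
      moreover have "0 \<le> b * (norm (pV q2))\<^sup>2" using ab by simp
      ultimately show ?thesis using W_inner[of q1 q1] W_inner[of q2 q2] q by linarith
    qed
    finally have "x1\<^sup>2 - x2\<^sup>2 \<le> \<eta>" using ba by (simp add: \<eta> field_simps)
    then show ?thesis by simp
  qed
  then have "x1\<^sup>2 * x1\<^sup>2 \<le> x1\<^sup>2 * (x2\<^sup>2 + \<eta>)" by (intro mult_left_mono) auto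
  also have "\<dots> = \<bar>x1 * x2\<bar>\<^sup>2 + x1\<^sup>2 * \<eta>" by (simp add: power_mult_distrib distrib_left)
  also have "\<dots> \<le> \<eta>\<^sup>2 + 1 * \<eta>"
  proof (intro add_mono mult_right_mono power_mono x12 \<eta>0)
    have "0 \<le> y1\<^sup>2" "0 \<le> (norm (pV q1))\<^sup>2" by simp_all
    then show "x1\<^sup>2 \<le> 1" using unit(1) by linarith
  qed simp
  finally show ?thesis by (simp add: xy)
qed

text \<open>The vector \<open>y\<close> has the component \<open>\<beta>\<close> along
  \<open>e2\<close> and norm at most 1, so normalising can only increase the overlap. The squared
  distance is then at most \<open>2 * n * (1 - \<bar>\<beta>\<bar>)\<close>, and
  \<open>\<bar>\<beta>\<bar>\<close> is at least its square, which is at least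
  \<open>1 - \<epsilon>\<close>.\<close>

lemma normalised_start_close:
  assumes q: "norm q = 1" and close: "(inner e1 q)\<^sup>2 + (norm (pV q))\<^sup>2 \<le> \<epsilon>" "\<epsilon> < 1"
    and y: "y = q - inner e1 q *\<^sub>R e1" and n: "n > 0"
  shows "y \<noteq> 0" "norm ((sqrt n / norm y) *\<^sub>R y) = sqrt n"
    "\<exists>\<sigma>\<in>{-1, 1}. (norm ((sqrt n / norm y) *\<^sub>R y - (\<sigma> * sqrt n) *\<^sub>R e2))\<^sup>2 \<le> 2 * \<epsilon> * n"
proof -
  define \<beta> where "\<beta> = inner e2 q"
  have y_eq: "y = \<beta> *\<^sub>R e2 + pV q" by (simp add: y pV_def pU_def \<beta>_def)
  have \<beta>2: "\<beta>\<^sup>2 = 1 - (inner e1 q)\<^sup>2 - (norm (pV q))\<^sup>2"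
    using norm_sq_split[of q] q by (simp add: norm_pU_sq \<beta>_def)
  have \<beta>: "1 - \<epsilon> \<le> \<beta>\<^sup>2" "0 < \<beta>\<^sup>2" using \<beta>2 close by linarith+
  have ny: "(norm y)\<^sup>2 = \<beta>\<^sup>2 + (norm (pV q))\<^sup>2"
    unfolding power2_norm_eq_inner y_eq using inner_e_pV(2)[of q]
    by (simp add: inner_simps ee inner_commute[of "pV q" e2] power2_eq_square)
  have ny1: "norm y \<le> 1"
  proof (rule power2_le_imp_le)
    have "0 \<le> (inner e1 q)\<^sup>2" by simp
    then show "(norm y)\<^sup>2 \<le> 1\<^sup>2" unfolding ny \<beta>2 by simp
  qed simp
  have "0 \<le> (norm (pV q))\<^sup>2" by simp
  then have "0 < (norm y)\<^sup>2" unfolding ny using \<beta>(2) by linarith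
  then have ny0: "norm y > 0" by simp
  then show "y \<noteq> 0" by auto
  show nx: "norm ((sqrt n / norm y) *\<^sub>R y) = sqrt n" using ny0 n by simp
  have b1: "\<bar>\<beta>\<bar> \<le> 1"
  proof (rule power2_le_imp_le)
    have "0 \<le> (inner e1 q)\<^sup>2" "0 \<le> (norm (pV q))\<^sup>2" by simp_all
    then show "\<bar>\<beta>\<bar>\<^sup>2 \<le> 1\<^sup>2" using \<beta>2 by simp
  qed simp
  have b2: "1 - \<epsilon> \<le> \<bar>\<beta>\<bar>"
  proof -
    have "\<beta>\<^sup>2 \<le> \<bar>\<beta>\<bar>" using mult_left_mono[OF b1, of "\<bar>\<beta>\<bar>"] by (simp add: power2_eq_square)
    then show ?thesis using \<beta>(1) by linarith
  qed
  define \<sigma> :: real where "\<sigma> = (if \<beta> \<ge> 0 then 1 else -1)"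
  have s: "\<sigma> \<in> {-1, 1}" "\<sigma>\<^sup>2 = 1" "\<sigma> * \<beta> = \<bar>\<beta>\<bar>" by (auto simp: \<sigma>_def)
  define x where "x = (sqrt n / norm y) *\<^sub>R y"
  have e2y: "inner e2 y = \<beta>" by (simp add: y_eq inner_simps ee inner_e_pV)
  have "inner x e2 = sqrt n / norm y * \<beta>" by (simp add: x_def inner_commute[of y] e2y)
  then have "(norm (x - (\<sigma> * sqrt n) *\<^sub>R e2))\<^sup>2 = (norm x)\<^sup>2 + \<sigma>\<^sup>2 * n - 2 * (sqrt n * sqrt n) * (\<sigma> * \<beta>) / norm y"
    unfolding power2_norm_eq_inner using n
    by (simp add: inner_diff_left inner_diff_right inner_commute[of e2 x] ee power2_eq_square algebra_simps)
  also have "\<dots> = 2 * n - 2 * n * \<bar>\<beta>\<bar> / norm y" unfolding s x_def nx using n by simp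
  also have "\<dots> \<le> 2 * n - 2 * n * \<bar>\<beta>\<bar> / 1"
    using n ny0 ny1 by (intro diff_left_mono divide_left_mono) auto
  also have "\<dots> \<le> 2 * \<epsilon> * n"
  proof -
    have "2 * n * (1 - \<bar>\<beta>\<bar>) \<le> 2 * n * \<epsilon>" using b2 n by (intro mult_left_mono) auto
    then show ?thesis by (simp add: algebra_simps)
  qed
  finally show "\<exists>\<sigma>\<in>{-1, 1}. (norm ((sqrt n / norm y) *\<^sub>R y - (\<sigma> * sqrt n) *\<^sub>R e2))\<^sup>2 \<le> 2 * \<epsilon> * n"
    using s(1) by (auto simp: x_def)
qed

end

section \<open>Exponential tail bounds for Bernoulli variables\<close>

lemma finite_set_Pi_pmf:
  assumes "finite I" "\<And>e. e \<in> I \<Longrightarrow> finite (set_pmf (p e))"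
  shows "finite (set_pmf (Pi_pmf I d p))"
  using assms by (simp add: set_Pi_pmf finite_PiE_dflt)

lemma bernoulli_product_mgf:
  fixes c r :: "'a \<Rightarrow> real"
  assumes I: "finite I" and r: "\<And>e. e \<in> I \<Longrightarrow> 0 \<le> r e \<and> r e \<le> 1"
  shows "measure_pmf.expectation (Pi_pmf I False (\<lambda>e. bernoulli_pmf (r e)))
      (\<lambda>a. exp (\<Sum>e\<in>I. c e * of_bool (a e))) \<le> exp (\<Sum>e\<in>I. r e * (exp (c e) - 1))"
proof -
  have "measure_pmf.expectation (Pi_pmf I False (\<lambda>e. bernoulli_pmf (r e))) (\<lambda>a. exp (\<Sum>e\<in>I. c e * of_bool (a e)))
     = measure_pmf.expectation (Pi_pmf I False (\<lambda>e. bernoulli_pmf (r e))) (\<lambda>a. \<Prod>e\<in>I. exp (c e * of_bool (a e)))"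
    by (simp add: exp_sum[OF I])
  also have "\<dots> = (\<Prod>e\<in>I. measure_pmf.expectation (bernoulli_pmf (r e)) (\<lambda>v. exp (c e * of_bool v)))"
    by (rule expectation_prod_Pi_pmf[OF I]) (auto intro!: integrable_measure_pmf_finite)
  also have "\<dots> \<le> (\<Prod>e\<in>I. exp (r e * (exp (c e) - 1)))"
  proof (rule prod_mono)
    fix e assume "e \<in> I"
    then have "measure_pmf.expectation (bernoulli_pmf (r e)) (\<lambda>v. exp (c e * of_bool v)) = 1 + r e * (exp (c e) - 1)"
      using r by (simp add: algebra_simps)
    moreover have "1 + r e * (exp (c e) - 1) \<le> exp (r e * (exp (c e) - 1))" by (rule exp_ge_add_one_self)
    moreover have "0 \<le> measure_pmf.expectation (bernoulli_pmf (r e)) (\<lambda>v. exp (c e * of_bool v))"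
      by (rule Bochner_Integration.integral_nonneg) simp
    ultimately show "0 \<le> measure_pmf.expectation (bernoulli_pmf (r e)) (\<lambda>v. exp (c e * of_bool v)) \<and>
        measure_pmf.expectation (bernoulli_pmf (r e)) (\<lambda>v. exp (c e * of_bool v)) \<le> exp (r e * (exp (c e) - 1))"
      by simp
  qed
  finally show ?thesis by (simp add: exp_sum[OF I])
qed

text \<open>The tilting parameter is absorbed into the weights \<open>c\<close>; weights of either
  sign then give upper and lower tails alike.\<close>

lemma bernoulli_chernoff:
  fixes c r :: "'a \<Rightarrow> real"
  assumes I: "finite I" and r: "\<And>e. e \<in> I \<Longrightarrow> 0 \<le> r e \<and> r e \<le> 1"
  shows "measure_pmf.prob (Pi_pmf I False (\<lambda>e. bernoulli_pmf (r e))) {a. s \<le> (\<Sum>e\<in>I. c e * of_bool (a e))}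
      \<le> exp ((\<Sum>e\<in>I. r e * (exp (c e) - 1)) - s)"
proof -
  let ?M = "Pi_pmf I False (\<lambda>e. bernoulli_pmf (r e))"
  let ?X = "\<lambda>a. (\<Sum>e\<in>I. c e * of_bool (a e))"
  have fin: "finite (set_pmf ?M)" by (rule finite_set_Pi_pmf[OF I]) auto
  have "measure_pmf.prob ?M {a. s \<le> ?X a} = measure_pmf.expectation ?M (indicator {a. s \<le> ?X a})"
    by simp
  also have "\<dots> \<le> measure_pmf.expectation ?M (\<lambda>a. exp (- s) * exp (?X a))"
  proof (rule integral_mono)
    show "indicator {a. s \<le> ?X a} a \<le> exp (- s) * exp (?X a)" for a
      by (auto simp: indicator_def simp flip: exp_add)
  qed (auto intro!: integrable_measure_pmf_finite fin)
  also have "\<dots> \<le> exp (- s) * exp (\<Sum>e\<in>I. r e * (exp (c e) - 1))"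
    using bernoulli_product_mgf[where r = r and c = c, OF I r] by simp
  finally show ?thesis by (simp add: algebra_simps flip: exp_add)
qed

text \<open>The weights are carried to \<open>I\<close> along \<open>f\<close> and extended by 0.
  Intended for the entries of one matrix row, indexed by the other endpoint.\<close>

lemma bernoulli_chernoff_inj:
  fixes c :: "'b \<Rightarrow> real" and r :: "'a \<Rightarrow> real"
  assumes I: "finite I" and r: "\<And>e. e \<in> I \<Longrightarrow> 0 \<le> r e \<and> r e \<le> 1"
    and f: "inj_on f X" "f ` X \<subseteq> I"
  shows "measure_pmf.prob (Pi_pmf I False (\<lambda>e. bernoulli_pmf (r e))) {a. s \<le> (\<Sum>x\<in>X. c x * of_bool (a (f x)))}
      \<le> exp ((\<Sum>x\<in>X. r (f x) * (exp (c x) - 1)) - s)"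
proof -
  define c' where "c' e = (if e \<in> f ` X then c (inv_into X f e) else 0)" for e
  have c': "c' (f x) = c x" if "x \<in> X" for x using that f by (simp add: c'_def)
  have *: "(\<Sum>e\<in>I. g e) = (\<Sum>x\<in>X. g (f x))" if "\<And>e. e \<notin> f ` X \<Longrightarrow> g e = 0" for g :: "'a \<Rightarrow> real"
  proof -
    have "(\<Sum>e\<in>I. g e) = (\<Sum>e\<in>f ` X. g e)"
      by (rule sum.mono_neutral_right) (use I f that in auto)
    then show ?thesis by (simp add: sum.reindex[OF f(1)])
  qed
  have 1: "(\<Sum>e\<in>I. c' e * of_bool (a e)) = (\<Sum>x\<in>X. c x * of_bool (a (f x)))" for a
    by (subst *) (auto simp: c'_def f(1))
  have 2: "(\<Sum>e\<in>I. r e * (exp (c' e) - 1)) = (\<Sum>x\<in>X. r (f x) * (exp (c x) - 1))"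
    by (subst *) (auto simp: c'_def f(1))
  show ?thesis using bernoulli_chernoff[where r = r and c = c' and s = s, OF I r] by (simp only: 1 2)
qed

text \<open>This lets one exponent serve both tails. For \<open>v = - y\<close> negative,
  \<open>(1 + y + y^2 / 2) (1 - y + y^2 / 2)\<close> is at least 1, so \<open>exp v\<close> is at
  most \<open>1 - y + y^2 / 2\<close>; the left-hand side is then at most \<open>y^2 / 2\<close>,
  which the quadratic Taylor bound for \<open>exp u\<close> dominates.\<close>

lemma exp_sub_linear_mono_abs:
  fixes u v :: real
  assumes "\<bar>v\<bar> \<le> u"
  shows "exp v - 1 - v \<le> exp u - 1 - u"
proof (cases "v \<ge> 0")
  case True
  have "u - v \<le> exp (u - v) - 1" using exp_ge_add_one_self[of "u - v"] by linarith
  also have "\<dots> \<le> exp v * (exp (u - v) - 1)"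
    using mult_right_mono[of 1 "exp v" "exp (u - v) - 1"] True assms by simp
  also have "\<dots> = exp u - exp v" by (simp add: algebra_simps flip: exp_add)
  finally show ?thesis by simp
next
  case False
  define y where "y = - v"
  have y: "0 < y" "y \<le> u" using False assms by (auto simp: y_def)
  have "exp v \<le> 1 - y + y\<^sup>2 / 2"
  proof -
    have "1 + y + y\<^sup>2 / 2 \<le> exp y" using y by (intro exp_lower_Taylor_quadratic) auto
    moreover have pos: "0 < 1 - y + y\<^sup>2 / 2"
    proof -
      have "1 - y + y\<^sup>2 / 2 = ((1 - y)\<^sup>2 + 1) / 2" by (simp add: power2_eq_square field_simps)
      moreover have "0 < ((1 - y)\<^sup>2 + 1) / 2" by (simp add: add_nonneg_pos)
      ultimately show ?thesis by (simp only:)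
    qed
    ultimately have "(1 + y + y\<^sup>2 / 2) * (1 - y + y\<^sup>2 / 2) \<le> exp y * (1 - y + y\<^sup>2 / 2)"
      by (intro mult_right_mono) auto
    moreover have "(1 + y + y\<^sup>2 / 2) * (1 - y + y\<^sup>2 / 2) = 1 + (y * y)\<^sup>2 / 4"
      by (simp add: power2_eq_square field_simps)
    moreover have "0 \<le> (y * y)\<^sup>2" by simp
    ultimately have "1 \<le> exp y * (1 - y + y\<^sup>2 / 2)" by linarith
    then have "exp v * 1 \<le> exp v * (exp y * (1 - y + y\<^sup>2 / 2))" by (intro mult_left_mono) auto
    moreover have "exp v * exp y = 1" by (simp add: y_def flip: exp_add)
    ultimately show ?thesis by (simp add: mult.assoc[symmetric])
  qed
  moreover have "1 + u + u\<^sup>2 / 2 \<le> exp u" using y by (intro exp_lower_Taylor_quadratic) auto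
  moreover have "y\<^sup>2 \<le> u\<^sup>2" using y by (intro power_mono) auto
  ultimately show ?thesis by (simp add: y_def)
qed

text \<open>The multiplicities up to 2 account for the symmetric pairs of matrix entries.\<close>

lemma bernoulli_two_sided:
  fixes r :: "'a \<Rightarrow> real" and m :: "'a \<Rightarrow> nat"
  assumes I: "finite I" and r: "\<And>e. e \<in> I \<Longrightarrow> 0 \<le> r e \<and> r e \<le> 1"
    and m: "\<And>e. e \<in> I \<Longrightarrow> m e \<le> 2" and \<theta>: "\<theta> \<ge> 0"
  shows "measure_pmf.prob (Pi_pmf I False (\<lambda>e. bernoulli_pmf (r e)))
      {a. d \<le> \<bar>\<Sum>e\<in>I. real (m e) * (of_bool (a e) - r e)\<bar>}
      \<le> 2 * exp ((\<Sum>e\<in>I. real (m e) * r e) * (exp (2 * \<theta>) - 1 - 2 * \<theta>) - \<theta> * d)"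
\<comment> \<open>For \<open>\<theta> = 0\<close> the bound is 2. Otherwise the event can be
  multiplied by \<open>\<theta>\<close>.\<close>
proof (cases "\<theta> = 0")
  case True
  then show ?thesis by (simp add: order_trans[OF measure_pmf.prob_le_1])
next
  case False
  then have \<theta>: "\<theta> > 0" using \<theta> by simp
  let ?M = "Pi_pmf I False (\<lambda>e. bernoulli_pmf (r e))"
  let ?\<phi> = "exp (2 * \<theta>) - 1 - 2 * \<theta>"
  let ?X = "\<lambda>a. \<Sum>e\<in>I. real (m e) * (of_bool (a e) - r e)"
  define \<mu> where "\<mu> = (\<Sum>e\<in>I. real (m e) * r e)"
  have X: "?X a = (\<Sum>e\<in>I. real (m e) * of_bool (a e)) - \<mu>" for a
    by (simp add: \<mu>_def right_diff_distrib sum_subtractf)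
  \<comment> \<open>Both tails at once: \<open>\<sigma>\<close> is \<open>1\<close> or
    \<open>-1\<close>.\<close>
  have one: "measure_pmf.prob ?M {a. d \<le> \<sigma> * ?X a} \<le> exp (\<mu> * ?\<phi> - \<theta> * d)"
    if \<sigma>: "\<bar>\<sigma>\<bar> = 1" for \<sigma> :: real
  proof -
    have "{a. d \<le> \<sigma> * ?X a} = {a. \<theta> * d + \<theta> * \<sigma> * \<mu> \<le> (\<Sum>e\<in>I. (\<theta> * \<sigma> * real (m e)) * of_bool (a e))}"
    proof -
      have "d \<le> \<sigma> * ?X a \<longleftrightarrow> \<theta> * d \<le> \<theta> * (\<sigma> * ?X a)" for a using \<theta> by simp
      moreover have "(\<Sum>e\<in>I. (\<theta> * \<sigma> * real (m e)) * of_bool (a e)) = \<theta> * \<sigma> * (\<Sum>e\<in>I. real (m e) * of_bool (a e))" for a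
        by (simp only: sum_distrib_left mult.assoc)
      ultimately show ?thesis unfolding X by (simp only: algebra_simps le_diff_eq)
    qed
    then have "measure_pmf.prob ?M {a. d \<le> \<sigma> * ?X a}
        \<le> exp ((\<Sum>e\<in>I. r e * (exp (\<theta> * \<sigma> * real (m e)) - 1)) - (\<theta> * d + \<theta> * \<sigma> * \<mu>))"
      using bernoulli_chernoff[where r = r and c = "\<lambda>e. \<theta> * \<sigma> * real (m e)", OF I r] by simp
    also have "\<dots> \<le> exp (\<mu> * ?\<phi> - \<theta> * d)"
    proof -
      have "(\<Sum>e\<in>I. r e * (exp (\<theta> * \<sigma> * real (m e)) - 1)) - \<theta> * \<sigma> * \<mu>
          = (\<Sum>e\<in>I. r e * (exp (\<theta> * \<sigma> * real (m e)) - 1 - \<theta> * \<sigma> * real (m e)))"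
        by (simp add: \<mu>_def sum_distrib_left sum_subtractf sum.distrib algebra_simps)
      also have "\<dots> \<le> (\<Sum>e\<in>I. real (m e) * r e * ?\<phi>)"
      proof (rule sum_mono)
        fix e assume e: "e \<in> I"
        have \<phi>0: "0 \<le> ?\<phi>" using exp_ge_add_one_self[of "2 * \<theta>"] by linarith
        \<comment> \<open>The factor \<open>m e\<close> on the right makes the sum over
          \<open>e\<close> a multiple of \<open>\<mu>\<close>. It is available because the left-hand
          side vanishes for \<open>m e = 0\<close> and \<open>m e\<close> is at least 1
          otherwise.\<close>
        have "exp (\<theta> * \<sigma> * real (m e)) - 1 - \<theta> * \<sigma> * real (m e) \<le> real (m e) * ?\<phi>"
        proof (cases "m e = 0")
          case False
          have "exp (\<theta> * \<sigma> * real (m e)) - 1 - \<theta> * \<sigma> * real (m e) \<le> ?\<phi>"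
          proof (rule exp_sub_linear_mono_abs)
            show "\<bar>\<theta> * \<sigma> * real (m e)\<bar> \<le> 2 * \<theta>" using \<theta> \<sigma> m[OF e] by (simp add: abs_mult)
          qed
          also have "\<dots> \<le> real (m e) * ?\<phi>" using False \<phi>0 mult_right_mono[of 1 "real (m e)" ?\<phi>] by simp
          finally show ?thesis .
        qed simp
        then have "r e * (exp (\<theta> * \<sigma> * real (m e)) - 1 - \<theta> * \<sigma> * real (m e)) \<le> r e * (real (m e) * ?\<phi>)"
          using r[OF e] by (intro mult_left_mono) auto
        then show "r e * (exp (\<theta> * \<sigma> * real (m e)) - 1 - \<theta> * \<sigma> * real (m e)) \<le> real (m e) * r e * ?\<phi>"
          by (simp only: ac_simps)
      qed
      finally show ?thesis by (simp add: \<mu>_def sum_distrib_right)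
    qed
    finally show ?thesis .
  qed
  have "{a. d \<le> \<bar>?X a\<bar>} \<subseteq> {a. d \<le> 1 * ?X a} \<union> {a. d \<le> (-1) * ?X a}" by auto
  then have "measure_pmf.prob ?M {a. d \<le> \<bar>?X a\<bar>} \<le> measure_pmf.prob ?M ({a. d \<le> 1 * ?X a} \<union> {a. d \<le> (-1) * ?X a})"
    by (intro measure_pmf.finite_measure_mono) auto
  also have "\<dots> \<le> measure_pmf.prob ?M {a. d \<le> 1 * ?X a} + measure_pmf.prob ?M {a. d \<le> (-1) * ?X a}"
    by (rule measure_Un_le) auto
  also have "\<dots> \<le> exp (\<mu> * ?\<phi> - \<theta> * d) + exp (\<mu> * ?\<phi> - \<theta> * d)"
    by (intro add_mono one) auto
  finally show ?thesis by (simp add: \<mu>_def)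
qed

section \<open>Counting small vertex sets\<close>

lemma sum_Pow_power_card:
  fixes y :: real
  shows "finite A \<Longrightarrow> (\<Sum>S\<in>Pow A. y ^ card S) = (1 + y) ^ card A"
  using prod_add[of A "\<lambda>_. y" "\<lambda>_. 1"] by (simp add: add.commute)

text \<open>Each subset is weighted by \<open>y ^ card S\<close> with \<open>y = t / n\<close>. All
  weights together give \<open>(1 + y) ^ n\<close>, at most \<open>exp t\<close>, while each counted
  set has weight at least \<open>y ^ t\<close>.\<close>

lemma card_small_subsets_le:
  assumes t: "1 \<le> t" "t \<le> n"
  shows "real (card {S. S \<subseteq> {..<n} \<and> card S \<le> t}) \<le> exp (real t * (1 + ln (real n / real t)))"
proof -
  define y where "y = real t / real n"
  have y: "0 < y" "y \<le> 1" using t by (auto simp: y_def)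
  have "real (card {S. S \<subseteq> {..<n} \<and> card S \<le> t}) * y ^ t = (\<Sum>S | S \<subseteq> {..<n} \<and> card S \<le> t. y ^ t)" by simp
  also have "\<dots> \<le> (\<Sum>S | S \<subseteq> {..<n} \<and> card S \<le> t. y ^ card S)"
    using y by (intro sum_mono power_decreasing) auto
  also have "\<dots> \<le> (\<Sum>S\<in>Pow {..<n}. y ^ card S)"
    using y by (intro sum_mono2) auto
  also have "\<dots> = (1 + y) ^ n" by (simp add: sum_Pow_power_card)
  also have "\<dots> \<le> exp y ^ n" using y by (intro power_mono) (auto simp: exp_ge_add_one_self)
  also have "\<dots> = exp (real t)" using t by (simp add: y_def flip: exp_of_nat_mult)
  finally have "real (card {S. S \<subseteq> {..<n} \<and> card S \<le> t}) \<le> exp (real t) / y ^ t" using y by (simp add: field_simps)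
  also have "\<dots> = exp (real t * (1 + ln (real n / real t)))"
  proof -
    have "exp (real t * ln (real n / real t)) = (real n / real t) ^ t"
      using t by (simp add: exp_of_nat_mult)
    then show ?thesis by (simp add: distrib_left exp_add y_def power_divide)
  qed
  finally show ?thesis .
qed

section \<open>Concentration in the block model\<close>

locale block_model =
  fixes n :: nat and p q :: real and x :: "nat \<Rightarrow> real"
  assumes pq: "0 \<le> q" "q \<le> p" "p \<le> 1"
    and x: "\<And>i. i < n \<Longrightarrow> x i \<in> {-1, 1}" and x_sum: "(\<Sum>i<n. x i) = 0"
begin

definition edges :: "(nat \<times> nat) set" where "edges = {(i, j). i \<le> j \<and> j < n}"
definition rate :: "nat \<times> nat \<Rightarrow> real" where "rate = (\<lambda>(i, j). if x i * x j = 1 then p else q)"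
text \<open>The tail bounds are proved for the independent bits; \<open>sbm_eq\<close> transfers
  them to the matrix.\<close>

definition law :: "(nat \<times> nat \<Rightarrow> bool) pmf" where "law = Pi_pmf edges False (\<lambda>e. bernoulli_pmf (rate e))"
definition pair :: "nat \<Rightarrow> nat \<Rightarrow> nat \<times> nat" where "pair i j = (min i j, max i j)"
definition adj :: "(nat \<times> nat \<Rightarrow> bool) \<Rightarrow> nat \<Rightarrow> nat \<Rightarrow> real" where "adj a i j = of_bool (a (pair i j))"
definition mean :: "nat \<Rightarrow> nat \<Rightarrow> real" where "mean i j = rate (pair i j)"

lemma finite_edges: "finite edges"
  by (rule finite_subset[of _ "{..<n} \<times> {..<n}"]) (auto simp: edges_def)

lemma rate_01: "0 \<le> rate e \<and> rate e \<le> 1"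
  using pq by (auto simp: rate_def split: prod.splits)

lemma pair_edges: "i < n \<Longrightarrow> j < n \<Longrightarrow> pair i j \<in> edges"
  by (auto simp: pair_def edges_def)

lemma pair_commute: "pair i j = pair j i"
  by (simp add: pair_def min.commute max.commute)

lemma adj_commute: "adj a i j = adj a j i" and mean_commute: "mean i j = mean j i"
  by (simp_all add: adj_def mean_def pair_commute)

lemma mean_eq: "mean i j = (if x i * x j = 1 then p else q)"
  by (auto simp: mean_def rate_def pair_def min_def max_def mult.commute)

lemma mean_bounds: "0 \<le> mean i j" "mean i j \<le> p"
  using pq by (auto simp: mean_eq)

lemma x_prod: "i < n \<Longrightarrow> j < n \<Longrightarrow> x i * x j = 1 \<or> x i * x j = -1"
  using x[of i] x[of j] by auto

lemma mean_linear:
  assumes "i < n" "j < n"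
  shows "mean i j = (p + q) / 2 + (p - q) / 2 * (x i * x j)"
proof -
  consider "x i * x j = 1" | "x i * x j = -1" using x_prod[OF assms] by blast
  then show ?thesis by cases (simp_all only: mean_eq, simp_all add: field_simps)
qed

text \<open>Within one row no unordered pair occurs twice, so the entries of the row are
  independent.\<close>

lemma row_tail:
  assumes i: "i < n"
  shows "measure_pmf.prob law {a. s \<le> (\<Sum>j<n. c j * adj a i j)}
     \<le> exp ((\<Sum>j<n. mean i j * (exp (c j) - 1)) - s)"
  unfolding law_def adj_def mean_def
proof (rule bernoulli_chernoff_inj[OF finite_edges rate_01])
  show "inj_on (pair i) {..<n}" by (auto simp: inj_on_def pair_def min_def max_def split: if_splits)
  show "pair i ` {..<n} \<subseteq> edges" using i pair_edges by auto
qed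

lemma degree_tail:
  assumes i: "i < n"
  shows "measure_pmf.prob law {a. s \<le> (\<Sum>j<n. adj a i j)} \<le> exp (2 * (real n * p) - s)"
proof -
  \<comment> \<open>The tilt is 1, and \<open>exp 1 \<le> 3\<close> yields the factor 2 in front of
    the mean degree.\<close>
  have e: "exp 1 - 1 \<le> (2 :: real)" "0 \<le> exp 1 - (1::real)" using exp_le by (auto simp: one_le_exp_iff)
  have "(\<Sum>j<n. mean i j * (exp 1 - 1)) \<le> (\<Sum>j<n. p * 2)"
    using e mean_bounds pq by (intro sum_mono mult_mono) auto
  then have "exp ((\<Sum>j<n. mean i j * (exp 1 - 1)) - s) \<le> exp (2 * (real n * p) - s)" by simp
  then show ?thesis using row_tail[OF i, of s "\<lambda>_. 1"] by (simp only: mult_1_left)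
qed

text \<open>Balance of the labels makes exactly half of the vertices agree with \<open>i\<close>,
  whence \<open>n / 2\<close>. It enters by writing a function of the sign \<open>x i * x j\<close>
  as an affine one, whose linear part sums to zero over \<open>j\<close>.\<close>

lemma margin_tail:
  assumes i: "i < n" and \<theta>: "\<theta> > 0"
  shows "measure_pmf.prob law {a. (\<Sum>j<n. x i * x j * adj a i j) \<le> k}
    \<le> exp (real n / 2 * (p * (exp (- \<theta>) - 1) + q * (exp \<theta> - 1)) + \<theta> * k)"
proof -
  let ?u = "p * (exp (- \<theta>) - 1)" and ?v = "q * (exp \<theta> - 1)"
  have eq: "(\<Sum>j<n. mean i j * (exp (- \<theta> * (x i * x j)) - 1)) = real n / 2 * (?u + ?v)"
  proof -
    have "(\<Sum>j<n. mean i j * (exp (- \<theta> * (x i * x j)) - 1)) = (\<Sum>j<n. (?u + ?v) / 2 + (?u - ?v) / 2 * (x i * x j))"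
    proof (rule sum.cong[OF refl])
      fix j assume "j \<in> {..<n}"
      then consider "x i * x j = 1" | "x i * x j = -1" using x_prod[OF i, of j] by auto
      then show "mean i j * (exp (- \<theta> * (x i * x j)) - 1) = (?u + ?v) / 2 + (?u - ?v) / 2 * (x i * x j)"
        by cases (simp_all only: mean_eq, simp_all add: field_simps)
    qed
    also have "\<dots> = real n * ((?u + ?v) / 2) + (?u - ?v) / 2 * x i * (\<Sum>j<n. x j)"
      by (simp add: sum.distrib sum_distrib_left mult.assoc)
    finally show ?thesis by (simp add: x_sum)
  qed
  have "{a. (\<Sum>j<n. x i * x j * adj a i j) \<le> k} = {a. - \<theta> * k \<le> (\<Sum>j<n. (- \<theta> * (x i * x j)) * adj a i j)}"
  proof -
    have "(\<Sum>j<n. (- \<theta> * (x i * x j)) * adj a i j) = - \<theta> * (\<Sum>j<n. x i * x j * adj a i j)" for a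
      by (simp only: sum_distrib_left mult.assoc)
    then show ?thesis using \<theta> by (simp add: mult_le_cancel_left)
  qed
  then show ?thesis using row_tail[OF i, of "- \<theta> * k" "\<lambda>j. - \<theta> * (x i * x j)"] unfolding eq by simp
qed

text \<open>Blocks are indexed by ordered pairs, the independent bits by unordered ones. When
  \<open>S\<close> and \<open>T\<close> overlap a bit can be counted twice, which the multiplicity
  records.\<close>

lemma block_sum_edges:
  fixes g :: "nat \<times> nat \<Rightarrow> real"
  assumes "S \<subseteq> {..<n}" "T \<subseteq> {..<n}"
  shows "(\<Sum>i\<in>S. \<Sum>j\<in>T. g (pair i j)) = (\<Sum>e\<in>edges. real (card {z \<in> S \<times> T. case_prod pair z = e}) * g e)"
proof -
  have fin: "finite (S \<times> T)" using assms finite_subset[of _ "{..<n}"] by auto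
  have sub: "case_prod pair ` (S \<times> T) \<subseteq> edges" using assms pair_edges by (auto simp: subset_iff)
  have "(\<Sum>i\<in>S. \<Sum>j\<in>T. g (pair i j)) = (\<Sum>z\<in>S \<times> T. g (case_prod pair z))"
    by (simp add: sum.cartesian_product case_prod_beta)
  also have "\<dots> = (\<Sum>e\<in>edges. \<Sum>z\<in>{z \<in> S \<times> T. case_prod pair z = e}. g (case_prod pair z))"
    by (rule sum.group[OF fin finite_edges sub, symmetric])
  also have "\<dots> = (\<Sum>e\<in>edges. real (card {z \<in> S \<times> T. case_prod pair z = e}) * g e)"
    by (rule sum.cong[OF refl]) simp
  finally show ?thesis .
qed

lemma pair_fibre_card: "card {z \<in> S \<times> T. case_prod pair z = e} \<le> 2"
proof -
  have "{z \<in> S \<times> T. case_prod pair z = e} \<subseteq> {(fst e, snd e), (snd e, fst e)}"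
    by (auto simp: pair_def min_def max_def split: if_splits)
  then have "card {z \<in> S \<times> T. case_prod pair z = e} \<le> card {(fst e, snd e), (snd e, fst e)}"
    by (intro card_mono) auto
  also have "\<dots> \<le> 2" by (simp add: card_insert_if)
  finally show ?thesis .
qed

lemma block_tail:
  assumes ST: "S \<subseteq> {..<n}" "T \<subseteq> {..<n}" and \<theta>: "\<theta> \<ge> 0"
  shows "measure_pmf.prob law {a. d \<le> \<bar>\<Sum>i\<in>S. \<Sum>j\<in>T. adj a i j - mean i j\<bar>}
    \<le> 2 * exp (p * (real (card S) * real (card T)) * (exp (2 * \<theta>) - 1 - 2 * \<theta>) - \<theta> * d)"
proof -
  let ?m = "\<lambda>e. card {z \<in> S \<times> T. case_prod pair z = e}"
  have 1: "(\<Sum>i\<in>S. \<Sum>j\<in>T. adj a i j - mean i j) = (\<Sum>e\<in>edges. real (?m e) * (of_bool (a e) - rate e))" for a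
    using block_sum_edges[OF ST, of "\<lambda>e. of_bool (a e) - rate e"] by (simp add: adj_def mean_def)
  have "(\<Sum>e\<in>edges. real (?m e) * rate e) = (\<Sum>i\<in>S. \<Sum>j\<in>T. mean i j)"
    using block_sum_edges[OF ST, of rate] by (simp add: mean_def)
  also have "\<dots> \<le> (\<Sum>i\<in>S. \<Sum>j\<in>T. p)" by (intro sum_mono mean_bounds)
  also have "\<dots> = p * (real (card S) * real (card T))" by simp
  finally have \<mu>: "(\<Sum>e\<in>edges. real (?m e) * rate e) \<le> p * (real (card S) * real (card T))" .
  have "0 \<le> exp (2 * \<theta>) - 1 - 2 * \<theta>" using exp_ge_add_one_self[of "2 * \<theta>"] by linarith
  then have 2: "(\<Sum>e\<in>edges. real (?m e) * rate e) * (exp (2 * \<theta>) - 1 - 2 * \<theta>)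
      \<le> p * (real (card S) * real (card T)) * (exp (2 * \<theta>) - 1 - 2 * \<theta>)"
    by (rule mult_right_mono[OF \<mu>])
  have "measure_pmf.prob law {a. d \<le> \<bar>\<Sum>i\<in>S. \<Sum>j\<in>T. adj a i j - mean i j\<bar>}
     \<le> 2 * exp ((\<Sum>e\<in>edges. real (?m e) * rate e) * (exp (2 * \<theta>) - 1 - 2 * \<theta>) - \<theta> * d)"
    unfolding 1 law_def by (rule bernoulli_two_sided[OF finite_edges rate_01 pair_fibre_card \<theta>])
  also have "\<dots> \<le> 2 * exp (p * (real (card S) * real (card T)) * (exp (2 * \<theta>) - 1 - 2 * \<theta>) - \<theta> * d)"
    using 2 by simp
  finally show ?thesis .
qed

end

text \<open>
  \<open>L\<close> stands for \<open>ln n\<close>. Sparse blocks use \<open>\<theta>\<close> of order \<open>ln (n / t)\<close>, dense ones a small \<open>\<theta>\<close>.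
\<close>

definition tail_regime :: "real \<Rightarrow> real \<Rightarrow> real \<Rightarrow> bool" where
  "tail_regime \<alpha> D L \<longleftrightarrow> L \<ge> 1 \<and> ln L \<ge> 1 \<and> ln L / 4 \<ge> 2 * \<alpha> * L powr (-1/4) \<and> L powr (1/2) \<ge> 64 * D \<and>
     L powr (1/4) \<ge> 8 * D * (8 * \<alpha> + 2) * (1 + ln L)"

lemma eventually_tail_regime: "\<forall>\<^sub>F L in at_top. tail_regime \<alpha> D L"
  unfolding tail_regime_def by (intro eventually_conj; real_asymp)

text \<open>Here \<open>h\<close> stands for \<open>n / t\<close>. There are at most
  \<open>exp (2 t (1 + ln h))\<close> pairs of sets of size at most \<open>t\<close>, so an exponent
  of twice that size survives the union bound.\<close>

lemma tail_exponent:
  fixes \<alpha> D L h t d \<mu> :: real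
  assumes R: "tail_regime \<alpha> D L" and \<alpha>: "\<alpha> > 0" and D: "D > 0" and h: "h \<ge> 1" and t: "t \<ge> 0"
    and d: "d \<ge> t * L powr (1/2) / D" and \<mu>: "\<mu> \<le> \<alpha> * L powr (1/4) / h * d" and \<mu>0: "\<mu> \<ge> 0"
  shows "\<exists>\<theta>\<ge>0. \<mu> * (exp (2 * \<theta>) - 1 - 2 * \<theta>) - \<theta> * d \<le> - 4 * t * (1 + ln h)"
proof -
  have L: "L \<ge> 1" "ln L \<ge> 1" "ln L / 4 \<ge> 2 * \<alpha> * L powr (-1/4)" "L powr (1/2) \<ge> 64 * D"
    "L powr (1/4) \<ge> 8 * D * (8 * \<alpha> + 2) * (1 + ln L)" using R by (auto simp: tail_regime_def)
  have d0: "d \<ge> 0" using d D t by (smt (verit) divide_nonneg_pos mult_nonneg_nonneg powr_ge_zero)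
  show ?thesis
  proof (cases "h \<ge> L")
    case True
    \<comment> \<open>Now \<open>exp (2 * \<theta>)\<close> is the square root of \<open>h\<close>,
      and the mean contributes at most \<open>\<alpha> L^(-1/4) d\<close>, which is less than half
      of the gain \<open>\<theta> * d\<close> because \<open>h \<ge> L\<close>.\<close>
    define \<theta> where "\<theta> = ln h / 4"
    have lnh: "ln L \<le> ln h" using True L by simp
    have eh: "exp (2 * \<theta>) = h powr (1/2)" using h by (simp add: \<theta>_def powr_def)
    have "\<mu> * (h powr (1/2) - 1 - 2 * \<theta>) \<le> \<mu> * h powr (1/2)"
      using lnh L \<mu>0 by (intro mult_left_mono) (auto simp: \<theta>_def)
    also have "\<mu> * h powr (1/2) \<le> (\<alpha> * L powr (1/4) / h * d) * h powr (1/2)" by (intro mult_right_mono \<mu>) simp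
    also have "\<dots> = \<alpha> * d * L powr (1/4) * (h powr (1/2) / h)" by simp
    also have "h powr (1/2) / h = h powr (-1/2)" using h by (simp add: powr_minus_divide powr_half_sqrt real_div_sqrt field_simps)
    also have "\<alpha> * d * L powr (1/4) * h powr (-1/2) \<le> \<alpha> * d * L powr (1/4) * L powr (-1/2)"
      using True L \<alpha> d0 by (intro mult_left_mono powr_mono2') auto
    also have "\<dots> = \<alpha> * L powr (-1/4) * d" by (simp add: mult.assoc mult.commute flip: powr_add)
    also have "\<dots> \<le> (\<theta> / 2) * d"
      using L(3) lnh d0 by (intro mult_right_mono) (auto simp: \<theta>_def)
    finally have "\<mu> * (exp (2 * \<theta>) - 1 - 2 * \<theta>) \<le> \<theta> / 2 * d" unfolding eh .
    then have "\<mu> * (exp (2 * \<theta>) - 1 - 2 * \<theta>) - \<theta> * d \<le> - (\<theta> / 2 * d)" by simp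
    also have "\<dots> \<le> - (\<theta> / 2 * (t * 64))"
    proof -
      have "t * 64 \<le> t * (L powr (1/2) / D)" using L(4) D t by (intro mult_left_mono) (auto simp: field_simps)
      then have "t * 64 \<le> d" using d by simp
      then show ?thesis using lnh L by (simp add: \<theta>_def mult_left_mono)
    qed
    also have "\<dots> = - 8 * t * ln h" by (simp add: \<theta>_def)
    also have "\<dots> \<le> - 4 * t * (1 + ln h)"
    proof -
      have "t * (1 + ln h) \<le> t * (2 * ln h)" using lnh L t by (intro mult_left_mono) auto
      then show ?thesis by simp
    qed
    finally show ?thesis using lnh L by (intro exI[of _ \<theta>]) (auto simp: \<theta>_def)
  next
    case False
    \<comment> \<open>Minimising \<open>4 \<mu> \<theta>^2 - \<theta> d\<close> at
      \<open>\<mu> = \<alpha> L^(1/4) d\<close> suggests \<open>L^(-1/4) / (8 \<alpha>)\<close>; the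
      added 2 ensures \<open>2 * \<theta> \<le> 1\<close>, where the quadratic bound for
      \<open>exp\<close> holds. The resulting gain of order \<open>t L^(1/4)\<close> suffices
      because \<open>ln h\<close> is now at most \<open>ln L\<close>.\<close>
    define \<theta> where "\<theta> = L powr (-1/4) / (8 * \<alpha> + 2)"
    have \<theta>0: "\<theta> > 0" using \<alpha> L by (simp add: \<theta>_def)
    have "L powr (-1/4) \<le> L powr 0" using L by (intro powr_mono) auto
    then have \<theta>1: "2 * \<theta> \<le> 1" using \<alpha> L by (simp add: \<theta>_def field_simps)
    have "exp (2 * \<theta>) \<le> 1 + 2 * \<theta> + (2 * \<theta>)\<^sup>2" using \<theta>0 \<theta>1 by (intro exp_bound) auto
    then have "\<mu> * (exp (2 * \<theta>) - 1 - 2 * \<theta>) \<le> \<mu> * (4 * \<theta>\<^sup>2)"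
      using \<mu>0 by (intro mult_left_mono) auto
    also have "\<dots> \<le> (\<alpha> * L powr (1/4) * d) * (4 * \<theta>\<^sup>2)"
    proof (rule mult_right_mono)
      have "\<alpha> * L powr (1/4) / h * d \<le> \<alpha> * L powr (1/4) / 1 * d"
        using h \<alpha> d0 by (intro mult_right_mono divide_left_mono) auto
      then show "\<mu> \<le> \<alpha> * L powr (1/4) * d" using \<mu> by simp
    qed simp
    also have "\<dots> = (4 * \<alpha> * (L powr (1/4) * \<theta>)) * (\<theta> * d)" by (simp add: power2_eq_square)
    also have "\<dots> \<le> (1/2) * (\<theta> * d)"
    proof (rule mult_right_mono)
      have "L powr (1/4) * \<theta> = 1 / (8 * \<alpha> + 2)" using L by (simp add: \<theta>_def flip: powr_add)
      then have "4 * \<alpha> * (L powr (1/4) * \<theta>) = 4 * \<alpha> / (8 * \<alpha> + 2)" by (simp only: times_divide_eq_right mult_1_right)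
      also have "\<dots> \<le> 1 / 2" using \<alpha> by (simp add: field_simps)
      finally show "4 * \<alpha> * (L powr (1/4) * \<theta>) \<le> 1 / 2" .
    qed (use \<theta>0 d0 in auto)
    finally have "\<mu> * (exp (2 * \<theta>) - 1 - 2 * \<theta>) - \<theta> * d \<le> - (\<theta> / 2 * d)" by simp
    also have "\<dots> \<le> - (\<theta> / 2 * (t * L powr (1/2) / D))"
      using mult_left_mono[OF d, of "\<theta> / 2"] \<theta>0 by simp
    also have "\<dots> = - (t * L powr (1/4) / (2 * D * (8 * \<alpha> + 2)))"
    proof -
      have "L powr (1/2) = L powr (1/4) * L powr (1/4)" by (simp flip: powr_add)
      moreover have "L powr (-1/4) * L powr (1/4) = 1" using L by (simp flip: powr_add)
      ultimately have "L powr (-1/4) * L powr (1/2) = L powr (1/4)" by simp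
      then show ?thesis using D \<alpha> by (simp add: \<theta>_def field_simps)
    qed
    also have "\<dots> \<le> - (t * (8 * D * (8 * \<alpha> + 2) * (1 + ln L)) / (2 * D * (8 * \<alpha> + 2)))"
      using L(5) t D \<alpha> by (intro le_imp_neg_le divide_right_mono mult_left_mono) auto
    also have "\<dots> = - 4 * t * (1 + ln L)"
    proof -
      have "2 * D * (8 * \<alpha> + 2) \<noteq> 0" using D \<alpha> by simp
      then show ?thesis by (simp add: field_simps)
    qed
    also have "\<dots> \<le> - 4 * t * (1 + ln h)"
    proof -
      have "ln h \<le> ln L" using False h by simp
      then have "t * (1 + ln h) \<le> t * (1 + ln L)" using t by (intro mult_left_mono) auto
      then show ?thesis by simp
    qed
    finally show ?thesis using \<theta>0 by (intro exI[of _ \<theta>]) auto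
  qed
qed

text \<open>The right-hand side increases with \<open>t\<close>, and the left-hand side is its value
  at \<open>t = 1\<close>. It makes every size class in the union bound as rare as the smallest
  one.\<close>

lemma size_entropy_mono:
  fixes t n :: real
  assumes "1 \<le> t" "t \<le> n"
  shows "1 + ln n \<le> t * (1 + ln (n / t))"
proof -
  have l: "ln t \<le> ln n" "0 \<le> ln t" using assms by auto
  have "t * ln t \<le> (t - 1) * (1 + ln t)"
    using ln_le_minus_one[of t] assms by (simp add: algebra_simps)
  also have "\<dots> \<le> (t - 1) * (1 + ln n)" using l assms by (intro mult_left_mono) auto
  finally have "t * ln t \<le> (t - 1) * (1 + ln n)" .
  then show ?thesis using assms by (simp add: ln_div algebra_simps)
qed

context block_model begin

text \<open>Let \<open>k\<close> be the geometric mean of the two sizes. The balance condition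
  bounds \<open>k\<close> below by \<open>t L^(-1/4) / D\<close>, so the deviation
  \<open>L^(3/4) k\<close> is at least \<open>t L^(1/2) / D\<close>; the bound
  \<open>k \<le> t\<close> controls the mean. These are the two inputs of
  \<open>tail_exponent\<close>.\<close>

lemma block_pair_prob:
  assumes n: "n \<ge> 1" and L: "L = ln (real n)" and p: "p = \<alpha> * L / real n" and \<alpha>: "\<alpha> > 0" and D: "D > 0"
    and R: "tail_regime \<alpha> D L"
    and ST: "S \<subseteq> {..<n}" "T \<subseteq> {..<n}" and t: "t = max (card S) (card T)" "t \<ge> 1"
    and bal: "(real t)\<^sup>2 * L powr (-1/2) / D\<^sup>2 \<le> real (card S) * real (card T)"
  shows "measure_pmf.prob law {a. L powr (3/4) * sqrt (real (card S) * real (card T))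
        \<le> \<bar>\<Sum>i\<in>S. \<Sum>j\<in>T. adj a i j - mean i j\<bar>}
      \<le> 2 * exp (- 4 * real t * (1 + ln (real n / real t)))"
proof -
  have L1: "L \<ge> 1" using R by (simp add: tail_regime_def)
  define k where "k = sqrt (real (card S) * real (card T))"
  have k0: "k \<ge> 0" and k2: "k * k = real (card S) * real (card T)" by (simp_all add: k_def)
  have tn: "t \<le> n" using t ST card_mono[of "{..<n}" S] card_mono[of "{..<n}" T] by auto
  have kt: "k \<le> real t"
  proof -
    have "real (card S) * real (card T) \<le> real t * real t" using t by (intro mult_mono) auto
    then have "k \<le> sqrt (real t * real t)" unfolding k_def by (rule real_sqrt_le_mono)
    then show ?thesis by simp
  qed
  have tk: "real t * L powr (-1/4) / D \<le> k"
  proof -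
    have "L powr (-1/2) = L powr (-1/4) * L powr (-1/4)" by (simp flip: powr_add)
    then have "(real t)\<^sup>2 * L powr (-1/2) / D\<^sup>2 = (real t * L powr (-1/4) / D)\<^sup>2"
      by (simp add: power2_eq_square)
    then have "(real t * L powr (-1/4) / D)\<^sup>2 \<le> real (card S) * real (card T)" using bal by simp
    then have "sqrt ((real t * L powr (-1/4) / D)\<^sup>2) \<le> k" unfolding k_def by (rule real_sqrt_le_mono)
    then show ?thesis using D by simp
  qed
  define d where "d = L powr (3/4) * k"
  have "\<exists>\<theta>\<ge>0. (p * (real (card S) * real (card T))) * (exp (2 * \<theta>) - 1 - 2 * \<theta>) - \<theta> * d
      \<le> - 4 * real t * (1 + ln (real n / real t))"
  proof (rule tail_exponent[OF R \<alpha> D])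
    show "1 \<le> real n / real t" using t tn by simp
    show "real t * L powr (1 / 2) / D \<le> d"
    proof -
      have "L powr (1/2) = L powr (3/4) * L powr (-1/4)" by (simp flip: powr_add)
      then have "real t * L powr (1 / 2) / D = L powr (3/4) * (real t * L powr (-1/4) / D)" by simp
      also have "\<dots> \<le> d" unfolding d_def by (intro mult_left_mono tk) simp
      finally show ?thesis .
    qed
    have "p * (real (card S) * real (card T)) = \<alpha> * L / real n * (k * k)" by (simp add: p k2)
    also have "\<dots> \<le> \<alpha> * L / real n * (real t * k)"
      using \<alpha> L1 kt k0 by (intro mult_left_mono mult_right_mono) auto
    also have "\<dots> = \<alpha> * L powr (1 / 4) / (real n / real t) * d"
    proof -
      have "\<alpha> * L powr (1 / 4) / (real n / real t) * d = \<alpha> * (L powr (1/4) * L powr (3/4)) / real n * (real t * k)"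
        by (simp add: d_def)
      moreover have "L powr (1/4) * L powr (3/4) = L" using L1 by (simp flip: powr_add)
      ultimately show ?thesis by (simp only:)
    qed
    finally show "p * (real (card S) * real (card T)) \<le> \<alpha> * L powr (1 / 4) / (real n / real t) * d" .
    show "0 \<le> p * (real (card S) * real (card T))" using pq by simp
  qed simp
  then obtain \<theta> where \<theta>: "\<theta> \<ge> 0" "(p * (real (card S) * real (card T))) * (exp (2 * \<theta>) - 1 - 2 * \<theta>) - \<theta> * d
      \<le> - 4 * real t * (1 + ln (real n / real t))" by blast
  have "measure_pmf.prob law {a. d \<le> \<bar>\<Sum>i\<in>S. \<Sum>j\<in>T. adj a i j - mean i j\<bar>}
    \<le> 2 * exp (p * (real (card S) * real (card T)) * (exp (2 * \<theta>) - 1 - 2 * \<theta>) - \<theta> * d)"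
    by (rule block_tail[OF ST \<theta>(1)])
  also have "\<dots> \<le> 2 * exp (- 4 * real t * (1 + ln (real n / real t)))" using \<theta>(2) by simp
  finally show ?thesis by (simp add: d_def k_def)
qed

text \<open>Pairs violating the first condition are so unbalanced that the degree bound suffices for them.\<close>

definition discrepant :: "real \<Rightarrow> real \<Rightarrow> (nat \<times> nat \<Rightarrow> bool) \<Rightarrow> nat set \<Rightarrow> nat set \<Rightarrow> bool" where
  "discrepant L D a S T \<longleftrightarrow>
     (real (max (card S) (card T)))\<^sup>2 * L powr (-1/2) / D\<^sup>2 \<le> real (card S) * real (card T) \<and>
     L powr (3/4) * sqrt (real (card S) * real (card T)) \<le> \<bar>\<Sum>i\<in>S. \<Sum>j\<in>T. adj a i j - mean i j\<bar>"

text \<open>Union bound over the larger size \<open>t\<close>. With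
  \<open>X = t (1 + ln (n / t))\<close> there are at most \<open>exp (2 X)\<close> pairs, each
  failing with probability at most \<open>2 exp (- 4 X)\<close>. As \<open>X\<close> is at least
  \<open>ln n\<close>, each \<open>t\<close> costs at most \<open>2 / n^2\<close>, and there are
  \<open>n\<close> values of \<open>t\<close>.\<close>

lemma discrepancy_prob:
  assumes n: "n \<ge> 1" and L: "L = ln (real n)" and p: "p = \<alpha> * L / real n" and \<alpha>: "\<alpha> > 0" and D: "D > 0"
    and R: "tail_regime \<alpha> D L"
  shows "measure_pmf.prob law {a. \<exists>S\<subseteq>{..<n}. \<exists>T\<subseteq>{..<n}. S \<noteq> {} \<and> T \<noteq> {} \<and> discrepant L D a S T} \<le> 2 / real n"
proof -
  define F where "F t = {S. S \<subseteq> {..<n} \<and> card S \<le> t}" for t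
  define B where "B t z = {a. max (card (fst z)) (card (snd z)) = t \<and> discrepant L D a (fst z) (snd z)}" for t and z :: "nat set \<times> nat set"
  have finF: "finite (F t)" for t by (rule finite_subset[of _ "Pow {..<n}"]) (auto simp: F_def)
  have Bt: "measure_pmf.prob law (B t z) \<le> 2 * exp (- 4 * real t * (1 + ln (real n / real t)))"
    if t: "t \<in> {1..n}" and z: "z \<in> F t \<times> F t" for t z
  proof (cases "max (card (fst z)) (card (snd z)) = t \<and>
      (real t)\<^sup>2 * L powr (-1/2) / D\<^sup>2 \<le> real (card (fst z)) * real (card (snd z))")
    case True
    have "measure_pmf.prob law (B t z) \<le> measure_pmf.prob law {a. L powr (3/4) * sqrt (real (card (fst z)) * real (card (snd z)))
        \<le> \<bar>\<Sum>i\<in>fst z. \<Sum>j\<in>snd z. adj a i j - mean i j\<bar>}"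
      by (intro measure_pmf.finite_measure_mono) (auto simp: B_def discrepant_def)
    also have "\<dots> \<le> 2 * exp (- 4 * real t * (1 + ln (real n / real t)))"
      by (rule block_pair_prob[OF n L p \<alpha> D R]) (use True z t in \<open>auto simp: F_def\<close>)
    finally show ?thesis .
  next
    case False
    then have "B t z = {}" by (auto simp: B_def discrepant_def)
    then show ?thesis by simp
  qed
  have "{a. \<exists>S\<subseteq>{..<n}. \<exists>T\<subseteq>{..<n}. S \<noteq> {} \<and> T \<noteq> {} \<and> discrepant L D a S T}
      \<subseteq> (\<Union>t\<in>{1..n}. \<Union>z\<in>F t \<times> F t. B t z)"
  proof
    fix a assume "a \<in> {a. \<exists>S\<subseteq>{..<n}. \<exists>T\<subseteq>{..<n}. S \<noteq> {} \<and> T \<noteq> {} \<and> discrepant L D a S T}"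
    then obtain S T where ST: "S \<subseteq> {..<n}" "T \<subseteq> {..<n}" "S \<noteq> {}" "T \<noteq> {}" "discrepant L D a S T" by blast
    have c: "card S \<le> n" "card T \<le> n" using ST card_mono[of "{..<n}" S] card_mono[of "{..<n}" T] by auto
    have "finite S" using ST finite_subset by blast
    then have "card S \<ge> 1" using ST by (simp add: Suc_le_eq card_gt_0_iff)
    then have "max (card S) (card T) \<in> {1..n}" using c by auto
    moreover have "(S, T) \<in> F (max (card S) (card T)) \<times> F (max (card S) (card T))" using ST by (auto simp: F_def)
    moreover have "a \<in> B (max (card S) (card T)) (S, T)" using ST by (simp add: B_def)
    ultimately show "a \<in> (\<Union>t\<in>{1..n}. \<Union>z\<in>F t \<times> F t. B t z)" by blast
  qed
  then have "measure_pmf.prob law {a. \<exists>S\<subseteq>{..<n}. \<exists>T\<subseteq>{..<n}. S \<noteq> {} \<and> T \<noteq> {} \<and> discrepant L D a S T}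
      \<le> measure_pmf.prob law (\<Union>t\<in>{1..n}. \<Union>z\<in>F t \<times> F t. B t z)"
    by (intro measure_pmf.finite_measure_mono) auto
  also have "\<dots> \<le> (\<Sum>t\<in>{1..n}. measure_pmf.prob law (\<Union>z\<in>F t \<times> F t. B t z))"
    by (rule measure_UNION_le) auto
  also have "\<dots> \<le> (\<Sum>t\<in>{1..n}. \<Sum>z\<in>F t \<times> F t. measure_pmf.prob law (B t z))"
    by (intro sum_mono measure_UNION_le) (auto simp: finF)
  also have "\<dots> \<le> (\<Sum>t\<in>{1..n}. \<Sum>z\<in>F t \<times> F t. 2 * exp (- 4 * real t * (1 + ln (real n / real t))))"
    by (intro sum_mono Bt)
  also have "\<dots> \<le> (\<Sum>t\<in>{1..n}. 2 / (real n)\<^sup>2)"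
  proof (rule sum_mono)
    fix t assume t: "t \<in> {1..n}"
    define X where "X = real t * (1 + ln (real n / real t))"
    have "real (card (F t)) \<le> exp X" unfolding F_def X_def using t by (intro card_small_subsets_le) auto
    then have "real (card (F t)) * real (card (F t)) \<le> exp X * exp X" by (intro mult_mono) auto
    then have "real (card (F t)) * real (card (F t)) * (2 * exp (- 4 * X)) \<le> exp X * exp X * (2 * exp (- 4 * X))"
      by (intro mult_right_mono) auto
    also have "\<dots> = 2 * exp (- 2 * X)" by (simp flip: exp_add)
    also have "\<dots> \<le> 2 * exp (- 2 * ln (real n))"
    proof -
      have "1 + ln (real n) \<le> X" unfolding X_def using t by (intro size_entropy_mono) auto
      then show ?thesis by simp
    qed
    also have "exp (- 2 * ln (real n)) = 1 / (real n)\<^sup>2"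
      using n exp_of_nat_mult[of 2 "ln (real n)"] by (simp add: exp_minus field_simps)
    finally show "(\<Sum>z\<in>F t \<times> F t. 2 * exp (- 4 * real t * (1 + ln (real n / real t)))) \<le> 2 / (real n)\<^sup>2"
      by (simp add: card_cartesian_product X_def mult.assoc)
  qed
  also have "\<dots> = 2 / real n" using n by (simp add: power2_eq_square)
  finally show ?thesis .
qed

section \<open>Operator norm of the noise and the good graphs\<close>

definition noise_bound :: "real \<Rightarrow> (nat \<times> nat \<Rightarrow> bool) \<Rightarrow> bool" where
  "noise_bound w a \<longleftrightarrow> (\<forall>z. (\<Sum>i<n. (\<Sum>j<n. (adj a i j - mean i j) * z j)\<^sup>2) \<le> w\<^sup>2 * (\<Sum>j<n. (z j)\<^sup>2))"

text \<open>\<open>D = 3 * \<alpha> + 2\<close> is the degree bound \<open>2 * \<alpha> + 2\<close>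
  plus the bound \<open>\<alpha>\<close> on the mean degree, both in units of \<open>L\<close>; so
  \<open>D * L\<close> bounds the absolute row sums of the centred matrix.\<close>

lemma noise_bound_of_regular:
  assumes n: "n \<ge> 1" and L: "L \<ge> 1" and p: "real n * p \<le> \<alpha> * L" and \<alpha>: "\<alpha> > 0"
    and D: "D = 3 * \<alpha> + 2"
    and deg: "\<And>i. i < n \<Longrightarrow> (\<Sum>j<n. adj a i j) \<le> (2 * \<alpha> + 2) * L"
    and disc: "\<And>S T. S \<subseteq> {..<n} \<Longrightarrow> T \<subseteq> {..<n} \<Longrightarrow> S \<noteq> {} \<Longrightarrow> T \<noteq> {} \<Longrightarrow> \<not> discrepant L D a S T"
  shows "noise_bound ((16 + 4 * D) * L powr (11/12)) a"
proof -
  define W where "W i j = adj a i j - mean i j" for i j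
  have W_sym: "W i j = W j i" for i j by (simp add: W_def adj_commute[of a i] mean_commute[of i])
  have D0: "D > 0" using D \<alpha> by simp
  have rows: "(\<Sum>j<n. \<bar>W i j\<bar>) \<le> D * L" if i: "i < n" for i
  proof -
    have "(\<Sum>j<n. \<bar>W i j\<bar>) \<le> (\<Sum>j<n. adj a i j + p)"
    proof (rule sum_mono)
      fix j show "\<bar>W i j\<bar> \<le> adj a i j + p"
        using mean_bounds[of i j] pq by (auto simp: W_def adj_def)
    qed
    also have "\<dots> = (\<Sum>j<n. adj a i j) + real n * p" by (simp add: sum.distrib)
    also have "\<dots> \<le> (2 * \<alpha> + 2) * L + \<alpha> * L" using deg[OF i] p by simp
    finally show ?thesis by (simp add: D algebra_simps)
  qed
  have cols: "(\<Sum>i<n. \<bar>W i j\<bar>) \<le> D * L" if "j < n" for j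
    using rows[OF that] by (simp add: W_sym[of _ j])
  have disc': "\<bar>\<Sum>i\<in>S. \<Sum>j\<in>T. W i j\<bar> \<le> L powr (3/4) * sqrt (real (card S) * real (card T))"
    if ST: "S \<subseteq> {..<n}" "T \<subseteq> {..<n}" for S T
  proof (cases "S = {} \<or> T = {}")
    case True
    then show ?thesis by auto
  next
    case False
    have fin: "finite S" "finite T" using ST finite_subset by auto
    have row_block: "\<bar>\<Sum>i\<in>X. \<Sum>j\<in>Y. W i j\<bar> \<le> D * L * real (card X)" if "X \<subseteq> {..<n}" "Y \<subseteq> {..<n}" for X Y
    proof -
      have "\<bar>\<Sum>i\<in>X. \<Sum>j\<in>Y. W i j\<bar> \<le> (\<Sum>i\<in>X. \<Sum>j\<in>Y. \<bar>W i j\<bar>)"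
        by (rule order_trans[OF sum_abs sum_mono[OF sum_abs]])
      also have "\<dots> \<le> (\<Sum>i\<in>X. \<Sum>j<n. \<bar>W i j\<bar>)" using that by (intro sum_mono sum_mono2) auto
      also have "\<dots> \<le> (\<Sum>i\<in>X. D * L)" using that by (intro sum_mono rows) auto
      finally show ?thesis by (simp add: mult.commute)
    qed
    define s t where "s = real (min (card S) (card T))" "t = real (max (card S) (card T))"
    have st: "real (card S) * real (card T) = s * t"
      unfolding s_t_def by (simp add: min_def max_def)
    have s0: "s \<ge> 0" "t \<ge> 0" by (simp_all add: s_t_def)
    have min: "\<bar>\<Sum>i\<in>S. \<Sum>j\<in>T. W i j\<bar> \<le> D * L * s"
    proof (cases "card S \<le> card T")
      case True
      then show ?thesis using row_block[OF ST] by (simp add: s_t_def)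
    next
      case False
      have "(\<Sum>i\<in>S. \<Sum>j\<in>T. W i j) = (\<Sum>j\<in>T. \<Sum>i\<in>S. W j i)"
        by (subst sum.swap) (simp add: W_sym)
      then show ?thesis using row_block[OF ST(2) ST(1)] False by (simp add: s_t_def)
    qed
    show ?thesis
    proof (cases "t\<^sup>2 * L powr (-1/2) / D\<^sup>2 \<le> s * t")
      case True
      then show ?thesis using disc[OF ST] False unfolding discrepant_def s_t_def[symmetric] st
        by (auto simp: W_def)
    next
      case unbal: False
      have t0: "t > 0" using False fin by (simp add: s_t_def max_def card_gt_0_iff)
      \<comment> \<open>For an unbalanced pair the trivial bound \<open>D * L * s\<close> by row
        sums of the smaller set is already below \<open>L^(3/4) sqrt (s t)\<close>; the balance
        threshold is the point at which the two agree.\<close>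
      have "t * (s * D\<^sup>2) < t * (t * L powr (-1/2))" using unbal D0 by (simp add: field_simps power2_eq_square)
      then have sD: "s * D\<^sup>2 \<le> t * L powr (-1/2)" using t0 by simp
      have "(D * L * s)\<^sup>2 = (s * D\<^sup>2) * (L\<^sup>2 * s)" by (simp add: power2_eq_square)
      also have "\<dots> \<le> (t * L powr (-1/2)) * (L\<^sup>2 * s)" using s0 by (intro mult_right_mono sD) auto
      also have "\<dots> = (L powr (3/4))\<^sup>2 * (s * t)"
      proof -
        have "L\<^sup>2 = L powr 2" using L by (simp add: powr_numeral)
        then have "L powr (-1/2) * L\<^sup>2 = (L powr (3/4))\<^sup>2" by (simp add: power2_eq_square flip: powr_add)
        then show ?thesis by (simp add: ac_simps)
      qed
      also have "\<dots> = (L powr (3/4) * sqrt (s * t))\<^sup>2" using s0 by (simp add: power_mult_distrib)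
      finally have "D * L * s \<le> L powr (3/4) * sqrt (s * t)" by (rule power2_le_imp_le) (use s0 in simp)
      then show ?thesis using min unfolding st by linarith
    qed
  qed
  \<comment> \<open>This \<open>R\<close> equates the orders of \<open>L^(3/4) R^2\<close> and
    \<open>D L / R\<close>. Rounding up costs at most a factor 2, as
    \<open>L \<ge> 1\<close>.\<close>
  define R where "R = nat \<lceil>L powr (1/12)\<rceil>"
  have L12: "1 \<le> L powr (1/12)" using L by (simp add: ge_one_powr_ge_zero)
  have R1: "L powr (1/12) \<le> real R" by (simp add: R_def real_nat_ceiling_ge)
  have R2: "real R \<le> 2 * L powr (1/12)" using L12 unfolding R_def by linarith
  have Rpos: "R > 0" using R1 L12 by linarith
  have c: "L powr (3/4) * (real R)\<^sup>2 + (D * L) / real R \<le> (4 + D) * L powr (11/12)"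
  proof -
    have "(real R)\<^sup>2 \<le> (2 * L powr (1/12))\<^sup>2" using R2 by (intro power_mono) auto
    also have "\<dots> = 4 * L powr (1/6)" by (simp add: power2_eq_square flip: powr_add)
    finally have "L powr (3/4) * (real R)\<^sup>2 \<le> L powr (3/4) * (4 * L powr (1/6))" by (intro mult_left_mono) auto
    also have "\<dots> = 4 * L powr (11/12)" by (simp flip: powr_add)
    finally have 1: "L powr (3/4) * (real R)\<^sup>2 \<le> 4 * L powr (11/12)" .
    have "(D * L) / real R \<le> (D * L) / L powr (1/12)"
      using R1 L12 D0 L by (intro divide_left_mono) auto
    also have "\<dots> = D * L powr (11/12)"
    proof -
      have "L = L powr (11/12) * L powr (1/12)" using L by (simp flip: powr_add)
      then have "D * L / L powr (1/12) = D * (L powr (11/12) * L powr (1/12)) / L powr (1/12)" by simp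
      then show ?thesis using L by simp
    qed
    finally show ?thesis using 1 by (simp add: distrib_right)
  qed
  show ?thesis
    unfolding noise_bound_def
  proof
    fix z
    have "(\<Sum>i<n. (\<Sum>j<n. W i j * z j)\<^sup>2)
       \<le> (4 * (L powr (3/4) * (real R)\<^sup>2 + (D * L) / real R))\<^sup>2 * (\<Sum>j<n. (z j)\<^sup>2)"
      by (rule discrepancy_operator_bound) (use Rpos D0 L rows cols disc' in auto)
    also have "\<dots> \<le> ((16 + 4 * D) * L powr (11/12))\<^sup>2 * (\<Sum>j<n. (z j)\<^sup>2)"
    proof (intro mult_right_mono power_mono)
      have "4 * (L powr (3/4) * (real R)\<^sup>2 + (D * L) / real R) \<le> 4 * ((4 + D) * L powr (11/12))"
        using c by simp
      then show "4 * (L powr (3/4) * (real R)\<^sup>2 + (D * L) / real R) \<le> (16 + 4 * D) * L powr (11/12)"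
        by (simp add: algebra_simps)
    qed (use D0 L in \<open>auto intro!: sum_nonneg\<close>)
    finally show "(\<Sum>i<n. (\<Sum>j<n. (adj a i j - mean i j) * z j)\<^sup>2)
       \<le> ((16 + 4 * D) * L powr (11/12))\<^sup>2 * (\<Sum>j<n. (z j)\<^sup>2)"
      by (simp add: W_def)
  qed
qed

definition good_graph :: "real \<Rightarrow> real \<Rightarrow> real \<Rightarrow> (nat \<times> nat \<Rightarrow> bool) \<Rightarrow> bool" where
  "good_graph k \<Delta> w a \<longleftrightarrow> (\<forall>i<n. k \<le> (\<Sum>j<n. x i * x j * adj a i j)) \<and>
     (\<forall>i<n. (\<Sum>j<n. adj a i j) \<le> \<Delta>) \<and> noise_bound w a"

text \<open>\<open>m\<close> is the Chernoff exponent of a negative margin, reduced by the price of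
  asking for the margin \<open>\<kappa> * L\<close> instead of 0. The \<open>n\<close> degrees fail
  with total probability at most \<open>1 / n\<close>, and the discrepancy with at most
  \<open>2 / n\<close>.\<close>

lemma good_graph_prob:
  assumes n: "n \<ge> 1" and L: "L = ln (real n)" and p: "p = \<alpha> * L / real n" and q: "q = \<beta> * L / real n"
    and ab: "0 < \<beta>" "\<beta> < \<alpha>" and D: "D = 3 * \<alpha> + 2" and R: "tail_regime \<alpha> D L"
    and m: "m = (sqrt \<alpha> - sqrt \<beta>)\<^sup>2 / 2 - ln (\<alpha> / \<beta>) / 2 * \<kappa>"
  shows "measure_pmf.prob law {a. \<not> good_graph (\<kappa> * L) ((2 * \<alpha> + 2) * L) ((16 + 4 * D) * L powr (11/12)) a}
    \<le> real n powr (1 - m) + 3 / real n"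
proof -
  \<comment> \<open>The minimiser of
    \<open>\<alpha> (exp (- \<theta>) - 1) + \<beta> (exp \<theta> - 1)\<close>; the minimum is
    minus the square of \<open>sqrt \<alpha> - sqrt \<beta>\<close>.\<close>
  define \<theta> where "\<theta> = ln (\<alpha> / \<beta>) / 2"
  have \<theta>: "\<theta> > 0" using ab by (simp add: \<theta>_def)
  have \<alpha>: "\<alpha> > 0" and D0: "D > 0" using ab D by auto
  have L1: "L \<ge> 1" using R by (simp add: tail_regime_def)
  have np: "real n * p = \<alpha> * L" using n by (simp add: p)
  define E1 where "E1 i = {a. (\<Sum>j<n. x i * x j * adj a i j) \<le> \<kappa> * L}" for i
  define E2 where "E2 i = {a. (2 * \<alpha> + 2) * L \<le> (\<Sum>j<n. adj a i j)}" for i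
  define E3 where "E3 = {a. \<exists>S\<subseteq>{..<n}. \<exists>T\<subseteq>{..<n}. S \<noteq> {} \<and> T \<noteq> {} \<and> discrepant L D a S T}"
  have 1: "measure_pmf.prob law (E1 i) \<le> real n powr (- m)" if i: "i < n" for i
  proof -
    have e: "exp \<theta> = sqrt \<alpha> / sqrt \<beta>" "exp (- \<theta>) = sqrt \<beta> / sqrt \<alpha>"
    proof -
      have "\<theta> = ln (sqrt \<alpha> / sqrt \<beta>)" using ab by (simp add: \<theta>_def ln_div ln_sqrt)
      then show "exp \<theta> = sqrt \<alpha> / sqrt \<beta>" using ab by simp
      then show "exp (- \<theta>) = sqrt \<beta> / sqrt \<alpha>" by (simp add: exp_minus)
    qed
    have sq: "sqrt \<alpha> * sqrt \<alpha> = \<alpha>" "sqrt \<beta> * sqrt \<beta> = \<beta>" using ab by auto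
    have "\<alpha> * exp (- \<theta>) = sqrt \<alpha> * sqrt \<beta>" "\<beta> * exp \<theta> = sqrt \<alpha> * sqrt \<beta>"
      unfolding e using ab sq by (simp_all add: field_simps)
    then have "\<alpha> * (exp (- \<theta>) - 1) + \<beta> * (exp \<theta> - 1) = - (sqrt \<alpha> - sqrt \<beta>)\<^sup>2"
      using sq by (simp add: algebra_simps power2_eq_square)
    moreover have "real n / 2 * (p * (exp (- \<theta>) - 1) + q * (exp \<theta> - 1))
      = L / 2 * (\<alpha> * (exp (- \<theta>) - 1) + \<beta> * (exp \<theta> - 1))"
      using n by (simp add: p q field_simps)
    ultimately have "real n / 2 * (p * (exp (- \<theta>) - 1) + q * (exp \<theta> - 1)) = L / 2 * - (sqrt \<alpha> - sqrt \<beta>)\<^sup>2"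
      by (simp only:)
    then have "real n / 2 * (p * (exp (- \<theta>) - 1) + q * (exp \<theta> - 1)) + \<theta> * (\<kappa> * L)
        = L / 2 * - (sqrt \<alpha> - sqrt \<beta>)\<^sup>2 + \<theta> * (\<kappa> * L)" by (simp only:)
    also have "\<dots> = - m * L"
      unfolding m \<theta>_def[symmetric] by (simp add: algebra_simps)
    finally have "real n / 2 * (p * (exp (- \<theta>) - 1) + q * (exp \<theta> - 1)) + \<theta> * (\<kappa> * L) = - m * L" .
    moreover have "exp (- m * L) = real n powr (- m)" using n by (simp add: L powr_def)
    ultimately show ?thesis using margin_tail[OF i \<theta>, of "\<kappa> * L"] by (simp add: E1_def)
  qed
  have 2: "measure_pmf.prob law (E2 i) \<le> 1 / (real n)\<^sup>2" if i: "i < n" for i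
  proof -
    have "2 * (real n * p) - (2 * \<alpha> + 2) * L = - (2 * L)" unfolding np by (simp add: algebra_simps)
    moreover have "exp (- (2 * L)) = 1 / (real n)\<^sup>2"
      using n exp_of_nat_mult[of 2 L] by (simp add: L exp_minus field_simps)
    ultimately show ?thesis using degree_tail[OF i, of "(2 * \<alpha> + 2) * L"] by (simp add: E2_def)
  qed
  have 3: "measure_pmf.prob law E3 \<le> 2 / real n"
    unfolding E3_def by (rule discrepancy_prob[OF n L p \<alpha> D0 R])
  have "{a. \<not> good_graph (\<kappa> * L) ((2 * \<alpha> + 2) * L) ((16 + 4 * D) * L powr (11/12)) a}
     \<subseteq> (\<Union>i\<in>{..<n}. E1 i) \<union> ((\<Union>i\<in>{..<n}. E2 i) \<union> E3)"
  proof (rule subsetI, rule ccontr)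
    fix a assume bad: "a \<in> {a. \<not> good_graph (\<kappa> * L) ((2 * \<alpha> + 2) * L) ((16 + 4 * D) * L powr (11/12)) a}"
      and "a \<notin> (\<Union>i\<in>{..<n}. E1 i) \<union> ((\<Union>i\<in>{..<n}. E2 i) \<union> E3)"
    then have a: "\<And>i. i < n \<Longrightarrow> a \<notin> E1 i" "\<And>i. i < n \<Longrightarrow> a \<notin> E2 i" "a \<notin> E3" by auto
    have deg: "(\<Sum>j<n. adj a i j) \<le> (2 * \<alpha> + 2) * L" if "i < n" for i
      using a(2)[OF that] by (simp add: E2_def)
    have "noise_bound ((16 + 4 * D) * L powr (11/12)) a"
      by (rule noise_bound_of_regular[OF n L1 _ \<alpha> D deg]) (use np a(3) in \<open>auto simp: E3_def\<close>)
    moreover have "\<kappa> * L \<le> (\<Sum>j<n. x i * x j * adj a i j)" if "i < n" for i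
      using a(1)[OF that] by (simp add: E1_def)
    ultimately show False using bad deg by (auto simp: good_graph_def)
  qed
  then have "measure_pmf.prob law {a. \<not> good_graph (\<kappa> * L) ((2 * \<alpha> + 2) * L) ((16 + 4 * D) * L powr (11/12)) a}
     \<le> measure_pmf.prob law ((\<Union>i\<in>{..<n}. E1 i) \<union> ((\<Union>i\<in>{..<n}. E2 i) \<union> E3))"
    by (intro measure_pmf.finite_measure_mono) auto
  also have "\<dots> \<le> measure_pmf.prob law (\<Union>i\<in>{..<n}. E1 i) + measure_pmf.prob law ((\<Union>i\<in>{..<n}. E2 i) \<union> E3)"
    by (rule measure_Un_le) auto
  also have "\<dots> \<le> measure_pmf.prob law (\<Union>i\<in>{..<n}. E1 i) + (measure_pmf.prob law (\<Union>i\<in>{..<n}. E2 i) + measure_pmf.prob law E3)"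
    by (intro add_left_mono measure_Un_le) auto
  also have "\<dots> \<le> (\<Sum>i<n. measure_pmf.prob law (E1 i)) + ((\<Sum>i<n. measure_pmf.prob law (E2 i)) + measure_pmf.prob law E3)"
    by (intro add_mono measure_UNION_le order_refl) auto
  also have "\<dots> \<le> (\<Sum>i<n. real n powr (- m)) + ((\<Sum>i<n. 1 / (real n)\<^sup>2) + 2 / real n)"
    by (intro add_mono sum_mono 1 2 3) auto
  also have "\<dots> = real n powr (1 - m) + 3 / real n"
  proof -
    have "real n powr (1 - m) = real n * real n powr (- m)" using n powr_add[of "real n" 1 "- m"] by simp
    then show ?thesis using n by (simp add: power2_eq_square)
  qed
  finally show ?thesis .
qed

end

section \<open>Projected power iterations\<close>

lemma mult_mat_vec_index_sum:
  "A \<in> carrier_mat n n \<Longrightarrow> v \<in> carrier_vec n \<Longrightarrow> i < n \<Longrightarrow> (A *\<^sub>v v) $ i = (\<Sum>j<n. A $$ (i, j) * v $ j)"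
  by (simp add: scalar_prod_def lessThan_atLeast0)

lemma scalar_prod_sum: "v \<in> carrier_vec n \<Longrightarrow> u \<bullet> v = (\<Sum>i<n. u $ i * v $ i)"
  by (simp add: scalar_prod_def lessThan_atLeast0)

lemma balanced_labels_sq:
  assumes "u \<in> balanced_labels n" "i < n"
  shows "u $ i * u $ i = 1"
  using assms by (auto simp: balanced_labels_def)

text \<open>As \<open>u\<close> and \<open>z\<close> are both balanced, there are as many errors of
  one sign as of the other. If each kind contained an index at which \<open>c\<close> has the sign
  of \<open>z\<close>, exchanging the two labels would bring \<open>u\<close> closer to
  \<open>c\<close>. So one kind consists of bad indices only, and it makes up half of the
  errors.\<close>

lemma projection_mismatch:
  assumes z: "z \<in> balanced_labels n" and u: "u \<in> projection n c" and c: "c \<in> carrier_vec n"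
  shows "card {i. i < n \<and> u $ i \<noteq> z $ i} \<le> 2 * card {i. i < n \<and> z $ i * c $ i \<le> 0}"
proof -
  have uB: "u \<in> balanced_labels n" and
    umin: "\<And>u'. u' \<in> balanced_labels n \<Longrightarrow> \<not> (u' - c) \<bullet> (u' - c) < (u - c) \<bullet> (u - c)"
    using u by (auto simp: projection_def is_arg_min_def)
  have uv: "u $ i = -1 \<or> u $ i = 1" and zv: "z $ i = -1 \<or> z $ i = 1" if "i < n" for i
    using uB z that by (auto simp: balanced_labels_def)
  have dims: "dim_vec u = n" "dim_vec c = n" using uB c by (auto simp: balanced_labels_def)
  define P where "P = {i. i < n \<and> z $ i = 1 \<and> u $ i = -1}"
  define Q where "Q = {i. i < n \<and> z $ i = -1 \<and> u $ i = 1}"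
  define bad where "bad = {i. i < n \<and> z $ i * c $ i \<le> 0}"
  have fin: "finite P" "finite Q" "finite bad" by (auto simp: P_def Q_def bad_def)
  have "(\<Sum>i<n. z $ i - u $ i) = 0" using uB z by (simp add: balanced_labels_def sum_subtractf)
  moreover have "(\<Sum>i<n. z $ i - u $ i) = (\<Sum>i<n. (if i \<in> P then 2 else 0) - (if i \<in> Q then 2 else 0))"
  proof (rule sum.cong[OF refl])
    fix i assume "i \<in> {..<n}"
    then show "z $ i - u $ i = (if i \<in> P then 2 else 0) - (if i \<in> Q then 2 else 0)"
      using uv[of i] zv[of i] by (auto simp: P_def Q_def)
  qed
  moreover have "\<dots> = 2 * real (card P) - 2 * real (card Q)"
  proof -
    have "{..<n} \<inter> P = P" "{..<n} \<inter> Q = Q" by (auto simp: P_def Q_def)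
    then show ?thesis by (simp add: sum_subtractf sum.If_cases)
  qed
  ultimately have PQ: "card P = card Q" by simp
  have "P \<subseteq> bad \<or> Q \<subseteq> bad"
  proof (rule ccontr)
    assume "\<not> ?thesis"
    then obtain i j where i: "i \<in> P" "i \<notin> bad" and j: "j \<in> Q" "j \<notin> bad" by blast
    have ij: "i < n" "j < n" "i \<noteq> j" "u $ i = -1" "u $ j = 1" "c $ i > 0" "c $ j < 0"
      using i j by (auto simp: P_def Q_def bad_def)
    \<comment> \<open>The exchange keeps the sum zero and changes the squared distance by
      \<open>4 * c $ j - 4 * c $ i\<close>, which is negative.\<close>
    define u' where "u' = vec n (\<lambda>k. if k = i then 1 else if k = j then -1 else u $ k)"
    have diff: "u' $ k - u $ k = (if k = i then 2 else 0) - (if k = j then 2 else 0)" if "k < n" for k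
      using that ij by (simp add: u'_def)
    have "(\<Sum>k<n. u' $ k - u $ k) = (\<Sum>k<n. (if k = i then 2 else 0) - (if k = j then 2 else (0::real)))"
      by (intro sum.cong refl diff) auto
    also have "\<dots> = 0" using ij by (simp add: sum_subtractf)
    finally have "(\<Sum>k<n. u' $ k) = 0" using uB by (simp add: sum_subtractf balanced_labels_def)
    then have u'B: "u' \<in> balanced_labels n"
      using uv by (auto simp: balanced_labels_def u'_def)
    have "(u' - c) \<bullet> (u' - c) - (u - c) \<bullet> (u - c) = (\<Sum>k<n. (u' $ k - c $ k) * (u' $ k - c $ k) - (u $ k - c $ k) * (u $ k - c $ k))"
      using dims by (simp add: scalar_prod_def u'_def sum_subtractf lessThan_atLeast0)
    also have "\<dots> = (\<Sum>k<n. (if k = i then - 4 * c $ i else 0) + (if k = j then 4 * c $ j else 0))"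
      by (rule sum.cong[OF refl]) (use ij in \<open>auto simp: u'_def algebra_simps\<close>)
    also have "\<dots> = 4 * c $ j - 4 * c $ i" using ij by (simp add: sum.distrib)
    also have "\<dots> < 0" using ij by simp
    finally show False using umin[OF u'B] by simp
  qed
  then have Pb: "card P \<le> card bad" using fin PQ card_mono[of bad] by metis
  have "{i. i < n \<and> u $ i \<noteq> z $ i} \<subseteq> P \<union> Q"
  proof
    fix i assume "i \<in> {i. i < n \<and> u $ i \<noteq> z $ i}"
    then show "i \<in> P \<union> Q" using uv[of i] zv[of i] by (auto simp: P_def Q_def)
  qed
  then have "card {i. i < n \<and> u $ i \<noteq> z $ i} \<le> card (P \<union> Q)" using fin by (intro card_mono) auto
  also have "\<dots> \<le> card P + card Q" by (rule card_Un_le)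
  finally show ?thesis using Pb PQ by (simp add: bad_def)
qed

text \<open>\<open>z\<close> is the true label or its negative, whichever the first stage has come
  close to; the mean matrix is the same for both signs.\<close>

locale recovery_setting =
  fixes n :: nat and A :: "real mat" and z :: "real vec" and r g k w :: real
  assumes n: "n \<ge> 1" and A: "A \<in> carrier_mat n n" and z: "z \<in> balanced_labels n"
    and margin: "\<And>i. i < n \<Longrightarrow> k \<le> (\<Sum>j<n. z $ i * z $ j * A $$ (i, j))"
    and noise: "\<And>v. (\<Sum>i<n. (\<Sum>j<n. (A $$ (i, j) - (r + g * (z $ i * z $ j))) * v j)\<^sup>2) \<le> w\<^sup>2 * (\<Sum>j<n. (v j)\<^sup>2)"
    and k: "k > 0" and g: "g \<ge> 0"
begin

definition err :: "real vec \<Rightarrow> real" where "err x = (\<Sum>i<n. (x $ i - z $ i)\<^sup>2)"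

lemma err_nonneg: "err x \<ge> 0"
  by (simp add: err_def sum_nonneg)

lemma z_carrier: "z \<in> carrier_vec n" and z_sum: "(\<Sum>i<n. z $ i) = 0"
  using z by (auto simp: balanced_labels_def)

lemma z_sq: "i < n \<Longrightarrow> z $ i * z $ i = 1"
  using balanced_labels_sq[OF z] .

text \<open>The difference \<open>v = x - z\<close> sums to zero, so the constant part of the mean
  vanishes on it. As \<open>x\<close> and \<open>z\<close> have equal norms, the inner product of
  \<open>z\<close> and \<open>v\<close> is \<open>- err x / 2\<close>, and the label part costs at
  most half of the margin. A bad index thus has noise of modulus at least \<open>k / 2\<close>, so
  there are at most \<open>4 w^2 / k^2 * err x\<close> of them. Each accounts for at most two wrong
  labels of squared error 4, which gives 32.\<close>

lemma projection_contracts: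
  assumes x: "x \<in> carrier_vec n" "(\<Sum>i<n. x $ i) = 0" "(\<Sum>i<n. (x $ i)\<^sup>2) = real n"
    and e: "g * err x \<le> k" and u: "u \<in> projection n (A *\<^sub>v x)"
  shows "err u \<le> 32 * w\<^sup>2 / k\<^sup>2 * err x"
proof -
  define v where "v j = x $ j - z $ j" for j
  define Wv where "Wv i = (\<Sum>j<n. (A $$ (i, j) - (r + g * (z $ i * z $ j))) * v j)" for i
  define bad where "bad = {i. i < n \<and> z $ i * (A *\<^sub>v x) $ i \<le> 0}"
  have v_sum: "(\<Sum>j<n. v j) = 0" using x z_sum by (simp add: v_def sum_subtractf)
  have zv: "(\<Sum>j<n. z $ j * v j) = - err x / 2"
  proof -
    have "err x = (\<Sum>i<n. (x $ i)\<^sup>2 - z $ i * z $ i - 2 * (z $ i * v i))"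
      unfolding err_def by (rule sum.cong[OF refl]) (simp add: v_def power2_eq_square algebra_simps)
    also have "\<dots> = real n - (\<Sum>i<n. z $ i * z $ i) - 2 * (\<Sum>i<n. z $ i * v i)"
      by (simp add: sum_subtractf sum_distrib_left x)
    also have "(\<Sum>i<n. z $ i * z $ i) = real n" by (simp add: z_sq)
    finally show ?thesis by simp
  qed
  have decomp: "z $ i * (A *\<^sub>v x) $ i = (\<Sum>j<n. z $ i * z $ j * A $$ (i, j)) + z $ i * Wv i - g * err x / 2"
    if i: "i < n" for i
  proof -
    have "(\<Sum>j<n. A $$ (i, j) * v j) = Wv i + r * (\<Sum>j<n. v j) + g * z $ i * (\<Sum>j<n. z $ j * v j)"
      unfolding Wv_def by (simp add: sum_distrib_left algebra_simps flip: sum.distrib)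
    then have 1: "(\<Sum>j<n. A $$ (i, j) * v j) = Wv i - g * z $ i * err x / 2" by (simp add: v_sum zv)
    have "(A *\<^sub>v x) $ i = (\<Sum>j<n. A $$ (i, j) * z $ j + A $$ (i, j) * v j)"
      using mult_mat_vec_index_sum[OF A x(1) i] by (simp add: v_def algebra_simps)
    also have "\<dots> = (\<Sum>j<n. A $$ (i, j) * z $ j) + (Wv i - g * z $ i * err x / 2)"
      by (simp add: sum.distrib 1)
    finally have 2: "(A *\<^sub>v x) $ i = (\<Sum>j<n. A $$ (i, j) * z $ j) + (Wv i - g * z $ i * err x / 2)" .
    have "z $ i * (A *\<^sub>v x) $ i = z $ i * (\<Sum>j<n. A $$ (i, j) * z $ j) + z $ i * Wv i - (z $ i * z $ i) * (g * err x / 2)"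
      unfolding 2 by (simp add: algebra_simps)
    then show ?thesis by (simp add: z_sq[OF i] sum_distrib_left ac_simps)
  qed
  have badW: "(k / 2)\<^sup>2 \<le> (Wv i)\<^sup>2" if "i \<in> bad" for i
  proof -
    have i: "i < n" and le: "z $ i * (A *\<^sub>v x) $ i \<le> 0" using that by (auto simp: bad_def)
    have "k / 2 \<le> - (z $ i * Wv i)" using decomp[OF i] margin[OF i] e le by linarith
    then have "(k / 2)\<^sup>2 \<le> (- (z $ i * Wv i))\<^sup>2" using k by (intro power_mono) auto
    also have "\<dots> = (z $ i * z $ i) * (Wv i)\<^sup>2" by (simp add: power2_eq_square)
    finally show ?thesis by (simp add: z_sq[OF i])
  qed
  have "(k / 2)\<^sup>2 * real (card bad) = (\<Sum>i\<in>bad. (k / 2)\<^sup>2)" by simp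
  also have "\<dots> \<le> (\<Sum>i\<in>bad. (Wv i)\<^sup>2)" by (intro sum_mono badW)
  also have "\<dots> \<le> (\<Sum>i<n. (Wv i)\<^sup>2)" by (rule sum_mono2) (auto simp: bad_def)
  also have "\<dots> \<le> w\<^sup>2 * err x" using noise[of v] by (simp add: Wv_def err_def v_def)
  finally have bad: "real (card bad) \<le> 4 * w\<^sup>2 / k\<^sup>2 * err x" using k by (simp add: field_simps power2_eq_square)
  have uB: "u \<in> balanced_labels n" using u by (auto simp: projection_def is_arg_min_def)
  have "err u = (\<Sum>i<n. if u $ i \<noteq> z $ i then 4 else 0)"
    unfolding err_def
  proof (rule sum.cong[OF refl])
    fix i assume "i \<in> {..<n}"
    then have "u $ i = -1 \<or> u $ i = 1" "z $ i = -1 \<or> z $ i = 1"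
      using uB z by (auto simp: balanced_labels_def)
    then show "(u $ i - z $ i)\<^sup>2 = (if u $ i \<noteq> z $ i then 4 else 0)" by auto
  qed
  also have "\<dots> = 4 * real (card {i. i < n \<and> u $ i \<noteq> z $ i})"
  proof -
    have "{..<n} \<inter> {i. u $ i \<noteq> z $ i} = {i. i < n \<and> u $ i \<noteq> z $ i}" by auto
    then show ?thesis by (simp add: sum.If_cases)
  qed
  also have "\<dots> \<le> 8 * real (card bad)"
    using projection_mismatch[OF z u] A x(1) unfolding bad_def by simp
  also have "\<dots> \<le> 32 * w\<^sup>2 / k\<^sup>2 * err x" using bad by simp
  finally show ?thesis .
qed

text \<open>The bound \<open>\<delta> * n\<close> on the error is preserved, so the contraction
  applies at every step. An error below 4 is zero, as one wrong label already contributes 4.\<close>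

lemma power_iterates_recover:
  assumes it: "power_iterates n A y x"
    and x0: "x 0 \<in> carrier_vec n" "(\<Sum>i<n. x 0 $ i) = 0" "(\<Sum>i<n. (x 0 $ i)\<^sup>2) = real n"
    and e: "err (x 0) \<le> \<delta> * real n" "g * (\<delta> * real n) \<le> k"
    and \<rho>: "\<rho> = 32 * w\<^sup>2 / k\<^sup>2" "\<rho> < 1" and K: "\<rho> ^ K * (\<delta> * real n) < 4" "K \<ge> 1"
  shows "\<exists>K'. stops_at x K' \<and> x K' = z \<and> K' \<le> Suc K"
proof -
  have \<rho>0: "\<rho> \<ge> 0" by (simp add: \<rho>)
  have step: "x (Suc m) \<in> projection n (A *\<^sub>v x m)" for m using it by (auto simp: power_iterates_def)
  have B: "x (Suc m) \<in> balanced_labels n" for m using step[of m] by (auto simp: projection_def is_arg_min_def)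
  have inv: "x m \<in> carrier_vec n \<and> (\<Sum>i<n. x m $ i) = 0 \<and> (\<Sum>i<n. (x m $ i)\<^sup>2) = real n" for m
  proof (cases m)
    case (Suc m')
    have "(\<Sum>i<n. (x m $ i)\<^sup>2) = (\<Sum>i<n. 1)"
      by (rule sum.cong[OF refl]) (use balanced_labels_sq[OF B[of m']] Suc in \<open>auto simp: power2_eq_square\<close>)
    then show ?thesis using B[of m'] Suc by (auto simp: balanced_labels_def)
  qed (use x0 in auto)
  have contr: "err (x (Suc m)) \<le> \<rho> * err (x m)" if "err (x m) \<le> \<delta> * real n" for m
  proof -
    have "g * err (x m) \<le> k" using mult_left_mono[OF that g] e(2) by linarith
    then show ?thesis unfolding \<rho>(1) using inv[of m] step[of m] by (intro projection_contracts) auto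
  qed
  have small: "err (x m) \<le> \<rho> ^ m * (\<delta> * real n) \<and> err (x m) \<le> \<delta> * real n" for m
  proof (induction m)
    case (Suc m)
    have c: "err (x (Suc m)) \<le> \<rho> * err (x m)" using contr Suc by blast
    also have "\<dots> \<le> \<rho> * (\<rho> ^ m * (\<delta> * real n))" using Suc \<rho>0 by (intro mult_left_mono) auto
    finally have 1: "err (x (Suc m)) \<le> \<rho> ^ Suc m * (\<delta> * real n)" by simp
    have "\<rho> * err (x m) \<le> 1 * err (x m)" using \<rho> err_nonneg by (intro mult_right_mono) auto
    then show ?case using 1 c Suc by simp
  qed (use e in auto)
  have eqz: "x (Suc m) = z" if lt: "err (x (Suc m)) < 4" for m
  proof (rule eq_vecI)
    show "dim_vec (x (Suc m)) = dim_vec z" using inv[of "Suc m"] z_carrier by auto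
    fix i assume "i < dim_vec z"
    then have i: "i < n" using z_carrier by auto
    have "(x (Suc m) $ i - z $ i)\<^sup>2 \<le> err (x (Suc m))"
      unfolding err_def by (rule member_le_sum) (use i in auto)
    then have lt: "(x (Suc m) $ i - z $ i)\<^sup>2 < 4" using lt by simp
    have "x (Suc m) $ i = -1 \<or> x (Suc m) $ i = 1" "z $ i = -1 \<or> z $ i = 1"
      using B[of m] z i by (auto simp: balanced_labels_def)
    then show "x (Suc m) $ i = z $ i" using lt by auto
  qed
  have z_stays: "x (Suc m) = z" if "x m = z" for m
  proof -
    have "err (x m) = 0" using that by (simp add: err_def)
    then have "err (x (Suc m)) \<le> 0" using contr[of m] small[of m] by simp
    then show ?thesis by (intro eqz) simp
  qed
  \<comment> \<open>Only projected iterates are label vectors; \<open>x 0\<close> is a real vector,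
    so the conclusion from a small error needs \<open>K \<ge> 1\<close>.\<close>
  obtain K0 where K0: "K = Suc K0" using K(2) by (cases K) auto
  have "x K = z" unfolding K0 by (rule eqz) (use small[of K] K K0 in auto)
  \<comment> \<open>The stopping test compares with the previous iterate, so arrival at step
    \<open>K\<close> is noticed at step \<open>K + 1\<close> at the latest.\<close>
  then have "x (Suc K) = x K" using z_stays by simp
  then have ex: "\<exists>k\<ge>1. x k = x (k - 1) \<and> k \<le> Suc K" by (intro exI[of _ "Suc K"]) auto
  define K' where "K' = (LEAST k. k \<ge> 1 \<and> x k = x (k - 1))"
  have K': "K' \<ge> 1 \<and> x K' = x (K' - 1)" unfolding K'_def by (rule LeastI_ex) (use ex in blast)
  have K'_le: "K' \<le> j" if "j \<ge> 1" "x j = x (j - 1)" for j unfolding K'_def by (rule Least_le) (use that in blast)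
  have "stops_at x K'" unfolding stops_at_def using K' K'_le by (meson not_le)
  moreover have "K' \<le> Suc K" using K'_le ex by fastforce
  \<comment> \<open>The test cannot succeed at wrong labels: a repeated iterate has an error at most
    \<open>\<rho>\<close> times itself, hence zero.\<close>
  moreover have "x K' = z"
  proof -
    obtain m where m: "K' = Suc m" using K' by (cases K') auto
    have eq: "x (Suc m) = x m" using K' m by simp
    then have "err (x (Suc m)) \<le> \<rho> * err (x (Suc m))" using contr[of m] small[of m] by simp
    then have "(1 - \<rho>) * err (x (Suc m)) \<le> 0" by (simp add: algebra_simps)
    then have "err (x (Suc m)) \<le> 0" using \<rho>(2) by (simp add: mult_le_0_iff)
    then show ?thesis unfolding m by (intro eqz) simp
  qed
  ultimately show ?thesis by blast
qed

end

section \<open>The Gaussian start\<close>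

abbreviation std_normal :: "real measure" where
  "std_normal \<equiv> density lborel (\<lambda>t. ennreal (std_normal_density t))"

lemma prob_space_std_normal: "prob_space std_normal"
  by (rule prob_space_normal_density) simp

lemma std_normal_density_le_half: "std_normal_density t \<le> 1 / 2"
proof -
  have "2 \<le> sqrt (2 * pi)" using pi_gt3 by (intro real_le_rsqrt) auto
  then have "1 / sqrt (2 * pi) \<le> 1 / 2" by (intro divide_left_mono) auto
  then have "1 / sqrt (2 * pi) * exp (- (t\<^sup>2) / 2) \<le> 1 / 2 * 1" by (intro mult_mono) auto
  then show ?thesis by (simp add: std_normal_density_def)
qed

text \<open>The event lies in an interval of length \<open>2 * \<epsilon> / \<bar>c\<bar>\<close>,
  and the density is at most one half.\<close>

lemma std_normal_affine_small_ball:
  assumes c: "c \<noteq> 0" and e: "\<epsilon> \<ge> 0"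
  shows "emeasure std_normal {y. \<bar>c * y + r\<bar> \<le> \<epsilon>} \<le> ennreal (\<epsilon> / \<bar>c\<bar>)"
proof -
  have sub: "{y. \<bar>c * y + r\<bar> \<le> \<epsilon>} \<subseteq> {- r / c - \<epsilon> / \<bar>c\<bar> .. - r / c + \<epsilon> / \<bar>c\<bar>}"
  proof
    fix y assume "y \<in> {y. \<bar>c * y + r\<bar> \<le> \<epsilon>}"
    then have "\<bar>c * y + r\<bar> / \<bar>c\<bar> \<le> \<epsilon> / \<bar>c\<bar>" by (simp add: divide_right_mono)
    moreover have "\<bar>c * y + r\<bar> / \<bar>c\<bar> = \<bar>y + r / c\<bar>" using c by (simp add: abs_divide[symmetric] add_divide_distrib)
    ultimately show "y \<in> {- r / c - \<epsilon> / \<bar>c\<bar> .. - r / c + \<epsilon> / \<bar>c\<bar>}" by (auto simp: abs_le_iff)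
  qed
  have "emeasure std_normal {y. \<bar>c * y + r\<bar> \<le> \<epsilon>} \<le> emeasure std_normal {- r / c - \<epsilon> / \<bar>c\<bar> .. - r / c + \<epsilon> / \<bar>c\<bar>}"
    by (rule emeasure_mono[OF sub]) simp
  also have "\<dots> = (\<integral>\<^sup>+ t. ennreal (std_normal_density t) * indicator {- r / c - \<epsilon> / \<bar>c\<bar> .. - r / c + \<epsilon> / \<bar>c\<bar>} t \<partial>lborel)"
    by (rule emeasure_density) auto
  also have "\<dots> \<le> (\<integral>\<^sup>+ t. ennreal (1 / 2) * indicator {- r / c - \<epsilon> / \<bar>c\<bar> .. - r / c + \<epsilon> / \<bar>c\<bar>} t \<partial>lborel)"
    by (intro nn_integral_mono mult_right_mono ennreal_leI std_normal_density_le_half) auto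
  also have "\<dots> = ennreal (1 / 2) * emeasure lborel {- r / c - \<epsilon> / \<bar>c\<bar> .. - r / c + \<epsilon> / \<bar>c\<bar>}"
    by (rule nn_integral_cmult_indicator) auto
  also have "\<dots> = ennreal (1 / 2 * (2 * \<epsilon> / \<bar>c\<bar>))"
  proof -
    have "emeasure lborel {- r / c - \<epsilon> / \<bar>c\<bar> .. - r / c + \<epsilon> / \<bar>c\<bar>} = ennreal (2 * \<epsilon> / \<bar>c\<bar>)"
      using e by simp
    then show ?thesis using e by (simp only:) (subst ennreal_mult, auto)
  qed
  finally show ?thesis by simp
qed

text \<open>Chebyshev's inequality. The quadratic decay is enough: at level \<open>n\<close> the
  \<open>2 n\<close> entries of the start together cost \<open>2 / n\<close>.\<close>

lemma std_normal_tail: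
  assumes k: "k > 0"
  shows "emeasure std_normal {y. k \<le> \<bar>y\<bar>} \<le> ennreal (1 / k\<^sup>2)"
proof -
  have meas: "{y::real. k \<le> \<bar>y\<bar>} \<in> sets lborel" by measurable
  have "has_bochner_integral lborel (\<lambda>x. std_normal_density x * x ^ (2 * 1)) (fact (2 * 1) / (2 ^ 1 * fact 1))"
    by (rule std_normal_moment_even)
  then have "has_bochner_integral lborel (\<lambda>x. std_normal_density x * x\<^sup>2 / k\<^sup>2) (1 / k\<^sup>2)"
    by (auto dest: has_bochner_integral_divide_zero[where c = "k\<^sup>2"] simp: fact_2)
  then have int: "(\<integral>\<^sup>+ t. ennreal (std_normal_density t * t\<^sup>2 / k\<^sup>2) \<partial>lborel) = ennreal (1 / k\<^sup>2)"
    by (subst nn_integral_eq_integral) (auto simp: has_bochner_integral_iff)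
  have "emeasure std_normal {y. k \<le> \<bar>y\<bar>} = (\<integral>\<^sup>+ t. ennreal (std_normal_density t) * indicator {y. k \<le> \<bar>y\<bar>} t \<partial>lborel)"
    by (rule emeasure_density[OF _ meas]) auto
  also have "\<dots> \<le> (\<integral>\<^sup>+ t. ennreal (std_normal_density t * t\<^sup>2 / k\<^sup>2) \<partial>lborel)"
  proof (rule nn_integral_mono)
    fix t :: real
    show "ennreal (std_normal_density t) * indicator {y. k \<le> \<bar>y\<bar>} t \<le> ennreal (std_normal_density t * t\<^sup>2 / k\<^sup>2)"
    proof (cases "k \<le> \<bar>t\<bar>")
      case True
      then have "k\<^sup>2 \<le> t\<^sup>2" using k abs_le_square_iff[of k t] by simp
      then have "1 \<le> t\<^sup>2 / k\<^sup>2" using k by simp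
      then have "std_normal_density t * 1 \<le> std_normal_density t * (t\<^sup>2 / k\<^sup>2)" by (intro mult_left_mono) auto
      then show ?thesis using True by (simp add: ennreal_leI)
    qed simp
  qed
  finally show ?thesis unfolding int .
qed

text \<open>Fubini with coordinate \<open>i\<close> integrated first: for fixed other coordinates
  the expression is affine in it, with slope at least \<open>\<eta>\<close> on the event.\<close>

lemma product_affine_small_ball:
  fixes c r :: "('i \<Rightarrow> real) \<Rightarrow> real"
  assumes I: "finite I" "i \<in> I"
    and [measurable]: "c \<in> borel_measurable (PiM I (\<lambda>_. std_normal))" "r \<in> borel_measurable (PiM I (\<lambda>_. std_normal))"
    and c: "\<And>x y. c (x(i := y)) = c x" and r: "\<And>x y. r (x(i := y)) = r x"
    and \<eta>: "\<eta> > 0" and \<epsilon>: "\<epsilon> \<ge> 0"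
  shows "emeasure (PiM I (\<lambda>_. std_normal)) {x \<in> space (PiM I (\<lambda>_. std_normal)). \<bar>c x * x i + r x\<bar> \<le> \<epsilon> \<and> \<eta> \<le> \<bar>c x\<bar>}
    \<le> ennreal (\<epsilon> / \<eta>)" (is "emeasure ?M ?A \<le> _")
proof -
  interpret P: product_sigma_finite "\<lambda>_ :: 'i. std_normal"
    using prob_space_std_normal prob_space_imp_sigma_finite by (simp add: product_sigma_finite_def)
  define J where "J = I - {i}"
  have IJ: "I = insert i J" "i \<notin> J" "finite J" using I by (auto simp: J_def)
  have A[measurable]: "?A \<in> sets ?M" using I by measurable
  have "emeasure ?M ?A = (\<integral>\<^sup>+ x. indicator ?A x \<partial>?M)" by (simp add: A)
  also have "\<dots> = (\<integral>\<^sup>+ x. (\<integral>\<^sup>+ y. indicator ?A (x(i := y)) \<partial>std_normal) \<partial>(PiM J (\<lambda>_. std_normal)))"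
    using A unfolding IJ(1) by (intro P.product_nn_integral_insert IJ) auto
  also have "\<dots> \<le> (\<integral>\<^sup>+ x. ennreal (\<epsilon> / \<eta>) \<partial>(PiM J (\<lambda>_. std_normal)))"
  proof (rule nn_integral_mono)
    fix x :: "'i \<Rightarrow> real"
    show "(\<integral>\<^sup>+ y. indicator ?A (x(i := y)) \<partial>std_normal) \<le> ennreal (\<epsilon> / \<eta>)"
    proof (cases "\<eta> \<le> \<bar>c x\<bar>")
      case True
      have m: "{y. \<bar>c x * y + r x\<bar> \<le> \<epsilon>} \<in> sets std_normal" by simp
      have "(\<integral>\<^sup>+ y. indicator ?A (x(i := y)) \<partial>std_normal) \<le> (\<integral>\<^sup>+ y. indicator {y. \<bar>c x * y + r x\<bar> \<le> \<epsilon>} y \<partial>std_normal)"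
        by (rule nn_integral_mono) (auto simp: indicator_def c r)
      also have "\<dots> = emeasure std_normal {y. \<bar>c x * y + r x\<bar> \<le> \<epsilon>}"
        by (rule nn_integral_indicator[OF m])
      also have "\<dots> \<le> ennreal (\<epsilon> / \<bar>c x\<bar>)"
        using True \<eta> \<epsilon> by (intro std_normal_affine_small_ball) auto
      also have "\<dots> \<le> ennreal (\<epsilon> / \<eta>)"
        using True \<eta> \<epsilon> by (intro ennreal_leI divide_left_mono) auto
      finally show ?thesis .
    next
      case False
      then have "(\<integral>\<^sup>+ y. indicator ?A (x(i := y)) \<partial>std_normal) = (\<integral>\<^sup>+ y. 0 \<partial>std_normal)"
        by (intro nn_integral_cong) (auto simp: c)
      then show ?thesis by simp
    qed
  qed
  also have "\<dots> = ennreal (\<epsilon> / \<eta>)"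
  proof -
    interpret Q: prob_space "PiM J (\<lambda>_. std_normal)"
      by (rule prob_space_PiM) (rule prob_space_std_normal)
    show ?thesis by (simp add: Q.emeasure_space_1)
  qed
  finally show ?thesis .
qed

text \<open>For the antisymmetric \<open>K i j = g1 i * g2 j - g2 i * g1 j\<close> this is the 2 x 2
  determinant of the inner products of \<open>g1\<close>, \<open>g2\<close> with the two columns of
  the start.\<close>

definition start_form :: "nat \<Rightarrow> (nat \<Rightarrow> nat \<Rightarrow> real) \<Rightarrow> (nat \<times> nat \<Rightarrow> real) \<Rightarrow> real" where
  "start_form n K Y = (\<Sum>i<n. \<Sum>j<n. K i j * Y (i, 0) * Y (j, 1))"

definition good_start :: "nat \<Rightarrow> (nat \<Rightarrow> nat \<Rightarrow> real) \<Rightarrow> (nat \<times> nat \<Rightarrow> real) set" where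
  "good_start n K = {Y \<in> space (gaussian_entries n).
     1 / real n ^ 3 < \<bar>start_form n K Y\<bar> \<and> (\<forall>e\<in>{..<n} \<times> {..<2}. \<bar>Y e\<bar> < real n)}"

lemma prob_space_gaussian_entries: "prob_space (gaussian_entries n)"
  unfolding gaussian_entries_def by (rule prob_space_PiM) (rule prob_space_std_normal)

lemma start_form_measurable [measurable]: "start_form n K \<in> borel_measurable (gaussian_entries n)"
  unfolding start_form_def gaussian_entries_def by measurable

lemma good_start_sets: "good_start n K \<in> sets (gaussian_entries n)"
proof -
  have [measurable]: "(\<lambda>Y. Y e) \<in> borel_measurable (gaussian_entries n)" if "e \<in> {..<n} \<times> {..<2}" for e
    using that unfolding gaussian_entries_def by measurable
  show ?thesis unfolding good_start_def by measurable
qed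

text \<open>Two affine steps. The linear form \<open>l\<close> in the second column has a
  coefficient at least \<open>1 / n\<close> and exceeds \<open>n^(-2)\<close>; it is in turn the
  coefficient of \<open>Y (i0, 0)\<close> in the bilinear form, which then exceeds
  \<open>n^(-3)\<close>. Each step fails with probability at most \<open>1 / n\<close>, the bound on
  the entries with at most \<open>2 / n\<close>.\<close>

lemma good_start_prob:
  assumes n: "n \<ge> 1" and ij: "i0 < n" "j0 < n" and K: "1 / real n \<le> \<bar>K i0 j0\<bar>"
  shows "measure (gaussian_entries n) (good_start n K) \<ge> 1 - 4 / real n"
proof -
  interpret prob_space "gaussian_entries n" by (rule prob_space_gaussian_entries)
  let ?I = "{..<n} \<times> {..<2::nat}"
  let ?M = "gaussian_entries n"
  have I: "finite ?I" by simp
  have [measurable]: "(\<lambda>Y. Y e) \<in> borel_measurable (PiM ?I (\<lambda>_. std_normal))" if "e \<in> ?I" for e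
    using that by measurable
  define l where "l Y = (\<Sum>j<n. K i0 j * Y (j, 1))" for Y :: "nat \<times> nat \<Rightarrow> real"
  define l' where "l' Y = (\<Sum>j\<in>{..<n} - {j0}. K i0 j * Y (j, 1))" for Y :: "nat \<times> nat \<Rightarrow> real"
  define f' where "f' Y = (\<Sum>i\<in>{..<n} - {i0}. \<Sum>j<n. K i j * Y (i, 0) * Y (j, 1))" for Y :: "nat \<times> nat \<Rightarrow> real"
  have l_eq: "l Y = K i0 j0 * Y (j0, 1) + l' Y" for Y
    unfolding l_def l'_def using ij by (subst sum.remove[of _ j0]) auto
  have f_eq: "start_form n K Y = l Y * Y (i0, 0) + f' Y" for Y
    unfolding start_form_def f'_def l_def using ij
      sum.remove[of "{..<n}" i0 "\<lambda>i. \<Sum>j<n. K i j * Y (i, 0) * Y (j, 1)"]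
    by (simp add: sum_distrib_left ac_simps)
  have [measurable]: "l \<in> borel_measurable (PiM ?I (\<lambda>_. std_normal))" unfolding l_def by measurable
  have [measurable]: "l' \<in> borel_measurable (PiM ?I (\<lambda>_. std_normal))" unfolding l'_def by measurable
  have [measurable]: "f' \<in> borel_measurable (PiM ?I (\<lambda>_. std_normal))" unfolding f'_def by measurable
  define B1 where "B1 = {Y \<in> space ?M. \<bar>K i0 j0 * Y (j0, 1) + l' Y\<bar> \<le> 1 / (real n)\<^sup>2 \<and> 1 / real n \<le> \<bar>K i0 j0\<bar>}"
  define B2 where "B2 = {Y \<in> space ?M. \<bar>l Y * Y (i0, 0) + f' Y\<bar> \<le> 1 / real n ^ 3 \<and> 1 / (real n)\<^sup>2 \<le> \<bar>l Y\<bar>}"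
  define B3 where "B3 e = {Y \<in> space ?M. real n \<le> \<bar>Y e\<bar>}" for e
  have [measurable]: "(\<lambda>Y. Y (j0, 1)) \<in> borel_measurable (PiM ?I (\<lambda>_. std_normal))"
    "(\<lambda>Y. Y (i0, 0)) \<in> borel_measurable (PiM ?I (\<lambda>_. std_normal))"
    using ij by (auto intro!: measurable_component_singleton[where M = "\<lambda>_. std_normal", simplified])
  have B_sets: "B1 \<in> sets ?M" "B2 \<in> sets ?M"
    unfolding B1_def B2_def gaussian_entries_def by measurable
  have B3_sets: "B3 e \<in> sets ?M" if "e \<in> ?I" for e
    unfolding B3_def gaussian_entries_def using that by measurable
  have p1: "prob B1 \<le> 1 / real n"
  proof -
    have "emeasure ?M B1 \<le> ennreal ((1 / (real n)\<^sup>2) / (1 / real n))"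
      unfolding B1_def gaussian_entries_def
      by (rule product_affine_small_ball[OF I, where c = "\<lambda>_. K i0 j0"]) (use n ij in \<open>auto simp: l'_def\<close>)
    also have "(1 / (real n)\<^sup>2) / (1 / real n) = 1 / real n" using n by (simp add: power2_eq_square)
    finally show ?thesis by (simp add: emeasure_eq_measure)
  qed
  have p2: "prob B2 \<le> 1 / real n"
  proof -
    have "emeasure ?M B2 \<le> ennreal ((1 / real n ^ 3) / (1 / (real n)\<^sup>2))"
      unfolding B2_def gaussian_entries_def
      by (rule product_affine_small_ball[OF I]) (use n ij in \<open>auto simp: l_def f'_def intro!: sum.cong\<close>)
    also have "(1 / real n ^ 3) / (1 / (real n)\<^sup>2) = 1 / real n" using n by (simp add: power2_eq_square power3_eq_cube)
    finally show ?thesis by (simp add: emeasure_eq_measure)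
  qed
  have p3: "prob (B3 e) \<le> 1 / (real n)\<^sup>2" if e: "e \<in> ?I" for e
  proof -
    have "distr (PiM ?I (\<lambda>_. std_normal)) std_normal (\<lambda>x. x e) = std_normal"
      by (rule distr_PiM_component[OF prob_space_std_normal e])
    then have "emeasure std_normal {y. real n \<le> \<bar>y\<bar>}
        = emeasure (distr (PiM ?I (\<lambda>_. std_normal)) std_normal (\<lambda>x. x e)) {y. real n \<le> \<bar>y\<bar>}" by simp
    also have "\<dots> = emeasure ?M (B3 e)"
      using e unfolding B3_def gaussian_entries_def
      by (subst emeasure_distr) (auto intro!: arg_cong2[of _ _ _ _ emeasure])
    finally show ?thesis using std_normal_tail[of "real n"] n by (simp add: emeasure_eq_measure)
  qed
  define B where "B = B1 \<union> (B2 \<union> (\<Union>e\<in>?I. B3 e))"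
  have BS: "B \<in> sets ?M" unfolding B_def using B_sets B3_sets by auto
  have "prob B \<le> prob B1 + (prob B2 + (\<Sum>e\<in>?I. prob (B3 e)))"
  proof -
    have "prob B \<le> prob B1 + prob (B2 \<union> (\<Union>e\<in>?I. B3 e))" unfolding B_def
      using B_sets B3_sets by (intro measure_Un_le) auto
    also have "prob (B2 \<union> (\<Union>e\<in>?I. B3 e)) \<le> prob B2 + prob (\<Union>e\<in>?I. B3 e)"
      using B_sets B3_sets by (intro measure_Un_le) auto
    also have "prob (\<Union>e\<in>?I. B3 e) \<le> (\<Sum>e\<in>?I. prob (B3 e))"
      using B3_sets by (intro measure_UNION_le) auto
    finally show ?thesis by simp
  qed
  also have "\<dots> \<le> 1 / real n + (1 / real n + (\<Sum>e\<in>?I. 1 / (real n)\<^sup>2))"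
    by (intro add_mono p1 p2 sum_mono p3)
  also have "\<dots> = 4 / real n" using n by (simp add: card_cartesian_product power2_eq_square)
  finally have pB: "prob B \<le> 4 / real n" .
  have "space ?M - B \<subseteq> good_start n K"
  proof
    fix Y assume Y: "Y \<in> space ?M - B"
    then have nb: "Y \<notin> B1" "Y \<notin> B2" "\<And>e. e \<in> ?I \<Longrightarrow> Y \<notin> B3 e" by (auto simp: B_def)
    have "1 / (real n)\<^sup>2 < \<bar>l Y\<bar>" using nb(1) Y K by (auto simp: B1_def l_eq)
    then have "1 / real n ^ 3 < \<bar>start_form n K Y\<bar>" using nb(2) Y by (auto simp: B2_def f_eq)
    moreover have "\<bar>Y e\<bar> < real n" if "e \<in> ?I" for e using nb(3)[OF that] Y by (auto simp: B3_def)
    ultimately show "Y \<in> good_start n K" using Y by (auto simp: good_start_def)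
  qed
  then have "prob (space ?M - B) \<le> prob (good_start n K)"
    using good_start_sets by (intro finite_measure_mono)
  then show ?thesis using prob_compl[OF BS] pB by simp
qed

section \<open>Matrices with two columns\<close>

declare One_nat_def [simp del] index_mult_mat(1) [simp del]

definition colv :: "nat \<Rightarrow> real mat \<Rightarrow> nat \<Rightarrow> fvec" where
  "colv n M k = fv n (\<lambda>i. M $$ (i, k))"

text \<open>The image of \<open>(c, d)\<close> under \<open>M\<close>. Over all \<open>c\<close> and
  \<open>d\<close> it runs through the column space, which is what is followed through the QR
  steps.\<close>

definition comb :: "nat \<Rightarrow> real mat \<Rightarrow> real \<Rightarrow> real \<Rightarrow> fvec" where
  "comb n M c d = c *\<^sub>R colv n M 0 + d *\<^sub>R colv n M 1"

lemma coord_colv: "coord (colv n M k) i = (if i < n then M $$ (i, k) else 0)"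
  by (simp add: colv_def coord_fv)

lemma colv_mult_left:
  assumes "A \<in> carrier_mat n n" "Q \<in> carrier_mat n m" "k < m"
  shows "colv n (A * Q) k = mat_op n (\<lambda>i j. A $$ (i, j)) (colv n Q k)"
  using assms by (intro fvec_eqI) (simp add: coord_colv mat_op_def coord_fv index_mult_mat(1) scalar_prod_def lessThan_atLeast0)

lemma index_mult_two:
  assumes "Q \<in> carrier_mat n 2" "R \<in> carrier_mat 2 m" "i < n" "k < m"
  shows "(Q * R) $$ (i, k) = Q $$ (i, 0) * R $$ (0, k) + Q $$ (i, 1) * R $$ (1, k)"
  using assms by (simp add: index_mult_mat(1) scalar_prod_def numeral_2_eq_2 One_nat_def)

lemma colv_mult_right:
  assumes "Q \<in> carrier_mat n 2" "R \<in> carrier_mat 2 2" "k < 2"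
  shows "colv n (Q * R) k = comb n Q (R $$ (0, k)) (R $$ (1, k))"
  using assms by (intro fvec_eqI) (simp add: coord_colv comb_def coord_simps index_mult_two[OF assms(1,2) _ assms(3)])

lemma comb_mult_right:
  assumes "Q \<in> carrier_mat n 2" "R \<in> carrier_mat 2 2"
  shows "comb n (Q * R) c d = comb n Q (R $$ (0, 0) * c + R $$ (0, 1) * d) (R $$ (1, 0) * c + R $$ (1, 1) * d)"
  using assms unfolding comb_def[of n "Q * R"]
  by (simp add: colv_mult_right comb_def scaleR_add_left scaleR_add_right mult.commute)

lemma comb_mult_left:
  assumes "A \<in> carrier_mat n n" "Q \<in> carrier_mat n 2"
  shows "comb n (A * Q) c d = mat_op n (\<lambda>i j. A $$ (i, j)) (comb n Q c d)"
  using assms by (simp add: comb_def colv_mult_left linear_add[OF linear_mat_op] linear_cmul[OF linear_mat_op])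

lemma transpose_mult_index:
  assumes "Q \<in> carrier_mat n 2" "P \<in> carrier_mat n 2" "a < 2" "b < 2"
  shows "(transpose_mat Q * P) $$ (a, b) = inner (colv n Q a) (colv n P b)"
  using assms by (simp add: colv_def inner_fv2 index_mult_mat(1) scalar_prod_def lessThan_atLeast0)

lemma mat2_eqI:
  assumes "P \<in> carrier_mat 2 2" "Q \<in> carrier_mat 2 2"
    and "P $$ (0, 0) = Q $$ (0, 0)" "P $$ (0, 1) = Q $$ (0, 1)" "P $$ (1, 0) = Q $$ (1, 0)" "P $$ (1, 1) = Q $$ (1, 1)"
  shows "P = Q"
proof (rule eq_matI)
  fix i j assume "i < dim_row Q" "j < dim_col Q"
  then have "i = 0 \<or> i = 1" "j = 0 \<or> j = 1" using assms(2) by auto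
  then show "P $$ (i, j) = Q $$ (i, j)" using assms by auto
qed (use assms in auto)

section \<open>Explicit factorisations of 2 x 2 matrices\<close>

definition mat2 :: "real \<Rightarrow> real \<Rightarrow> real \<Rightarrow> real \<Rightarrow> real mat" where
  "mat2 a b c d = mat 2 2 (\<lambda>(i, j). if i = 0 then (if j = 0 then a else b) else (if j = 0 then c else d))"

lemma mat2_simps [simp]:
  "mat2 a b c d \<in> carrier_mat 2 2"
  "mat2 a b c d $$ (0, 0) = a" "mat2 a b c d $$ (0, 1) = b"
  "mat2 a b c d $$ (1, 0) = c" "mat2 a b c d $$ (1, 1) = d"
  by (simp_all add: mat2_def)

lemma mat2_mult: "mat2 a b c d * mat2 a' b' c' d' =
   mat2 (a * a' + b * c') (a * b' + b * d') (c * a' + d * c') (c * b' + d * d')"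
proof -
  have "mat2 a b c d * mat2 a' b' c' d' \<in> carrier_mat 2 2" by (rule mult_carrier_mat[of _ 2 2 _ 2]) auto
  then show ?thesis
    by (rule mat2_eqI) (simp_all add: index_mult_two[OF mat2_simps(1) mat2_simps(1)])
qed

lemma mat2_transpose: "transpose_mat (mat2 a b c d) = mat2 a c b d"
  by (rule mat2_eqI) (auto simp: mat2_def)

lemma mat2_one: "1\<^sub>m 2 = mat2 1 0 0 1"
  by (rule mat2_eqI) auto

lemma two_by_two_surj:
  fixes a b c d :: real
  assumes inj: "\<And>x y. a * x + b * y = 0 \<Longrightarrow> c * x + d * y = 0 \<Longrightarrow> x = 0 \<and> y = 0"
  shows "\<exists>x y. a * x + b * y = u \<and> c * x + d * y = v"
proof -
  define D where "D = a * d - b * c"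
  have D: "D \<noteq> 0"
  proof
    assume "D = 0"
    \<comment> \<open>With vanishing determinant \<open>(d, - c)\<close> and \<open>(b, - a)\<close>
      lie in the kernel, so all entries vanish.\<close>
    then have "d = 0 \<and> - c = 0" by (intro inj) (simp_all add: D_def)
    moreover have "b = 0 \<and> - a = 0" using \<open>D = 0\<close> by (intro inj) (simp_all add: D_def algebra_simps)
    ultimately show False using inj[of 1 0] by simp
  qed
  have "a * ((d * u - b * v) / D) + b * ((a * v - c * u) / D) = (D * u) / D"
    by (simp add: D_def add_divide_distrib[symmetric] algebra_simps)
  moreover have "c * ((d * u - b * v) / D) + d * ((a * v - c * u) / D) = (D * v) / D"
    by (simp add: D_def add_divide_distrib[symmetric] algebra_simps)
  ultimately show ?thesis using D by (metis nonzero_mult_div_cancel_left)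
qed

text \<open>By Cayley-Hamilton a positive definite 2 x 2 matrix \<open>M\<close> has the square root
  \<open>(M + s) / t\<close>, where \<open>s\<close> is the root of the determinant and
  \<open>t\<close> the root of the trace plus \<open>2 s\<close>. Applied to the adjugate of the
  Gram matrix and divided by \<open>s\<close>, this gives \<open>S\<close>.\<close>

lemma gram_inv_sqrt_exists:
  assumes Y: "Y \<in> carrier_mat n 2" and indep: "\<And>c d. comb n Y c d = 0 \<Longrightarrow> c = 0 \<and> d = 0"
  shows "\<exists>S. is_inv_sqrt (transpose_mat Y * Y) S"
proof -
  define y0 y1 where "y0 = colv n Y 0" "y1 = colv n Y 1"
  define a b d where "a = inner y0 y0" "b = inner y0 y1" "d = inner y1 y1"
  have G: "transpose_mat Y * Y = mat2 a b b d"
  proof (rule mat2_eqI)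
    show "transpose_mat Y * Y \<in> carrier_mat 2 2" using Y by auto
  qed (use Y in \<open>simp_all add: transpose_mult_index a_b_d_def y0_y1_def inner_commute\<close>)
  have pos: "0 < a * c\<^sup>2 + 2 * b * c * e + d * e\<^sup>2" if "c \<noteq> 0 \<or> e \<noteq> 0" for c e
  proof -
    have "comb n Y c e \<noteq> 0" using indep that by blast
    then have "0 < inner (comb n Y c e) (comb n Y c e)" by simp
    also have "\<dots> = a * c\<^sup>2 + 2 * b * c * e + d * e\<^sup>2"
      by (simp add: comb_def y0_y1_def[symmetric] a_b_d_def inner_simps inner_commute[of y1 y0] power2_eq_square algebra_simps)
    finally show ?thesis .
  qed
  have a: "a > 0" using pos[of 1 0] by simp
  have d: "d > 0" using pos[of 0 1] by simp
  have det: "a * d - b\<^sup>2 > 0"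
  proof -
    \<comment> \<open>The quadratic form at \<open>(b, - a)\<close> is \<open>a\<close> times the
      determinant.\<close>
    have "0 < a * b\<^sup>2 + 2 * b * b * (- a) + d * (- a)\<^sup>2" using a by (intro pos) auto
    also have "\<dots> = a * (a * d - b\<^sup>2)" by (simp add: power2_eq_square algebra_simps)
    finally show ?thesis using a by (simp add: zero_less_mult_iff)
  qed
  define s where "s = sqrt (a * d - b\<^sup>2)"
  have s: "s > 0" "s * s = a * d - b * b" using det by (auto simp: s_def power2_eq_square)
  define t where "t = sqrt (a + d + 2 * s)"
  have t: "t > 0" "t * t = a + d + 2 * s" using a d s by (auto simp: t_def)
  define m where "m = 1 / (s * t)"
  have m: "m > 0" using s t by (simp add: m_def)
  define S where "S = mat2 (m * (d + s)) (- m * b) (- m * b) (m * (a + s))"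
  have SS: "S * S = mat2 (d / (s * s)) (- b / (s * s)) (- b / (s * s)) (a / (s * s))"
  proof -
    have 1: "m * (d + s) * (m * (d + s)) + - m * b * (- m * b) = m * m * ((d + s) * (d + s) + b * b)"
      "m * (d + s) * (- m * b) + - m * b * (m * (a + s)) = m * m * (- b * (a + d + 2 * s))"
      "- m * b * (m * (d + s)) + m * (a + s) * (- m * b) = m * m * (- b * (a + d + 2 * s))"
      "- m * b * (- m * b) + m * (a + s) * (m * (a + s)) = m * m * ((a + s) * (a + s) + b * b)"
      by (simp_all add: algebra_simps)
    have 2: "(d + s) * (d + s) + b * b = d * (t * t)" "(a + s) * (a + s) + b * b = a * (t * t)"
      using s(2) unfolding t(2) by (simp_all add: algebra_simps)
    have 3: "m * m * (u * (t * t)) = u / (s * s)" for u using s(1) t(1) by (simp add: m_def)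
    show ?thesis unfolding S_def mat2_mult 1 2 t(2)[symmetric] 3 by simp
  qed
  have "is_inv_sqrt (mat2 a b b d) S"
    unfolding is_inv_sqrt_def
  proof (intro conjI ballI impI)
    have dr: "dim_row (mat2 a b b d) = 2" by (simp add: mat2_def)
    show "S \<in> carrier_mat (dim_row (mat2 a b b d)) (dim_row (mat2 a b b d))" by (simp add: dr S_def)
    show "transpose_mat S = S" by (simp add: S_def mat2_transpose)
    have i1: "a * (d / (s * s)) + b * (- b / (s * s)) = 1" "a * (- b / (s * s)) + b * (a / (s * s)) = 0"
      "b * (d / (s * s)) + d * (- b / (s * s)) = 0" "b * (- b / (s * s)) + d * (a / (s * s)) = 1"
      "d / (s * s) * a + - b / (s * s) * b = 1" "d / (s * s) * b + - b / (s * s) * d = 0"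
      "- b / (s * s) * a + a / (s * s) * b = 0" "- b / (s * s) * b + a / (s * s) * d = 1"
      using s det by (simp_all add: power2_eq_square diff_divide_distrib[symmetric] algebra_simps)
    show "inverts_mat (mat2 a b b d) (S * S)"
      unfolding inverts_mat_def SS mat2_mult i1 dr mat2_one ..
    have "dim_row (S * S) = 2" by (simp add: S_def mat2_def)
    then show "inverts_mat (S * S) (mat2 a b b d)"
      unfolding inverts_mat_def SS[symmetric] by (simp only: SS mat2_mult i1 mat2_one)
    fix v :: "real vec" assume v: "v \<in> carrier_vec (dim_row (mat2 a b b d))" "v \<noteq> 0\<^sub>v (dim_row (mat2 a b b d))"
    define p q where "p = v $ 0" "q = v $ 1"
    have v2: "v \<in> carrier_vec 2" using v dr by simp
    have pq: "p \<noteq> 0 \<or> q \<noteq> 0"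
    proof (rule ccontr)
      assume z: "\<not> ?thesis"
      have "v = 0\<^sub>v 2"
      proof (rule eq_vecI)
        fix i assume "i < dim_vec (0\<^sub>v 2)"
        then have "i = 0 \<or> i = 1" by auto
        then show "v $ i = 0\<^sub>v 2 $ i" using z by (auto simp: p_q_def)
      qed (use v2 in auto)
      then show False using v dr by simp
    qed
    have "v \<bullet> (S *\<^sub>v v) = m * ((d * p\<^sup>2 - 2 * b * p * q + a * q\<^sup>2) + s * (p\<^sup>2 + q\<^sup>2))"
      using v2 by (simp add: scalar_prod_def numeral_2_eq_2 S_def mat2_def p_q_def power2_eq_square One_nat_def algebra_simps)
    moreover have "0 < d * p\<^sup>2 - 2 * b * p * q + a * q\<^sup>2"
    proof -
      have "- q \<noteq> 0 \<or> p \<noteq> 0" using pq by auto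
      from pos[OF this] show ?thesis by (simp add: algebra_simps)
    qed
    moreover have "0 \<le> s * (p\<^sup>2 + q\<^sup>2)" using s by simp
    ultimately show "0 < v \<bullet> (S *\<^sub>v v)" using m by (simp add: add_pos_nonneg)
  qed
  then show ?thesis unfolding G by blast
qed

lemma qr_exists:
  assumes M: "M \<in> carrier_mat n 2" and indep: "\<And>c d. comb n M c d = 0 \<Longrightarrow> c = 0 \<and> d = 0"
  shows "\<exists>Q R. is_qr n M Q R"
proof -
  define u v where "u = colv n M 0" "v = colv n M 1"
  have u: "u \<noteq> 0" using indep[of 1 0] by (auto simp: comb_def u_v_def)
  define q0 where "q0 = (1 / norm u) *\<^sub>R u"
  define k where "k = v - inner q0 v *\<^sub>R q0"
  have q0: "inner q0 q0 = 1" using u by (simp add: q0_def power2_norm_eq_inner[symmetric] power2_eq_square)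
  have "k = comb n M (- inner q0 v / norm u) 1" by (simp add: k_def comb_def u_v_def[symmetric] q0_def)
  then have k: "k \<noteq> 0" using indep[of "- inner q0 v / norm u" 1] by auto
  define q1 where "q1 = (1 / norm k) *\<^sub>R k"
  have q1: "inner q1 q1 = 1" using k by (simp add: q1_def power2_norm_eq_inner[symmetric] power2_eq_square)
  have q01: "inner q0 q1 = 0" by (simp add: q1_def k_def inner_simps q0)
  have supp: "coord u i = 0" "coord v i = 0" "coord q0 i = 0" "coord q1 i = 0" if "i \<ge> n" for i
    using that by (simp_all add: u_v_def coord_colv q0_def q1_def k_def coord_simps)
  define Q where "Q = mat n 2 (\<lambda>(i, j). if j = 0 then coord q0 i else coord q1 i)"
  define R where "R = mat2 (norm u) (inner q0 v) 0 (norm k)"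
  have Q: "Q \<in> carrier_mat n 2" by (simp add: Q_def)
  have Rc: "R \<in> carrier_mat 2 2" by (simp add: R_def)
  have cQ: "colv n Q 0 = q0" "colv n Q 1 = q1"
    by (rule fvec_eqI, simp add: coord_colv Q_def supp)+
  have "transpose_mat Q * Q = 1\<^sub>m 2"
  proof (rule mat2_eqI)
    show "transpose_mat Q * Q \<in> carrier_mat 2 2" using Q by auto
  qed (use q0 q1 q01 cQ in \<open>simp_all add: transpose_mult_index[OF Q Q] inner_commute\<close>)
  moreover have "upper_triangular R" by (auto simp: R_def mat2_def upper_triangular_def)
  moreover have "M = Q * R"
  proof (rule eq_matI)
    show "dim_row M = dim_row (Q * R)" "dim_col M = dim_col (Q * R)" using M by (auto simp: Q_def R_def mat2_def)
    fix i j assume "i < dim_row (Q * R)" "j < dim_col (Q * R)"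
    then have ij: "i < n" "j = 0 \<or> j = 1" by (auto simp: Q_def R_def mat2_def)
    have "M $$ (i, 0) = coord u i" "M $$ (i, 1) = coord v i" using ij by (simp_all add: u_v_def coord_colv)
    moreover have "u = norm u *\<^sub>R q0" "v = inner q0 v *\<^sub>R q0 + norm k *\<^sub>R q1"
      using u k by (simp_all add: q0_def q1_def k_def)
    then have "coord u i = norm u * coord q0 i" "coord v i = inner q0 v * coord q0 i + norm k * coord q1 i"
      by (metis coord_simps(3), metis coord_simps(1) coord_simps(3))
    moreover have "(Q * R) $$ (i, 0) = coord q0 i * norm u" "(Q * R) $$ (i, 1) = coord q0 i * inner q0 v + coord q1 i * norm k"
      using ij by (simp_all add: index_mult_two[OF Q Rc]) (simp_all add: Q_def R_def)
    ultimately show "M $$ (i, j) = (Q * R) $$ (i, j)" using ij by auto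
  qed
  ultimately show ?thesis using Q by (intro exI[of _ Q] exI[of _ R]) (auto simp: is_qr_def R_def)
qed

text \<open>\<open>(x, y)\<close> is the first column of a rotation; the middle equation says that
  the off-diagonal entry of the rotated matrix vanishes, and the last inequality orders its diagonal
  by modulus.\<close>

lemma jacobi_rotation:
  fixes a b d :: real
  shows "\<exists>x y. x * x + y * y = 1 \<and> b * (x * x - y * y) = (a - d) * (x * y) \<and>
     \<bar>a * (y * y) - 2 * b * (x * y) + d * (x * x)\<bar> \<le> \<bar>a * (x * x) + 2 * b * (x * y) + d * (y * y)\<bar>"
proof -
  have "\<exists>x y. x * x + y * y = 1 \<and> b * (x * x - y * y) = (a - d) * (x * y)"
  proof (cases "b = 0")
    case True
    then show ?thesis by (intro exI[of _ 1] exI[of _ 0]) simp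
  next
    case False
    define r where "r = sqrt (((a - d) / 2)\<^sup>2 + b\<^sup>2)"
    have r: "r * r = ((a - d) / 2) * ((a - d) / 2) + b * b"
      unfolding r_def by (simp add: power2_eq_square)
    \<comment> \<open>\<open>(b, v)\<close> is an eigenvector for the larger eigenvalue
      \<open>(a + d) / 2 + r\<close>.\<close>
    define v where "v = (d - a) / 2 + r"
    have vv: "v * (v + a - d) = b * b" using r by (simp add: v_def field_simps)
    define m where "m = sqrt (b * b + v * v)"
    have m: "m > 0" "m * m = b * b + v * v" 
    proof -
      have "0 < b\<^sup>2 + v\<^sup>2" using False by (intro add_pos_nonneg) auto
      then show "m > 0" "m * m = b * b + v * v" by (simp_all add: m_def power2_eq_square)
    qed
    have "b / m * (b / m) + v / m * (v / m) = 1"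
    proof -
      have "b / m * (b / m) + v / m * (v / m) = (b * b + v * v) / (m * m)" by (simp add: add_divide_distrib)
      then show ?thesis using m(1) by (simp add: m(2)[symmetric])
    qed
    moreover have "b * (b / m * (b / m) - v / m * (v / m)) = (a - d) * (b / m * (v / m))"
    proof -
      have "b * b - v * v = (a - d) * v" using vv by (simp add: algebra_simps)
      then have eq: "b * (b * b - v * v) = b * ((a - d) * v)" by (simp only:)
      have "b * (b / m * (b / m) - v / m * (v / m)) = b * (b * b - v * v) / (m * m)"
        by (simp add: right_diff_distrib diff_divide_distrib)
      also have "\<dots> = (a - d) * (b / m * (v / m))" unfolding eq by simp
      finally show ?thesis .
    qed
    ultimately show ?thesis by blast
  qed
  then obtain x y where xy: "x * x + y * y = 1" "b * (x * x - y * y) = (a - d) * (x * y)" by blast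
  show ?thesis
  proof (cases "\<bar>a * (y * y) - 2 * b * (x * y) + d * (x * x)\<bar> \<le> \<bar>a * (x * x) + 2 * b * (x * y) + d * (y * y)\<bar>")
    case True
    then show ?thesis using xy by blast
  next
    case False
    \<comment> \<open>A further quarter turn exchanges the two diagonal entries.\<close>
    show ?thesis
      by (intro exI[of _ "- y"] exI[of _ x]) (use xy False in \<open>auto simp: algebra_simps\<close>)
  qed
qed

lemma eigendecomp_exists: "\<exists>H D. is_eigendecomp (mat2 a b b d) H D"
proof -
  obtain x y where xy: "x * x + y * y = 1" "b * (x * x - y * y) = (a - d) * (x * y)"
    and le: "\<bar>a * (y * y) - 2 * b * (x * y) + d * (x * x)\<bar> \<le> \<bar>a * (x * x) + 2 * b * (x * y) + d * (y * y)\<bar>"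
    using jacobi_rotation[of b a d] by blast
  define d0 where "d0 = a * (x * x) + 2 * b * (x * y) + d * (y * y)"
  define d1 where "d1 = a * (y * y) - 2 * b * (x * y) + d * (x * x)"
  define H where "H = mat2 x (- y) y x"
  define D where "D = mat2 d0 0 0 d1"
  have "x * d0 * x + y * d1 * y = a * (x * x + y * y) * (x * x + y * y) + 2 * (x * y) * (b * (x * x - y * y) - (a - d) * (x * y))"
    by (simp add: d0_def d1_def algebra_simps)
  then have 1: "x * d0 * x + y * d1 * y = a" by (simp add: xy)
  have "x * d0 * y - y * d1 * x = b * (x * x + y * y) * (x * x + y * y) - (x * x - y * y) * (b * (x * x - y * y) - (a - d) * (x * y))"
    by (simp add: d0_def d1_def algebra_simps)
  then have 2: "x * d0 * y - y * d1 * x = b" by (simp add: xy)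
  have "y * d0 * y + x * d1 * x = d * (x * x + y * y) * (x * x + y * y) - 2 * (x * y) * (b * (x * x - y * y) - (a - d) * (x * y))"
    by (simp add: d0_def d1_def algebra_simps)
  then have 3: "y * d0 * y + x * d1 * x = d" by (simp add: xy)
  have "transpose_mat H * H = 1\<^sub>m 2" using xy by (simp add: H_def mat2_transpose mat2_mult mat2_one algebra_simps)
  moreover have "H * D * transpose_mat H = mat2 a b b d"
    using 1 2 3 by (simp add: H_def D_def mat2_transpose mat2_mult algebra_simps)
  moreover have "diagonal_mat D" by (auto simp: D_def mat2_def diagonal_mat_def)
  ultimately show ?thesis using le
    by (intro exI[of _ H] exI[of _ D]) (auto simp: is_eigendecomp_def H_def D_def d0_def d1_def)
qed

section \<open>The first stage\<close>

locale stage_one =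
  perturbed_rank_two "mat_op n (\<lambda>i j. A $$ (i, j))" W "fv n (\<lambda>_. 1 / sqrt (real n))" e2 a b w
  for n :: nat and A :: "real mat" and W e2 a b w +
  fixes Y :: "real mat" and N :: nat and t :: real
  assumes A: "A \<in> carrier_mat n n" and Y: "Y \<in> carrier_mat n 2" and N: "N \<ge> 1"
    and align: "\<And>c d. c \<noteq> 0 \<or> d \<noteq> 0 \<Longrightarrow>
      pU ((mat_op n (\<lambda>i j. A $$ (i, j)) ^^ N) (comb n Y c d)) \<noteq> 0 \<and>
      norm (pV ((mat_op n (\<lambda>i j. A $$ (i, j)) ^^ N) (comb n Y c d)))
        \<le> t * norm (pU ((mat_op n (\<lambda>i j. A $$ (i, j)) ^^ N) (comb n Y c d)))"
begin

abbreviation op :: "fvec \<Rightarrow> fvec" where "op \<equiv> mat_op n (\<lambda>i j. A $$ (i, j))"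

lemma op_pow_zero: "(op ^^ k) 0 = 0"
  by (rule linear_0[OF linear_Tn])

lemma op_pow_nonzero:
  assumes "k \<le> N" "c \<noteq> 0 \<or> d \<noteq> 0"
  shows "(op ^^ k) (comb n Y c d) \<noteq> 0"
proof
  assume z: "(op ^^ k) (comb n Y c d) = 0"
  have "(op ^^ N) (comb n Y c d) = (op ^^ (N - k)) ((op ^^ k) (comb n Y c d))"
    using assms(1) by (metis comp_apply funpow_add le_add_diff_inverse2)
  then have "(op ^^ N) (comb n Y c d) = 0" by (simp add: z op_pow_zero)
  then show False using align[OF assms(2)] by (simp add: pU_def)
qed

text \<open>An invariant that does not depend on the factorisations chosen: every nonzero
  combination of the columns of \<open>Q\<close> comes from a nonzero combination of the columns of
  \<open>Y\<close>, so the alignment of the latter applies to it.\<close>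

definition tracks :: "nat \<Rightarrow> real mat \<Rightarrow> bool" where
  "tracks k Q \<longleftrightarrow> Q \<in> carrier_mat n 2 \<and>
     (\<forall>c d. c \<noteq> 0 \<or> d \<noteq> 0 \<longrightarrow>
        (\<exists>c' d'. (c' \<noteq> 0 \<or> d' \<noteq> 0) \<and> comb n Q c d = (op ^^ k) (comb n Y c' d')))"

lemma comb_zero: "comb n M 0 0 = 0"
  by (simp add: comb_def)

text \<open>A vanishing combination would stay zero until step \<open>N\<close>, where alignment
  gives a nonzero component in the leading plane. The strict \<open>k < N\<close> leaves room for
  the extra product with \<open>A\<close>.\<close>

lemma tracks_indep_image:
  assumes "tracks k Q" "k < N" "comb n (A * Q) c d = 0"
  shows "c = 0 \<and> d = 0"
proof (rule ccontr)
  assume "\<not> ?thesis"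
  then obtain c' d' where cd: "c' \<noteq> 0 \<or> d' \<noteq> 0" "comb n Q c d = (op ^^ k) (comb n Y c' d')"
    using assms(1) unfolding tracks_def by blast
  have Q: "Q \<in> carrier_mat n 2" using assms(1) by (simp add: tracks_def)
  have "comb n (A * Q) c d = (op ^^ Suc k) (comb n Y c' d')" by (simp add: comb_mult_left[OF A Q] cd(2))
  then show False using op_pow_nonzero[of "Suc k" c' d'] assms cd by simp
qed

lemma tracks_step:
  assumes Q: "tracks k Q" and k: "k < N" and qr: "is_qr n (A * Q) Q' R"
  shows "tracks (Suc k) Q'"
proof -
  have Qc: "Q \<in> carrier_mat n 2" using Q by (simp add: tracks_def)
  have Q': "Q' \<in> carrier_mat n 2" "transpose_mat Q' * Q' = 1\<^sub>m 2" and R: "R \<in> carrier_mat 2 2"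
    and AQ: "A * Q = Q' * R" using qr by (auto simp: is_qr_def)
  have comb_R: "comb n (A * Q) x y = comb n Q' (R $$ (0, 0) * x + R $$ (0, 1) * y) (R $$ (1, 0) * x + R $$ (1, 1) * y)" for x y
    unfolding AQ by (rule comb_mult_right[OF Q'(1) R])
  have "\<exists>c' d'. (c' \<noteq> 0 \<or> d' \<noteq> 0) \<and> comb n Q' c d = (op ^^ Suc k) (comb n Y c' d')" if cd: "c \<noteq> 0 \<or> d \<noteq> 0" for c d
  proof -
    \<comment> \<open>\<open>R\<close> is injective because \<open>A * Q\<close> has independent
      columns, hence surjective; combinations of \<open>Q'\<close> can therefore be pulled
      back.\<close>
    have "\<exists>x y. R $$ (0, 0) * x + R $$ (0, 1) * y = c \<and> R $$ (1, 0) * x + R $$ (1, 1) * y = d"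
    proof (rule two_by_two_surj)
      fix x y assume "R $$ (0, 0) * x + R $$ (0, 1) * y = 0" "R $$ (1, 0) * x + R $$ (1, 1) * y = 0"
      then have "comb n (A * Q) x y = 0" by (simp add: comb_R comb_zero)
      then show "x = 0 \<and> y = 0" by (rule tracks_indep_image[OF Q k])
    qed
    then obtain x y where xy: "R $$ (0, 0) * x + R $$ (0, 1) * y = c" "R $$ (1, 0) * x + R $$ (1, 1) * y = d" by blast
    then have "x \<noteq> 0 \<or> y \<noteq> 0" using cd by auto
    then obtain c' d' where "c' \<noteq> 0 \<or> d' \<noteq> 0" "comb n Q x y = (op ^^ k) (comb n Y c' d')"
      using Q unfolding tracks_def by blast
    moreover have "comb n Q' c d = op (comb n Q x y)"
      using comb_R[of x y] comb_mult_left[OF A Qc, of x y] by (simp add: xy)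
    ultimately show ?thesis by (intro exI[of _ c'] exI[of _ d']) simp
  qed
  then show ?thesis using Q' by (simp add: tracks_def)
qed

text \<open>Positive definiteness makes \<open>S\<close> injective, so nonzero coefficients stay
  nonzero.\<close>

lemma tracks_start:
  assumes S: "is_inv_sqrt (transpose_mat Y * Y) S"
  shows "tracks 0 (Y * S)"
proof -
  have dr: "dim_row (transpose_mat Y * Y) = 2" using Y by simp
  have Sc: "S \<in> carrier_mat 2 2" and pos: "\<And>v. v \<in> carrier_vec 2 \<Longrightarrow> v \<noteq> 0\<^sub>v 2 \<Longrightarrow> v \<bullet> (S *\<^sub>v v) > 0"
    using S unfolding is_inv_sqrt_def dr by auto
  have "S $$ (0, 0) * c + S $$ (0, 1) * d \<noteq> 0 \<or> S $$ (1, 0) * c + S $$ (1, 1) * d \<noteq> 0"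
    if cd: "c \<noteq> 0 \<or> d \<noteq> 0" for c d
  proof -
    define v where "v = vec 2 (\<lambda>i. if i = 0 then c else d)"
    have "v $ 0 = c" "v $ 1 = d" by (simp_all add: v_def)
    then have "v \<noteq> 0\<^sub>v 2" using cd by auto
    then have "0 < v \<bullet> (S *\<^sub>v v)" by (intro pos) (auto simp: v_def)
    also have "v \<bullet> (S *\<^sub>v v) = c * (S $$ (0, 0) * c + S $$ (0, 1) * d) + d * (S $$ (1, 0) * c + S $$ (1, 1) * d)"
      using Sc by (simp add: scalar_prod_def numeral_2_eq_2 v_def One_nat_def)
    finally show ?thesis by auto
  qed
  then show ?thesis unfolding tracks_def using Y Sc
    by (auto simp: comb_mult_right[OF Y Sc] intro!: mult_carrier_mat)
qed

lemma iterates_track: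
  assumes S: "is_inv_sqrt (transpose_mat Y * Y) S" and Q0: "Q 0 = Y * S"
    and qr: "\<And>k. k \<in> {1..m} \<Longrightarrow> is_qr n (A * Q (k - 1)) (Q k) (R k)" and m: "m \<le> N"
  shows "tracks m (Q m)"
  using qr m
proof (induction m)
  case 0
  then show ?case using tracks_start[OF S] by (simp add: Q0)
next
  case (Suc m)
  have "tracks m (Q m)" using Suc by simp
  moreover have "is_qr n (A * Q m) (Q (Suc m)) (R (Suc m))" using Suc.prems(1)[of "Suc m"] by simp
  ultimately show ?case using tracks_step Suc.prems(2) by simp
qed

lemma tracks_cone:
  assumes "tracks N Q" and q: "q = comb n Q c d" "norm q = 1"
  shows "norm (pV q) \<le> t"
proof -
  have "c \<noteq> 0 \<or> d \<noteq> 0" using q by (auto simp: comb_zero)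
  then obtain c' d' where cd: "c' \<noteq> 0 \<or> d' \<noteq> 0" "q = (op ^^ N) (comb n Y c' d')"
    using assms(1) unfolding tracks_def q(1) by blast
  have le: "norm (pV q) \<le> t * norm (pU q)" and pU: "norm (pU q) > 0" using align[OF cd(1)] by (auto simp: cd(2))
  have "t \<ge> 0"
  proof (rule ccontr)
    assume "\<not> ?thesis"
    then have "t * norm (pU q) < 0" using pU by (simp add: mult_neg_pos)
    then show False using le norm_ge_zero[of "pV q"] by linarith
  qed
  then have "t * norm (pU q) \<le> t * 1" using norm_pU_le[of q] q by (intro mult_left_mono) auto
  then show ?thesis using le by simp
qed

lemma stage1_output:
  assumes st: "stage1 n A Y N y" and \<eta>: "\<eta> = (2 * w + b * t\<^sup>2) / (a - b)"
  shows "y \<in> carrier_vec n"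
    and "\<exists>q. norm q = 1 \<and> (inner (fv n (\<lambda>_. 1 / sqrt (real n))) q)\<^sup>2 * (inner (fv n (\<lambda>_. 1 / sqrt (real n))) q)\<^sup>2 \<le> \<eta>\<^sup>2 + \<eta>
      \<and> norm (pV q) \<le> t
      \<and> fv n (\<lambda>i. y $ i) = q - inner (fv n (\<lambda>_. 1 / sqrt (real n))) q *\<^sub>R fv n (\<lambda>_. 1 / sqrt (real n))"
proof -
  obtain S Q R H D i where S: "is_inv_sqrt (transpose_mat Y * Y) S" and Q0: "Q 0 = Y * S"
    and qr: "\<And>k. k \<in> {1..N} \<Longrightarrow> is_qr n (A * Q (k - 1)) (Q k) (R k)"
    and ed: "is_eigendecomp (transpose_mat (Q N) * A * Q N) H D"
    and am: "is_arg_min (\<lambda>i. D $$ (i, i)) (\<lambda>i. i \<in> {0, 1}) i"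
    and y: "y = centre n (col (Q N * H) i)"
    using st unfolding stage1_def by blast
  show "y \<in> carrier_vec n" by (simp add: y centre_def)
  have tr: "tracks N (Q N)" by (rule iterates_track[OF S Q0 qr]) auto
  have Qc: "Q N \<in> carrier_mat n 2" and QQ: "transpose_mat (Q N) * Q N = 1\<^sub>m 2"
    using qr[of N] N by (auto simp: is_qr_def)
  have H: "H \<in> carrier_mat 2 2" and D: "D \<in> carrier_mat 2 2" and HH: "transpose_mat H * H = 1\<^sub>m 2"
    and diag: "diagonal_mat D" and B: "transpose_mat (Q N) * A * Q N = H * D * transpose_mat H"
    using ed by (auto simp: is_eigendecomp_def)
  \<comment> \<open>In terms of \<open>P\<close> the Rayleigh-Ritz step says that the columns are
    orthonormal and that \<open>transpose_mat P * (A * P)\<close> is the diagonal matrix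
    \<open>D\<close>: exactly the input of \<open>ritz_selection\<close>.\<close>
  define P where "P = Q N * H"
  have Pc: "P \<in> carrier_mat n 2" using Qc H by (auto simp: P_def)
  define q where "q k = colv n P k" for k
  have q_comb: "q k = comb n (Q N) (H $$ (0, k)) (H $$ (1, k))" if "k < 2" for k
    unfolding q_def P_def by (rule colv_mult_right[OF Qc H that])
  have tQ: "transpose_mat (Q N) \<in> carrier_mat 2 n" and tH: "transpose_mat H \<in> carrier_mat 2 2" using Qc H by auto
  have tP: "transpose_mat P = transpose_mat H * transpose_mat (Q N)"
    unfolding P_def by (rule transpose_mult[OF Qc H])
  have "transpose_mat P * P = transpose_mat H * (transpose_mat (Q N) * (Q N * H))"
    unfolding tP unfolding P_def by (rule assoc_mult_mat[OF tH tQ]) (use Qc H in auto)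
  also have "transpose_mat (Q N) * (Q N * H) = transpose_mat (Q N) * Q N * H"
    by (rule assoc_mult_mat[OF tQ Qc H, symmetric])
  also have "transpose_mat H * (transpose_mat (Q N) * Q N * H) = 1\<^sub>m 2" using H HH by (simp add: QQ)
  finally have PP: "transpose_mat P * P = 1\<^sub>m 2" .
  have AQc: "A * Q N \<in> carrier_mat n 2" using A Qc by auto
  have "transpose_mat P * (A * P) = transpose_mat H * (transpose_mat (Q N) * (A * P))"
    unfolding tP by (rule assoc_mult_mat[OF tH tQ]) (use A Pc in auto)
  also have AP: "A * P = A * Q N * H" unfolding P_def by (rule assoc_mult_mat[OF A Qc H, symmetric])
  also have "transpose_mat (Q N) * (A * Q N * H) = transpose_mat (Q N) * (A * Q N) * H"
    by (rule assoc_mult_mat[OF tQ AQc H, symmetric])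
  also have "transpose_mat (Q N) * (A * Q N) = transpose_mat (Q N) * A * Q N"
    by (rule assoc_mult_mat[OF tQ A Qc, symmetric])
  also have "\<dots> = H * D * transpose_mat H" by (rule B)
  also have "H * D * transpose_mat H * H = H * D * (transpose_mat H * H)"
    by (rule assoc_mult_mat[of _ 2 2 _ 2 _ 2]) (use H D in auto)
  also have "\<dots> = H * D" using H D by (simp add: HH right_mult_one_mat[of _ 2 2])
  also have "transpose_mat H * (H * D) = transpose_mat H * H * D"
    by (rule assoc_mult_mat[OF tH H D, symmetric])
  also have "\<dots> = D" using D by (simp add: HH)
  finally have PAP: "transpose_mat P * (A * P) = D" unfolding AP .
  have orth: "inner (q k) (q l) = (if k = l then 1 else 0)" if "k < 2" "l < 2" for k l
    using transpose_mult_index[OF Pc Pc that] that by (simp add: PP q_def)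
  have ritz: "inner (q k) (op (q l)) = D $$ (k, l)" if "k < 2" "l < 2" for k l
  proof -
    have "A * P \<in> carrier_mat n 2" using A Pc by auto
    from transpose_mult_index[OF Pc this that] show ?thesis
      using that by (simp add: PAP q_def colv_mult_left[OF A Pc])
  qed
  have nq: "norm (q k) = 1" if "k < 2" for k using orth[OF that that] by (simp add: norm_eq_1)
  have i2: "i < 2" and i01: "i = 0 \<or> i = 1" and imin: "\<And>j. j \<in> {0, 1} \<Longrightarrow> D $$ (i, i) \<le> D $$ (j, j)"
    using am by (auto simp: is_arg_min_def not_less)
  \<comment> \<open>The Ritz vector that is not selected.\<close>
  define j where "j = 1 - i"
  have j: "j < 2" "j \<noteq> i" "j \<in> {0, 1}" using i01 by (auto simp: j_def)
  have D0: "D $$ (i, j) = 0" using diag D i2 j by (auto simp: diagonal_mat_def)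
  have cone: "norm (pV (q k)) \<le> t" if "k < 2" for k
    by (rule tracks_cone[OF tr q_comb[OF that] nq[OF that]])
  have sel: "(inner (fv n (\<lambda>_. 1 / sqrt (real n))) (q i))\<^sup>2 * (inner (fv n (\<lambda>_. 1 / sqrt (real n))) (q i))\<^sup>2 \<le> \<eta>\<^sup>2 + \<eta>"
    by (rule ritz_selection[OF nq[OF i2] nq[OF j(1)] _ cone[OF i2] cone[OF j(1)] _ _ \<eta>])
       (use orth[OF i2 j(1)] j ritz i2 D0 imin in auto)
  \<comment> \<open>Centring is removal of the component along the unit all-one vector: two factors
    \<open>1 / sqrt n\<close> make up the \<open>1 / n\<close> of the mean.\<close>
  have "fv n (\<lambda>l. y $ l) = q i - inner (fv n (\<lambda>_. 1 / sqrt (real n))) (q i) *\<^sub>R fv n (\<lambda>_. 1 / sqrt (real n))"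
  proof (rule fvec_eqI)
    fix l
    have "inner (fv n (\<lambda>_. 1 / sqrt (real n))) (q i) = (\<Sum>m<n. P $$ (m, i)) / sqrt (real n)"
      by (simp add: inner_fv q_def coord_colv sum_divide_distrib)
    moreover have "y $ l = P $$ (l, i) - (\<Sum>m<n. P $$ (m, i)) / real n" if "l < n"
    proof -
      have "col P i $ m = P $$ (m, i)" if "m < n" for m using that Pc i2 by simp
      then have "(\<Sum>m<n. col P i $ m) = (\<Sum>m<n. P $$ (m, i))" by (intro sum.cong) auto
      then show ?thesis using that Pc i2 by (simp add: y centre_def P_def[symmetric])
    qed
    ultimately show "coord (fv n (\<lambda>l. y $ l)) l = coord (q i - inner (fv n (\<lambda>_. 1 / sqrt (real n))) (q i) *\<^sub>R fv n (\<lambda>_. 1 / sqrt (real n))) l"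
      by (simp add: coord_fv coord_simps q_def coord_colv)
  qed
  then show "\<exists>q. norm q = 1 \<and> (inner (fv n (\<lambda>_. 1 / sqrt (real n))) q)\<^sup>2 * (inner (fv n (\<lambda>_. 1 / sqrt (real n))) q)\<^sup>2 \<le> \<eta>\<^sup>2 + \<eta>
      \<and> norm (pV q) \<le> t
      \<and> fv n (\<lambda>i. y $ i) = q - inner (fv n (\<lambda>_. 1 / sqrt (real n))) q *\<^sub>R fv n (\<lambda>_. 1 / sqrt (real n))"
    using nq[OF i2] cone[OF i2] sel by blast
qed

lemma stage1_feasible:
  assumes sym: "\<And>i j. i < n \<Longrightarrow> j < n \<Longrightarrow> A $$ (i, j) = A $$ (j, i)"
  shows "\<exists>y. stage1 n A Y N y"
proof -
  have "c = 0 \<and> d = 0" if "comb n Y c d = 0" for c d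
    using op_pow_nonzero[of 0 c d] that by auto
  then obtain S where S: "is_inv_sqrt (transpose_mat Y * Y) S" using gram_inv_sqrt_exists[OF Y] by blast
  \<comment> \<open>The iterates are chosen recursively. A QR factor exists as long as
    \<open>k < N\<close>; later values are arbitrary.\<close>
  define Q where "Q = rec_nat (Y * S) (\<lambda>k Q. SOME Q'. \<exists>R. is_qr n (A * Q) Q' R)"
  have Q0: "Q 0 = Y * S" and QS: "Q (Suc k) = (SOME Q'. \<exists>R. is_qr n (A * Q k) Q' R)" for k
    by (simp_all add: Q_def)
  have step: "\<exists>R. is_qr n (A * Q k) (Q (Suc k)) R" if "tracks k (Q k)" "k < N" for k
  proof -
    have "A * Q k \<in> carrier_mat n 2" using A that by (auto simp: tracks_def)
    then have "\<exists>Q' R. is_qr n (A * Q k) Q' R" using tracks_indep_image[OF that] by (rule qr_exists)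
    then show ?thesis unfolding QS by (rule someI_ex)
  qed
  have tr: "k \<le> N \<Longrightarrow> tracks k (Q k)" for k
  proof (induction k)
    case 0
    then show ?case using tracks_start[OF S] by (simp add: Q0)
  next
    case (Suc k)
    then have k: "tracks k (Q k)" "k < N" by auto
    then show ?case using step[OF k] tracks_step by blast
  qed
  have qr_ex: "\<forall>k\<in>{1..N}. \<exists>R. is_qr n (A * Q (k - 1)) (Q k) R"
  proof
    fix k assume "k \<in> {1..N}"
    then obtain k' where "k = Suc k'" "k' < N" by (cases k) auto
    then show "\<exists>R. is_qr n (A * Q (k - 1)) (Q k) R" using step[of k'] tr[of k'] by simp
  qed
  then obtain R where qr: "\<forall>k\<in>{1..N}. is_qr n (A * Q (k - 1)) (Q k) (R k)" using bchoice[OF qr_ex] by blast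
  have Qc: "Q N \<in> carrier_mat n 2" using tr[of N] by (simp add: tracks_def)
  define B where "B = transpose_mat (Q N) * A * Q N"
  have Bc: "B \<in> carrier_mat 2 2" using A Qc by (auto simp: B_def)
  have "B = transpose_mat (Q N) * (A * Q N)" unfolding B_def by (rule assoc_mult_mat) (use A Qc in auto)
  moreover have "A * Q N \<in> carrier_mat n 2" using A Qc by auto
  ultimately have Bi: "B $$ (k, l) = inner (colv n (Q N) k) (op (colv n (Q N) l))" if "k < 2" "l < 2" for k l
    using that by (simp add: transpose_mult_index[OF Qc] colv_mult_left[OF A Qc])
  have B10: "B $$ (1, 0) = B $$ (0, 1)"
  proof -
    have "B $$ (1, 0) = inner (op (colv n (Q N) 0)) (colv n (Q N) 1)" by (simp add: Bi inner_commute)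
    also have "\<dots> = inner (colv n (Q N) 0) (op (colv n (Q N) 1))" by (rule T_sym)
    finally show ?thesis by (simp add: Bi)
  qed
  have B_eq: "mat2 (B $$ (0, 0)) (B $$ (0, 1)) (B $$ (0, 1)) (B $$ (1, 1)) = B"
    by (rule mat2_eqI[OF mat2_simps(1) Bc]) (simp_all add: B10)
  obtain H D where HD: "is_eigendecomp B H D"
    using eigendecomp_exists[of "B $$ (0, 0)" "B $$ (0, 1)" "B $$ (1, 1)"] unfolding B_eq by blast
  define i :: nat where "i = (if D $$ (0, 0) \<le> D $$ (1, 1) then 0 else 1)"
  have "i \<in> {0, 1}" by (simp add: i_def)
  moreover have "D $$ (i, i) \<le> D $$ (j, j)" if "j \<in> {0, 1}" for j using that by (auto simp: i_def)
  ultimately have "is_arg_min (\<lambda>i. D $$ (i, i)) (\<lambda>i. i \<in> {0, 1}) i"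
    unfolding is_arg_min_def by (meson not_less)
  then have "stage1 n A Y N (centre n (col (Q N * H) i))"
    unfolding stage1_def
    by (intro exI[of _ S] exI[of _ Q] exI[of _ R] exI[of _ H] exI[of _ D] exI[of _ i] conjI S Q0 qr refl)
       (use HD in \<open>simp add: B_def\<close>)
  then show ?thesis by blast
qed

end

declare One_nat_def [simp] index_mult_mat(1) [simp]

section \<open>Exact recovery\<close>

text \<open>By Lagrange's identity the squares of the 2 x 2 minors of an orthonormal pair sum to 2
  over all ordered index pairs. If all minors were below \<open>1 / n\<close>, the sum would be at
  most 1.\<close>

lemma plane_form_large_coefficient:
  assumes n: "n \<ge> 1" and g: "norm g1 = 1" "norm g2 = 1" "inner g1 g2 = 0"
    and supp: "\<And>i. i \<ge> n \<Longrightarrow> coord g1 i = 0" "\<And>i. i \<ge> n \<Longrightarrow> coord g2 i = 0"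
  shows "\<exists>i<n. \<exists>j<n. 1 / real n \<le> \<bar>coord g1 i * coord g2 j - coord g2 i * coord g1 j\<bar>"
proof (rule ccontr)
  assume neg: "\<not> ?thesis"
  define K where "K i j = coord g1 i * coord g2 j - coord g2 i * coord g1 j" for i j
  have ip: "(\<Sum>i<n. coord u i * coord v i) = inner u v" if "\<And>i. i \<ge> n \<Longrightarrow> coord u i = 0" for u v
    using inner_fv[of n "coord u" v] fv_coord[of n u, OF that] by simp
  have gg: "inner g1 g1 = 1" "inner g2 g2 = 1" "inner g2 g1 = 0"
    using g by (simp_all add: norm_eq_1 inner_commute)
  have "(\<Sum>i<n. \<Sum>j<n. (K i j)\<^sup>2) = (\<Sum>i<n. \<Sum>j<n. (coord g1 i * coord g1 i) * (coord g2 j * coord g2 j)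
      + (coord g2 i * coord g2 i) * (coord g1 j * coord g1 j) - 2 * ((coord g1 i * coord g2 i) * (coord g1 j * coord g2 j)))"
    by (intro sum.cong refl) (simp add: K_def power2_eq_square algebra_simps)
  also have "\<dots> = 2"
    by (simp add: sum.distrib sum_subtractf sum_distrib_left[symmetric] sum_distrib_right[symmetric] ip[OF supp(1)] ip[OF supp(2)] gg g)
  finally have two: "(\<Sum>i<n. \<Sum>j<n. (K i j)\<^sup>2) = 2" .
  have "(\<Sum>i<n. \<Sum>j<n. (K i j)\<^sup>2) \<le> (\<Sum>i<n. \<Sum>j<n. (1 / real n)\<^sup>2)"
  proof (intro sum_mono)
    fix i j assume "i \<in> {..<n}" "j \<in> {..<n}"
    then have "\<bar>K i j\<bar> \<le> 1 / real n" using neg by (force simp: K_def)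
    then show "(K i j)\<^sup>2 \<le> (1 / real n)\<^sup>2" using abs_le_square_iff[of "K i j" "1 / real n"] by simp
  qed
  also have "\<dots> = 1" using n by (simp add: power2_eq_square)
  finally show False using two by simp
qed

lemma uminus_balanced: "xs \<in> balanced_labels n \<Longrightarrow> - xs \<in> balanced_labels n"
  by (auto simp: balanced_labels_def sum_negf)

text \<open>\<open>F\<close> precedes the start, the cost model and the time bound in the
  conclusion: it depends on the graph alone, so it may be treated as fixed when the independent
  Gaussian start is drawn.\<close>

lemma deterministic_recovery:
  fixes xs :: "real vec" and a :: "nat \<times> nat \<Rightarrow> bool"
  assumes n: "n \<ge> 1" and xs: "xs \<in> balanced_labels n" and pq: "0 < q" "q < p" "p \<le> 1"
    and good: "block_model.good_graph n p q (\<lambda>i. xs $ i) k \<Delta> w a" and k: "k > 0"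
    and lead: "la = real n * (p + q) / 2" and second: "lb = real n * (p - q) / 2"
    and w: "0 \<le> w" "8 * w \<le> lb"
    and N: "N \<ge> 1" "8 * real n ^ 7 * (4 * w / lb) ^ (N - 1) \<le> 1"
    and t: "t = 8 * w / lb" "t\<^sup>2 \<le> \<epsilon> / 2" and \<eta>: "\<eta> = (2 * w + lb * t\<^sup>2) / (la - lb)" "\<eta>\<^sup>2 + \<eta> \<le> (\<epsilon> / 2)\<^sup>2"
    and \<epsilon>: "0 < \<epsilon>" "\<epsilon> < 1" "\<epsilon> * (real n * (p - q)) \<le> k"
    and \<rho>: "32 * w\<^sup>2 / k\<^sup>2 < 1" "(32 * w\<^sup>2 / k\<^sup>2) ^ K * real n < 2" and K: "K \<ge> 1"
  defines "A \<equiv> mat n n (\<lambda>(i, j). of_bool (a (min i j, max i j)))"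
  shows "\<exists>F i0 j0. i0 < n \<and> j0 < n \<and> 1 / real n \<le> \<bar>F i0 j0\<bar> \<and>
    (\<forall>Y\<in>good_start n F. \<forall>cm T. (\<forall>K'\<le>Suc K. real (run_time cm n (nnz A) N K') \<le> T) \<longrightarrow>
       recovers_within cm n N xs T A (mat n 2 Y))"
proof -
  define x where "x i = xs $ i" for i
  interpret bm: block_model n p q x
    by unfold_locales (use pq xs in \<open>auto simp: x_def balanced_labels_def\<close>)
  have x_eq: "x = (\<lambda>i. xs $ i)" by (rule ext) (simp add: x_def)
  have good: "bm.good_graph k \<Delta> w a" using good by (simp only: x_eq)
  define r g where "r = (p + q) / 2" "g = (p - q) / 2"
  have A_c: "A \<in> carrier_mat n n" by (simp add: A_def)
  have A_adj: "A $$ (i, j) = bm.adj a i j" if "i < n" "j < n" for i j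
    using that by (simp add: A_def bm.adj_def bm.pair_def)
  have A_sym: "A $$ (i, j) = A $$ (j, i)" if "i < n" "j < n" for i j
    using that by (simp add: A_adj bm.adj_commute[of a i j])
  have x_sq: "x i * x i = 1" if "i < n" for i using balanced_labels_sq[OF xs that] by (simp add: x_def)
  define V where "V i j = A $$ (i, j) - (r + g * (x i * x j))" for i j
  have V_noise: "V i j = bm.adj a i j - bm.mean i j" if "i < n" "j < n" for i j
    using that by (simp add: V_def A_adj bm.mean_linear r_g_def)
  have noise: "(\<Sum>i<n. (\<Sum>j<n. V i j * v j)\<^sup>2) \<le> w\<^sup>2 * (\<Sum>j<n. (v j)\<^sup>2)" for v
  proof -
    have "(\<Sum>i<n. (\<Sum>j<n. V i j * v j)\<^sup>2) = (\<Sum>i<n. (\<Sum>j<n. (bm.adj a i j - bm.mean i j) * v j)\<^sup>2)"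
      by (intro sum.cong refl arg_cong[of _ _ "\<lambda>u. u\<^sup>2"]) (simp add: V_noise)
    then show ?thesis using good by (simp add: bm.good_graph_def bm.noise_bound_def)
  qed
  define e1 e2 where "e1 = fv n (\<lambda>_. 1 / sqrt (real n))" "e2 = fv n (\<lambda>i. x i / sqrt (real n))"
  have rn: "sqrt (real n) * sqrt (real n) = real n" "sqrt (real n) > 0" using n by auto
  define op where "op = mat_op n (\<lambda>i j. A $$ (i, j))"
  define W where "W = mat_op n V"
  \<comment> \<open>The mean matrix is exactly of rank two, since the self-loops have rate
    \<open>p\<close> and fit the same formula on the diagonal.\<close>
  interpret P: perturbed_rank_two op W e1 e2 la lb w
  proof (rule perturbed_rank_two.intro)
    fix z
    have s1: "inner e1 z = (\<Sum>j<n. coord z j) / sqrt (real n)"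
      by (simp add: e1_e2_def inner_fv sum_divide_distrib)
    have s2: "inner e2 z = (\<Sum>j<n. x j * coord z j) / sqrt (real n)"
      by (simp add: e1_e2_def inner_fv sum_divide_distrib)
    show "op z = (la * inner e1 z) *\<^sub>R e1 + (lb * inner e2 z) *\<^sub>R e2 + W z"
    proof (rule fvec_eqI)
      fix i
      show "coord (op z) i = coord ((la * inner e1 z) *\<^sub>R e1 + (lb * inner e2 z) *\<^sub>R e2 + W z) i"
      proof (cases "i < n")
        case True
        have "la * inner e1 z * (1 / sqrt (real n)) = la / real n * (\<Sum>j<n. coord z j)"
          unfolding s1 using rn by simp
        also have "la / real n = r" using n by (simp add: lead r_g_def)
        finally have 1: "la * inner e1 z * (1 / sqrt (real n)) = r * (\<Sum>j<n. coord z j)" .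
        have "lb * inner e2 z * (x i / sqrt (real n)) = lb / real n * x i * (\<Sum>j<n. x j * coord z j)"
          unfolding s2 using rn by simp
        also have "lb / real n = g" using n by (simp add: second r_g_def)
        finally have 2: "lb * inner e2 z * (x i / sqrt (real n)) = g * x i * (\<Sum>j<n. x j * coord z j)" .
        have "(\<Sum>j<n. A $$ (i, j) * coord z j) = r * (\<Sum>j<n. coord z j) + g * x i * (\<Sum>j<n. x j * coord z j)
            + (\<Sum>j<n. V i j * coord z j)"
          by (simp add: V_def sum_distrib_left algebra_simps flip: sum.distrib)
        then show ?thesis using True 1 2
          by (simp add: op_def W_def mat_op_def coord_simps coord_fv e1_e2_def(1)[symmetric] e1_e2_def(2)[symmetric])
             (simp add: e1_e2_def coord_fv)
      next
        case False
        then show ?thesis by (simp add: op_def W_def mat_op_def coord_simps coord_fv e1_e2_def)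
      qed
    qed
  next
    show "linear W" unfolding W_def by (rule linear_mat_op)
    show "inner (W u) v = inner u (W v)" for u v
      unfolding W_def by (rule mat_op_sym) (simp add: V_def A_sym mult.commute)
    show "norm (W z) \<le> w * norm z" for z
    proof (rule power2_le_imp_le)
      have "(norm (W z))\<^sup>2 \<le> w\<^sup>2 * (\<Sum>j<n. (coord z j)\<^sup>2)"
        using noise[of "coord z"] by (simp add: W_def mat_op_def norm_fv_sq)
      also have "\<dots> \<le> w\<^sup>2 * (norm z)\<^sup>2" by (intro mult_left_mono sum_coord_sq_le) simp
      finally show "(norm (W z))\<^sup>2 \<le> (w * norm z)\<^sup>2" by (simp add: power_mult_distrib)
    qed (use w in simp)
    have "inner e1 e1 = 1" using n by (simp add: e1_e2_def inner_fv2)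
    then show "norm e1 = 1" by (simp add: norm_eq_1)
    have "inner e2 e2 = (\<Sum>i<n. 1 / real n)" unfolding e1_e2_def inner_fv2
      by (rule sum.cong[OF refl]) (use x_sq rn in simp)
    then have "inner e2 e2 = 1" using n by simp
    then show "norm e2 = 1" by (simp add: norm_eq_1)
    have "inner e1 e2 = (\<Sum>i<n. x i) / real n"
      unfolding e1_e2_def inner_fv2 using rn by (simp add: sum_divide_distrib)
    then show "inner e1 e2 = 0" by (simp add: bm.x_sum)
    show "0 < lb" "lb < la" using n pq by (auto simp: lead second)
    show "0 \<le> w" "8 * w \<le> lb" by (rule w)+
  qed
  obtain g1 g2 where gn: "norm g1 = 1" "norm g2 = 1" "inner g1 g2 = 0"
    and img: "\<exists>c d. g1 = (op ^^ N) (c *\<^sub>R e1 + d *\<^sub>R e2)" "\<exists>c d. g2 = (op ^^ N) (c *\<^sub>R e1 + d *\<^sub>R e2)"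
    and comp: "\<And>r. inner g1 r = 0 \<Longrightarrow> inner g2 r = 0 \<Longrightarrow> P.pU ((op ^^ N) r) = 0"
    using P.image_plane_basis[of N] by metis
  \<comment> \<open>At least one application of \<open>op\<close> brings every vector into the first
    \<open>n\<close> coordinates.\<close>
  obtain N' where N': "N = Suc N'" using N(1) by (cases N) auto
  have supp: "coord ((op ^^ N) u) i = 0" if "i \<ge> n" for u i
    using that by (simp add: N' op_def mat_op_def coord_fv)
  have supp_g: "coord g1 i = 0" "coord g2 i = 0" if "i \<ge> n" for i
    using img supp that by auto
  define F where "F i j = coord g1 i * coord g2 j - coord g2 i * coord g1 j" for i j
  obtain i0 j0 where ij: "i0 < n" "j0 < n" "1 / real n \<le> \<bar>F i0 j0\<bar>"
    using plane_form_large_coefficient[OF n gn] supp_g by (auto simp: F_def)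
  have main: "recovers_within cm n N xs T A (mat n 2 Y)"
    if Y: "Y \<in> good_start n F" and T: "\<And>K'. K' \<le> Suc K \<Longrightarrow> real (run_time cm n (nnz A) N K') \<le> T" for Y cm T
  proof -
    define M where "M = mat n 2 Y"
    have M: "M \<in> carrier_mat n 2" by (simp add: M_def)
    define y0 y1 where "y0 = colv n M 0" "y1 = colv n M 1"
    have cy: "coord y0 i = (if i < n then Y (i, 0) else 0)" "coord y1 i = (if i < n then Y (i, 1) else 0)" for i
      by (simp_all add: y0_y1_def coord_colv M_def)
    have ip: "inner u y0 = (\<Sum>i<n. coord u i * Y (i, 0))" "inner u y1 = (\<Sum>i<n. coord u i * Y (i, 1))"
      if "\<And>i. i \<ge> n \<Longrightarrow> coord u i = 0" for u
      using inner_fv[of n "coord u"] fv_coord[of n u, OF that] by (simp_all add: cy)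
    have gy: "inner g1 y0 = (\<Sum>i<n. coord g1 i * Y (i, 0))" "inner g1 y1 = (\<Sum>i<n. coord g1 i * Y (i, 1))"
      "inner g2 y0 = (\<Sum>i<n. coord g2 i * Y (i, 0))" "inner g2 y1 = (\<Sum>i<n. coord g2 i * Y (i, 1))"
      by (simp_all add: ip supp_g)
    have "inner g1 y0 * inner g2 y1 - inner g2 y0 * inner g1 y1 = start_form n F Y"
      unfolding gy start_form_def F_def
      by (simp add: sum_product sum_subtractf[symmetric] algebra_simps)
    then have det: "1 / real n ^ 3 \<le> \<bar>inner g1 y0 * inner g2 y1 - inner g2 y0 * inner g1 y1\<bar>"
      using Y by (simp add: good_start_def)
    \<comment> \<open>Entries below \<open>n\<close> give a squared norm of at most
      \<open>n^3\<close>, rounded up to \<open>n^4\<close> to have the bound \<open>n^2\<close> for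
      the norm.\<close>
    have yn: "norm y0 \<le> (real n)\<^sup>2" "norm y1 \<le> (real n)\<^sup>2"
    proof -
      have Yb: "\<bar>Y (i, l)\<bar> \<le> real n" if "i < n" "l < 2" for i l
        using Y that by (force simp: good_start_def)
      have "norm (fv n (\<lambda>i. Y (i, l))) \<le> (real n)\<^sup>2" if l: "l < 2" for l
      proof (rule power2_le_imp_le)
        have "(norm (fv n (\<lambda>i. Y (i, l))))\<^sup>2 \<le> (\<Sum>i<n. (real n)\<^sup>2)"
          unfolding norm_fv_sq
        proof (rule sum_mono)
          fix i assume "i \<in> {..<n}"
          then show "(Y (i, l))\<^sup>2 \<le> (real n)\<^sup>2"
            using Yb[of i l] l abs_le_square_iff[of "Y (i, l)" "real n"] by simp
        qed
        also have "\<dots> = real n ^ 3" by (simp add: power2_eq_square power3_eq_cube)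
        also have "\<dots> \<le> real n ^ 4" using n by (intro power_increasing) auto
        finally show "(norm (fv n (\<lambda>i. Y (i, l))))\<^sup>2 \<le> ((real n)\<^sup>2)\<^sup>2" by simp
      qed simp
      moreover have "y0 = fv n (\<lambda>i. Y (i, 0))" "y1 = fv n (\<lambda>i. Y (i, 1))"
        by (rule fvec_eqI, simp add: cy coord_fv)+
      ultimately show "norm y0 \<le> (real n)\<^sup>2" "norm y1 \<le> (real n)\<^sup>2" by simp_all
    qed
    have dpos: "0 < 1 / real n ^ 3" using n by simp
    have align: "P.pU ((op ^^ N) (comb n M c d)) \<noteq> 0 \<and>
        norm (P.pV ((op ^^ N) (comb n M c d))) \<le> t * norm (P.pU ((op ^^ N) (comb n M c d)))"
      if cd: "c \<noteq> 0 \<or> d \<noteq> 0" for c d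
    proof -
      define z where "z = comb n M c d"
      have z: "z = c *\<^sub>R y0 + d *\<^sub>R y1" by (simp add: z_def comb_def y0_y1_def)
      have z0: "z \<noteq> 0"
      proof
        assume "z = 0"
        then have 1: "c * inner g1 y0 + d * inner g1 y1 = 0" "c * inner g2 y0 + d * inner g2 y1 = 0"
          using arg_cong[OF z, of "inner g1"] arg_cong[OF z, of "inner g2"] by (simp_all add: inner_simps)
        let ?D = "inner g1 y0 * inner g2 y1 - inner g2 y0 * inner g1 y1"
        have "c * ?D = inner g2 y1 * (c * inner g1 y0 + d * inner g1 y1) - inner g1 y1 * (c * inner g2 y0 + d * inner g2 y1)"
          "d * ?D = inner g1 y0 * (c * inner g2 y0 + d * inner g2 y1) - inner g2 y0 * (c * inner g1 y0 + d * inner g1 y1)"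
          by (simp_all add: algebra_simps)
        then have "?D = 0" using cd 1 by auto
        then show False using det dpos by simp
      qed
      \<comment> \<open>Norms up to \<open>n^2\<close> and a determinant of at least
        \<open>n^(-3)\<close> give \<open>4 n^4 n^3\<close>, the origin of the power
        \<open>n^7\<close>.\<close>
      have "norm z \<le> 4 * ((real n)\<^sup>2)\<^sup>2 / (1 / real n ^ 3) * norm (inner g1 z *\<^sub>R g1 + inner g2 z *\<^sub>R g2)"
        by (rule projection_coefficients_bound[OF gn det dpos yn z])
      also have "4 * ((real n)\<^sup>2)\<^sup>2 / (1 / real n ^ 3) = 4 * real n ^ 7" by (simp flip: power_add)
      finally have zb: "norm z \<le> 4 * real n ^ 7 * norm (inner g1 z *\<^sub>R g1 + inner g2 z *\<^sub>R g2)" .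
      have K7: "2 * (4 * real n ^ 7) * (4 * w / lb) ^ (N - 1) \<le> 1" using N(2) by simp
      show ?thesis
        unfolding t(1) z_def[symmetric]
        using P.block_power_alignment[OF N(1) gn img comp zb z0 K7] by blast
    qed
    interpret S: stage_one n A W e2 la lb w M N t
      by (intro stage_one.intro stage_one_axioms.intro
            P.perturbed_rank_two_axioms[unfolded op_def e1_e2_def(1)] A_c M N(1)
            align[unfolded op_def e1_e2_def(1)])
    have feasible: "\<exists>y. stage1 n A M N y" by (rule S.stage1_feasible[OF A_sym])
    have run: "y \<noteq> 0\<^sub>v n \<and> (\<forall>x. power_iterates n A y x \<longrightarrow>
           (\<exists>K. stops_at x K \<and> (x K = xs \<or> x K = - xs) \<and> real (run_time cm n (nnz A) N K) \<le> T))"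
      if st: "stage1 n A M N y" for y
    proof -
      have yc: "y \<in> carrier_vec n" by (rule S.stage1_output(1)[OF st \<eta>(1)])
      obtain q where q: "norm q = 1" "(inner e1 q)\<^sup>2 * (inner e1 q)\<^sup>2 \<le> \<eta>\<^sup>2 + \<eta>" "norm (P.pV q) \<le> t"
        "fv n (\<lambda>i. y $ i) = q - inner e1 q *\<^sub>R e1"
        using S.stage1_output(2)[OF st \<eta>(1)] unfolding op_def e1_e2_def(1) by blast
      have "((inner e1 q)\<^sup>2)\<^sup>2 \<le> (\<epsilon> / 2)\<^sup>2" using q(2) \<eta>(2) by (simp add: power2_eq_square)
      then have "(inner e1 q)\<^sup>2 \<le> \<epsilon> / 2" by (rule power2_le_imp_le) (use \<epsilon> in simp)
      moreover have "(norm (P.pV q))\<^sup>2 \<le> \<epsilon> / 2"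
        using power_mono[OF q(3) norm_ge_zero, of 2] t(2) by simp
      ultimately have close: "(inner e1 q)\<^sup>2 + (norm (P.pV q))\<^sup>2 \<le> \<epsilon>" by simp
      define fy where "fy = fv n (\<lambda>i. y $ i)"
      have n0: "0 < real n" using n by simp
      note start = P.normalised_start_close[OF q(1) close \<epsilon>(2) q(4)[folded fy_def] n0]
      have yy: "sqrt (y \<bullet> y) = norm fy"
        unfolding norm_eq_sqrt_inner fy_def inner_fv2 by (simp add: scalar_prod_sum[OF yc])
      have y0: "y \<noteq> 0\<^sub>v n"
      proof
        assume "y = 0\<^sub>v n"
        then have "fy = 0" by (intro fvec_eqI) (simp add: fy_def coord_fv coord_simps)
        then show False using start(1) by simp
      qed
      moreover have "\<exists>K. stops_at s K \<and> (s K = xs \<or> s K = - xs) \<and> real (run_time cm n (nnz A) N K) \<le> T"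
        if it: "power_iterates n A y s" for s
      proof -
        have s0: "s 0 = (sqrt (real n) / norm fy) \<cdot>\<^sub>v y" using it by (simp add: power_iterates_def yy)
        have s0c: "s 0 \<in> carrier_vec n" using yc by (simp add: s0)
        have fs: "fv n (\<lambda>i. s 0 $ i) = (sqrt (real n) / norm fy) *\<^sub>R fy"
          using yc by (intro fvec_eqI) (simp add: s0 fy_def coord_fv coord_simps)
        have s_sum: "(\<Sum>i<n. s 0 $ i) = 0"
        proof -
          have "inner e1 fy = 0" by (simp add: fy_def q(4) inner_simps P.ee)
          then have "(\<Sum>i<n. y $ i) = 0" using rn(2)
            by (simp add: e1_e2_def fy_def inner_fv2 sum_divide_distrib[symmetric])
          moreover have "(\<Sum>i<n. s 0 $ i) = (\<Sum>i<n. sqrt (real n) / norm fy * y $ i)"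
            by (rule sum.cong[OF refl]) (use yc in \<open>simp add: s0\<close>)
          ultimately show ?thesis by (simp only: sum_distrib_left[symmetric] mult_zero_right)
        qed
        have s_sq: "(\<Sum>i<n. (s 0 $ i)\<^sup>2) = real n"
          using arg_cong[OF start(2), of "\<lambda>u. u\<^sup>2"] n by (simp add: fs[symmetric] norm_fv_sq)
        obtain \<sigma> where \<sigma>: "\<sigma> \<in> {-1, 1}"
          "(norm ((sqrt (real n) / norm fy) *\<^sub>R fy - (\<sigma> * sqrt (real n)) *\<^sub>R e2))\<^sup>2 \<le> 2 * \<epsilon> * real n"
          using start(3) by blast
        \<comment> \<open>The first stage determines the label up to sign only; the second stage
          converges to the sign that was found.\<close>
        define z where "z = (if \<sigma> = 1 then xs else - xs)"
        have zB: "z \<in> balanced_labels n" using xs uminus_balanced by (simp add: z_def)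
        have zi: "z $ i = \<sigma> * x i" if "i < n" for i
          using that \<sigma>(1) xs by (auto simp: z_def x_def balanced_labels_def)
        have zz: "z $ i * z $ j = x i * x j" if "i < n" "j < n" for i j
          using \<sigma>(1) that by (auto simp: zi)
        interpret R: recovery_setting n A z r g k w
        proof unfold_locales
          show "k \<le> (\<Sum>j<n. z $ i * z $ j * A $$ (i, j))" if i: "i < n" for i
          proof -
            have "(\<Sum>j<n. z $ i * z $ j * A $$ (i, j)) = (\<Sum>j<n. x i * x j * bm.adj a i j)"
              by (rule sum.cong[OF refl]) (use i in \<open>simp add: zz A_adj\<close>)
            then show ?thesis using good i by (simp add: bm.good_graph_def)
          qed
          show "(\<Sum>i<n. (\<Sum>j<n. (A $$ (i, j) - (r + g * (z $ i * z $ j))) * v j)\<^sup>2) \<le> w\<^sup>2 * (\<Sum>j<n. (v j)\<^sup>2)" for v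
          proof -
            have "(\<Sum>i<n. (\<Sum>j<n. (A $$ (i, j) - (r + g * (z $ i * z $ j))) * v j)\<^sup>2) = (\<Sum>i<n. (\<Sum>j<n. V i j * v j)\<^sup>2)"
              by (intro sum.cong refl arg_cong[of _ _ "\<lambda>u. u\<^sup>2"]) (simp add: V_def zz)
            then show ?thesis using noise[of v] by simp
          qed
          show "0 \<le> g" using pq by (simp add: r_g_def)
        qed (use n A_c zB k in auto)
        have e: "R.err (s 0) \<le> 2 * \<epsilon> * real n"
        proof -
          have "(sqrt (real n) / norm fy) *\<^sub>R fy - (\<sigma> * sqrt (real n)) *\<^sub>R e2 = fv n (\<lambda>i. s 0 $ i - z $ i)"
            unfolding fs[symmetric] using rn(2) by (intro fvec_eqI) (simp add: coord_simps coord_fv e1_e2_def zi)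
          then have "R.err (s 0) = (norm ((sqrt (real n) / norm fy) *\<^sub>R fy - (\<sigma> * sqrt (real n)) *\<^sub>R e2))\<^sup>2"
            by (simp add: norm_fv_sq R.err_def)
          then show ?thesis using \<sigma>(2) by simp
        qed
        \<comment> \<open>The condition for entering the contraction region, as
          \<open>2 * g = p - q\<close>.\<close>
        have ge: "g * (2 * \<epsilon> * real n) \<le> k" using \<epsilon>(3) by (simp add: r_g_def algebra_simps)
        have "(32 * w\<^sup>2 / k\<^sup>2) ^ K * (2 * \<epsilon> * real n) \<le> (32 * w\<^sup>2 / k\<^sup>2) ^ K * (2 * 1 * real n)"
          using \<epsilon> by (intro mult_left_mono mult_right_mono) auto
        also have "\<dots> = 2 * ((32 * w\<^sup>2 / k\<^sup>2) ^ K * real n)" by (simp only: mult_1_right ac_simps)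
        also have "\<dots> < 4" using \<rho>(2) by linarith
        finally have K4: "(32 * w\<^sup>2 / k\<^sup>2) ^ K * (2 * \<epsilon> * real n) < 4" .
        obtain K' where K': "stops_at s K'" "s K' = z" "K' \<le> Suc K"
          using R.power_iterates_recover[OF it s0c s_sum s_sq e ge refl \<rho>(1) K4 K] by blast
        then show ?thesis using T[OF K'(3)] by (intro exI[of _ K']) (auto simp: z_def)
      qed
      ultimately show ?thesis by blast
    qed
    show ?thesis unfolding recovers_within_def M_def[symmetric] using feasible run by blast
  qed
  show ?thesis
    by (intro exI[of _ F] exI[of _ i0] exI[of _ j0] conjI ij ballI allI impI) (rule main, auto)
qed

text \<open>Finite support of \<open>M\<close> makes \<open>E\<close> a finite disjoint union of
  rectangles, so the sets \<open>B A\<close> may depend on \<open>A\<close> in any way and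
  \<open>S\<close> itself may be arbitrary.\<close>

lemma prob_at_least_product:
  fixes M :: "'a pmf" and G :: "'b measure"
  assumes fin: "finite (set_pmf M)" and G: "prob_space G" and v: "v \<ge> 0"
    and B: "\<And>A. A \<in> Good \<Longrightarrow> B A \<in> sets G" "\<And>A. A \<in> Good \<Longrightarrow> 1 - v \<le> measure G (B A)"
    and sub: "\<And>A y. A \<in> Good \<Longrightarrow> y \<in> B A \<Longrightarrow> (A, y) \<in> S"
    and u: "1 - u \<le> measure_pmf.prob M Good"
  shows "prob_at_least (measure_pmf M \<Otimes>\<^sub>M G) S (1 - u - v)"
proof -
  interpret G: prob_space G by (rule G)
  interpret MG: pair_prob_space "measure_pmf M" G ..
  define R where "R = Good \<inter> set_pmf M"
  have finR: "finite R" using fin by (simp add: R_def)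
  define E where "E = (\<Union>A\<in>R. {A} \<times> B A)"
  have sets: "{A} \<times> B A \<in> sets (measure_pmf M \<Otimes>\<^sub>M G)" if "A \<in> R" for A
    using that B by (intro pair_measureI) (auto simp: R_def)
  have E: "E \<in> sets (measure_pmf M \<Otimes>\<^sub>M G)" unfolding E_def using finR sets by auto
  have PR: "measure_pmf.prob M R = measure_pmf.prob M Good"
    unfolding R_def by (rule measure_Int_set_pmf)
  have "measure (measure_pmf M \<Otimes>\<^sub>M G) E = (\<Sum>A\<in>R. measure (measure_pmf M \<Otimes>\<^sub>M G) ({A} \<times> B A))"
    unfolding E_def
    by (rule MG.P.finite_measure_finite_Union[OF finR]) (use sets in \<open>auto simp: disjoint_family_on_def\<close>)
  also have "\<dots> = (\<Sum>A\<in>R. pmf M A * measure G (B A))"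
  proof (rule sum.cong[OF refl])
    fix A assume "A \<in> R"
    then have "B A \<in> sets G" using B by (simp add: R_def)
    then have "emeasure (measure_pmf M \<Otimes>\<^sub>M G) ({A} \<times> B A) = emeasure (measure_pmf M) {A} * emeasure G (B A)"
      by (intro G.emeasure_pair_measure_Times) auto
    then show "measure (measure_pmf M \<Otimes>\<^sub>M G) ({A} \<times> B A) = pmf M A * measure G (B A)"
      by (simp add: measure_def enn2real_mult emeasure_pmf_single)
  qed
  also have "\<dots> \<ge> (\<Sum>A\<in>R. pmf M A * (1 - v))"
    by (intro sum_mono mult_left_mono B(2)) (auto simp: R_def)
  also have "(\<Sum>A\<in>R. pmf M A * (1 - v)) = measure_pmf.prob M Good * (1 - v)"
    unfolding sum_distrib_right[symmetric] using PR by (simp only: measure_measure_pmf_finite[OF finR])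
  finally have "measure_pmf.prob M Good * (1 - v) \<le> measure (measure_pmf M \<Otimes>\<^sub>M G) E" .
  moreover have "1 - u - v \<le> measure_pmf.prob M Good * (1 - v)"
  proof -
    have "measure_pmf.prob M Good * v \<le> 1 * v" using v by (intro mult_right_mono) auto
    then show ?thesis using u by (simp add: right_diff_distrib)
  qed
  moreover have "E \<subseteq> S" using sub by (auto simp: E_def R_def)
  ultimately show ?thesis unfolding prob_at_least_def using E by (intro bexI[of _ E] conjI) auto
qed

section \<open>Running time and number of iterations\<close>

lemma run_time_le:
  assumes cm: "\<And>m. matvec_cost cm n m \<le> \<kappa> * (m + n)" "qr_cost cm n \<le> \<kappa> * n" "select_cost cm n \<le> \<kappa> * n"
    and n: "n \<ge> 1"
  shows "run_time cm n m N K \<le> (N + K + 3) * ((3 * \<kappa> + eig_cost cm + 40) * (m + n))"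
proof -
  \<comment> \<open>A common bound for all phases: an orthogonal iteration needs two sparse products
    and a QR decomposition, hence \<open>3 * \<kappa>\<close>, and 40 covers dense products and
    vector operations. The 3 in the lemma counts initialisation, Ritz step and
    normalisation.\<close>
  define c where "c = (3 * \<kappa> + eig_cost cm + 40) * (m + n)"
  define P where "P = \<kappa> * (m + n)"
  define E where "E = eig_cost cm * (m + n)"
  have e: "eig_cost cm \<le> E" using n by (simp add: E_def)
  have k: "\<kappa> * n \<le> P" by (simp add: P_def)
  have c_eq: "c = 3 * P + E + 40 * m + 40 * n" by (simp add: c_def P_def E_def algebra_simps)
  have d: "dense_mult_time 2 n 2 \<le> 8 * n" "dense_mult_time n 2 2 = 6 * n" "dense_mult_time 2 2 2 = 12"
    by (simp_all add: dense_mult_time_def)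
  have "init_time cm n \<le> c" unfolding init_time_def c_eq using d e n by linarith
  moreover have "orth_iter_time cm n m \<le> c" unfolding orth_iter_time_def c_eq
    using cm(1)[of m, folded P_def] cm(2) k by linarith
  moreover have "ritz_time cm n m \<le> c" unfolding ritz_time_def c_eq
    using cm(1)[of m, folded P_def] d e n by linarith
  moreover have "normalise_time n \<le> c" unfolding normalise_time_def c_eq using n by linarith
  moreover have "power_iter_time cm n m \<le> c" unfolding power_iter_time_def c_eq
    using cm(1)[of m, folded P_def] cm(3) k by linarith
  ultimately have "run_time cm n m N K \<le> c + N * c + c + c + K * c"
    unfolding run_time_def by (intro add_mono mult_le_mono2)
  then show ?thesis unfolding c_def[symmetric] by (simp add: algebra_simps)
qed

text \<open>The origin of the order \<open>L / ln L\<close>: a contraction by a power of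
  \<open>L\<close>, repeated that often, gains a power of \<open>n\<close>.\<close>

lemma power_decay:
  fixes u L s c :: real
  assumes u: "0 \<le> u" "u \<le> L powr (- s)" and L: "L > 0" "ln L > 0" and s: "s \<ge> 0" and M: "c * L / ln L \<le> real M"
  shows "u ^ M \<le> exp (- (s * c * L))"
proof -
  have "u ^ M \<le> (L powr (- s)) ^ M" using u by (intro power_mono)
  also have "\<dots> = exp (- (s * (real M * ln L)))"
    using L by (simp add: powr_def exp_of_nat_mult[symmetric] algebra_simps)
  also have "\<dots> \<le> exp (- (s * (c * L)))"
  proof -
    have "c * L \<le> real M * ln L" using M L by (simp add: field_simps)
    then show ?thesis using s by (simp add: mult_left_mono)
  qed
  finally show ?thesis by (simp add: mult.assoc)
qed

text \<open>
  With \<open>L = ln n\<close>, a contraction factor of at most \<open>L powr (- 1 / 24)\<close> yields \<open>n powr (- 8)\<close> after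
  \<open>192 * L / ln L\<close> steps, which beats the loss of order \<open>n ^ 7\<close> from the Gaussian start.
\<close>

definition num_iterations :: "nat \<Rightarrow> nat" where
  "num_iterations n = nat \<lceil>192 * ln (real n) / ln (ln (real n))\<rceil> + 1"

lemma num_iterations_ge: "192 * ln (real n) / ln (ln (real n)) \<le> real (num_iterations n - 1)"
  unfolding num_iterations_def by (simp add: real_nat_ceiling_ge)

lemma num_iterations_le:
  assumes "0 \<le> ln (real n) / ln (ln (real n))"
  shows "real (num_iterations n) \<le> 192 * (ln (real n) / ln (ln (real n))) + 2"
  using assms unfolding num_iterations_def by (simp add: of_nat_nat) linarith

lemma eventually_ratio_large: "\<forall>\<^sub>F n in sequentially. c \<le> ln (real n) / ln (ln (real n))"
  by real_asymp

lemma num_iterations_bigtheta: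
  "(\<lambda>n. real (num_iterations n)) \<in> \<Theta>(\<lambda>n. ln (real n) / ln (ln (real n)))"
proof (rule bigthetaI)
  show "(\<lambda>n. real (num_iterations n)) \<in> O(\<lambda>n. ln (real n) / ln (ln (real n)))"
  proof (rule bigoI[of _ 194])
    show "\<forall>\<^sub>F n in sequentially. norm (real (num_iterations n)) \<le> 194 * norm (ln (real n) / ln (ln (real n)))"
      using eventually_ratio_large[of 1]
    proof eventually_elim
      case (elim n)
      then have "real (num_iterations n) \<le> 194 * (ln (real n) / ln (ln (real n)))"
        using num_iterations_le[of n] by linarith
      moreover have "norm (ln (real n) / ln (ln (real n))) = ln (real n) / ln (ln (real n))"
        unfolding real_norm_def by (rule abs_of_nonneg) (use elim in linarith)
      ultimately show ?case by (simp only: real_norm_def abs_of_nat)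
    qed
  qed
  show "(\<lambda>n. real (num_iterations n)) \<in> \<Omega>(\<lambda>n. ln (real n) / ln (ln (real n)))"
  proof (rule landau_omega.bigI[of 1])
    show "\<forall>\<^sub>F n in sequentially. 1 * norm (ln (real n) / ln (ln (real n))) \<le> norm (real (num_iterations n))"
      using eventually_ratio_large[of 1]
    proof eventually_elim
      case (elim n)
      have "real (num_iterations n - 1) \<le> real (num_iterations n)" by simp
      then show ?case using elim num_iterations_ge[of n] by simp
    qed
  qed simp
qed

text \<open>The two last ratios are really of order \<open>L^(-1/12)\<close> and
  \<open>L^(-1/6)\<close>; halving the exponents leaves room for all constants.\<close>

definition spectral_regime :: "real \<Rightarrow> real \<Rightarrow> real \<Rightarrow> real \<Rightarrow> real \<Rightarrow> real \<Rightarrow> bool" where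
  "spectral_regime \<alpha> \<beta> \<kappa> \<epsilon> C L \<longleftrightarrow>
    (let w = C * L powr (11/12); la = (\<alpha> + \<beta>) / 2 * L; lb = (\<alpha> - \<beta>) / 2 * L; t = 8 * w / lb; \<eta> = (2 * w + lb * t\<^sup>2) / (la - lb)
     in 8 * w \<le> lb \<and> t\<^sup>2 \<le> \<epsilon> / 2 \<and> \<eta>\<^sup>2 + \<eta> \<le> (\<epsilon> / 2)\<^sup>2 \<and> 4 * w / lb \<le> L powr (- (1/24)) \<and>
        32 * w\<^sup>2 / (\<kappa> * L)\<^sup>2 \<le> L powr (- (1/12)))"

lemma eventually_spectral_regime:
  assumes ab: "0 < \<beta>" "\<beta> < \<alpha>" and \<kappa>: "\<kappa> > 0" and \<epsilon>: "\<epsilon> > 0" and C: "C > 0"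
  shows "\<forall>\<^sub>F L in at_top. spectral_regime \<alpha> \<beta> \<kappa> \<epsilon> C L"
proof -
  \<comment> \<open>All quantities are polynomials without constant term in \<open>s L\<close>, or
    such a polynomial times a power of \<open>L\<close>, so \<open>s\<close> tending to 0 settles
    every condition.\<close>
  define s where "s L = L powr (- (1/12))" for L :: real
  define A where "A = 2 * C / (\<alpha> - \<beta>)"
  have A: "A > 0" using C ab by (simp add: A_def)
  define h where "h L = 2 * C / \<beta> * s L + (\<alpha> - \<beta>) / (2 * \<beta>) * (8 * A * s L)\<^sup>2" for L
  have s0: "(s \<longlongrightarrow> 0) at_top" unfolding s_def by real_asymp
  have lim_h: "((\<lambda>L. (h L)\<^sup>2 + h L) \<longlongrightarrow> (2 * C / \<beta> * 0 + (\<alpha> - \<beta>) / (2 * \<beta>) * (8 * A * 0)\<^sup>2)\<^sup>2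
      + (2 * C / \<beta> * 0 + (\<alpha> - \<beta>) / (2 * \<beta>) * (8 * A * 0)\<^sup>2)) at_top"
    unfolding h_def by (intro tendsto_intros s0)
  have lim_t: "((\<lambda>L. (8 * A * s L)\<^sup>2) \<longlongrightarrow> (8 * A * 0)\<^sup>2) at_top" by (intro tendsto_intros s0)
  have lim_b: "((\<lambda>L. 8 * A * s L) \<longlongrightarrow> 8 * A * 0) at_top" by (intro tendsto_intros s0)
  have lim_e: "((\<lambda>L. 4 * A * L powr (- (1/24))) \<longlongrightarrow> 4 * A * 0) at_top"
    by (intro tendsto_intros) real_asymp
  have lim_f: "((\<lambda>L. 32 * C\<^sup>2 / \<kappa>\<^sup>2 * s L) \<longlongrightarrow> 32 * C\<^sup>2 / \<kappa>\<^sup>2 * 0) at_top" by (intro tendsto_intros s0)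
  have e1: "\<forall>\<^sub>F L in at_top. (h L)\<^sup>2 + h L < (\<epsilon> / 2)\<^sup>2" using order_tendstoD(2)[OF lim_h, of "(\<epsilon> / 2)\<^sup>2"] \<epsilon> by simp
  have e2: "\<forall>\<^sub>F L in at_top. (8 * A * s L)\<^sup>2 < \<epsilon> / 2" using order_tendstoD(2)[OF lim_t, of "\<epsilon> / 2"] \<epsilon> by simp
  have e3: "\<forall>\<^sub>F L in at_top. 8 * A * s L < 1" using order_tendstoD(2)[OF lim_b] by simp
  have e4: "\<forall>\<^sub>F L in at_top. 4 * A * L powr (- (1/24)) < 1" using order_tendstoD(2)[OF lim_e] by simp
  have e5: "\<forall>\<^sub>F L in at_top. 32 * C\<^sup>2 / \<kappa>\<^sup>2 * s L < 1" using order_tendstoD(2)[OF lim_f] by simp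
  show ?thesis
    using e1 e2 e3 e4 e5 eventually_gt_at_top[of "0::real"]
  proof eventually_elim
    case (elim L)
    define w lb where "w = C * L powr (11/12)" "lb = (\<alpha> - \<beta>) / 2 * L"
    have sL: "L powr (11/12) = L * s L"
    proof -
      have "L powr (11/12) = L powr 1 * L powr (- (1/12))" unfolding powr_add[symmetric] by simp
      then show ?thesis using elim by (simp add: s_def)
    qed
    have lb: "lb > 0" using ab elim by (simp add: w_lb_def)
    have wlb: "w / lb = A * s L" using elim ab by (simp add: w_lb_def sL A_def field_simps)
    then have w_eq: "w = A * s L * lb" using lb by (simp add: field_simps)
    have t: "8 * w / lb = 8 * A * s L" using wlb by simp
    have f: "4 * w / lb = 4 * A * s L" using wlb by simp
    have "8 * w = 8 * A * s L * lb" by (simp add: w_eq)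
    also have "\<dots> \<le> 1 * lb" using elim lb by (intro mult_right_mono) auto
    finally have c1: "8 * w \<le> lb" by simp
    have la: "(\<alpha> + \<beta>) / 2 * L - lb = \<beta> * L" by (simp add: w_lb_def field_simps)
    have \<eta>: "(2 * w + lb * (8 * w / lb)\<^sup>2) / ((\<alpha> + \<beta>) / 2 * L - lb) = h L"
    proof -
      have "2 * w / (\<beta> * L) = 2 * C / \<beta> * s L" using elim ab by (simp add: w_lb_def sL field_simps)
      moreover have "lb * (8 * A * s L)\<^sup>2 / (\<beta> * L) = (\<alpha> - \<beta>) / (2 * \<beta>) * (8 * A * s L)\<^sup>2"
        using elim ab by (simp add: w_lb_def)
      ultimately show ?thesis unfolding la t by (simp only: add_divide_distrib h_def)
    qed
    have c2: "4 * w / lb \<le> L powr (- (1/24))"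
    proof -
      have "s L = L powr (- (1/24)) * L powr (- (1/24))" unfolding s_def powr_add[symmetric] by simp
      then have "4 * w / lb = (4 * A * L powr (- (1/24))) * L powr (- (1/24))" by (simp add: f)
      also have "\<dots> \<le> 1 * L powr (- (1/24))" using elim by (intro mult_right_mono) auto
      finally show ?thesis by simp
    qed
    have c3: "32 * w\<^sup>2 / (\<kappa> * L)\<^sup>2 \<le> L powr (- (1/12))"
    proof -
      have "32 * w\<^sup>2 / (\<kappa> * L)\<^sup>2 = (32 * C\<^sup>2 / \<kappa>\<^sup>2 * s L) * s L"
        using elim \<kappa> by (simp add: w_lb_def sL power2_eq_square)
      also have "\<dots> \<le> 1 * s L" using elim by (intro mult_right_mono) (auto simp: s_def)
      finally show ?thesis by (simp add: s_def)
    qed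
    show ?case
      unfolding spectral_regime_def Let_def w_lb_def[symmetric] \<eta>
      unfolding t using c1 c2 c3 elim by (intro conjI) (assumption | simp)+
  qed
qed

lemma sbm_eq:
  assumes "block_model n p q (\<lambda>i. xs $ i)"
  shows "sbm n p q xs = map_pmf (\<lambda>a. mat n n (\<lambda>(i, j). of_bool (a (min i j, max i j)))) (block_model.law n p q (\<lambda>i. xs $ i))"
proof -
  interpret block_model n p q "\<lambda>i. xs $ i" by (rule assms)
  have "(\<lambda>(i, j). bernoulli_pmf (if xs $ i * xs $ j = 1 then p else q)) = (\<lambda>e. bernoulli_pmf (rate e))"
    by (auto simp: rate_def fun_eq_iff)
  then show ?thesis by (simp add: sbm_def law_def edges_def)
qed

lemma nnz_le:
  assumes deg: "\<And>i. i < n \<Longrightarrow> (\<Sum>j<n. of_bool (a (min i j, max i j))) \<le> (\<Delta>::real)"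
  shows "real (nnz (mat n n (\<lambda>(i, j). of_bool (a (min i j, max i j)) :: real))) \<le> real n * \<Delta>"
proof -
  let ?S = "{z \<in> {..<n} \<times> {..<n}. a (min (fst z) (snd z), max (fst z) (snd z))}"
  have "{(i, j). i < n \<and> j < n \<and> mat n n (\<lambda>(i, j). of_bool (a (min i j, max i j)) :: real) $$ (i, j) \<noteq> 0} = ?S"
    by auto
  then have "real (nnz (mat n n (\<lambda>(i, j). of_bool (a (min i j, max i j)) :: real))) = real (card ?S)"
    by (simp add: nnz_def)
  also have "\<dots> = (\<Sum>z\<in>?S. 1)" by simp
  also have "\<dots> = (\<Sum>z\<in>{..<n} \<times> {..<n}. if a (min (fst z) (snd z), max (fst z) (snd z)) then 1 else 0)"
    by (rule sum.inter_filter) simp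
  also have "\<dots> = (\<Sum>i<n. \<Sum>j<n. of_bool (a (min i j, max i j)))"
    by (simp add: sum.cartesian_product case_prod_beta of_bool_def)
  also have "\<dots> \<le> (\<Sum>i<n. \<Delta>)" by (intro sum_mono deg) auto
  finally show ?thesis by simp
qed

theorem corollary1:
  fixes \<alpha> \<beta> :: real
  assumes "\<alpha> > \<beta>" and "\<beta> > 0" and "sqrt \<alpha> - sqrt \<beta> > sqrt 2"
  shows "\<exists>N :: nat \<Rightarrow> nat.
    (\<forall>n. N n > 0) \<and>
    (\<lambda>n. real (N n)) \<in> \<Theta>(\<lambda>n. ln (real n) / ln (ln (real n))) \<and>
    (\<exists>c>0. \<forall>cm. admissible_costs cm \<longrightarrow>
      (\<exists>C. \<forall>\<^sub>F n in sequentially. even n \<longrightarrow>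
        (\<forall>xs \<in> balanced_labels n.
          prob_at_least
            (measure_pmf (sbm n (\<alpha> * ln (real n) / real n) (\<beta> * ln (real n) / real n) xs)
              \<Otimes>\<^sub>M gaussian_entries n)
            {(A, Y). recovers_within cm n (N n) xs
                       (C * (real n * (ln (real n))\<^sup>2 / ln (ln (real n)))) A (mat n 2 Y)}
            (1 - real n powr (- c)))))"
proof -
  define h where "h = (sqrt \<alpha> - sqrt \<beta>)\<^sup>2 / 2"
  have h: "h > 1"
  proof -
    have "(sqrt 2)\<^sup>2 < (sqrt \<alpha> - sqrt \<beta>)\<^sup>2" using assms(3) by (intro power_strict_mono) auto
    then show ?thesis by (simp add: h_def)
  qed
  define \<theta> where "\<theta> = ln (\<alpha> / \<beta>) / 2"
  have \<theta>: "\<theta> > 0" using assms by (simp add: \<theta>_def)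
  \<comment> \<open>The margin costs \<open>\<theta> * \<kappa> = (h - 1) / 2\<close>, so
    \<open>m\<close> is the midpoint of 1 and \<open>h\<close> and still exceeds 1.\<close>
  define \<kappa> where "\<kappa> = (h - 1) / (2 * \<theta>)"
  have \<kappa>: "\<kappa> > 0" using h \<theta> by (simp add: \<kappa>_def)
  define m where "m = (h + 1) / 2"
  have m: "m = (sqrt \<alpha> - sqrt \<beta>)\<^sup>2 / 2 - ln (\<alpha> / \<beta>) / 2 * \<kappa>"
    using \<theta> by (simp add: h_def[symmetric] \<theta>_def[symmetric] m_def \<kappa>_def field_simps)
  \<comment> \<open>Both \<open>1 / n\<close> and \<open>n^(1 - m)\<close> are then at most
    \<open>n^(- 2 c)\<close>; the other factor \<open>n^c\<close> will absorb constants.\<close>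
  define c where "c = min (1/2) ((m - 1) / 2)"
  have c_le: "c \<le> 1 / 2" "c \<le> (m - 1) / 2" unfolding c_def by (rule min.cobounded1, rule min.cobounded2)
  have "c > 0" using h by (simp add: c_def m_def)
  moreover have "2 * c \<le> 1" using c_le(1) by simp
  moreover have "2 * c \<le> 2 * ((m - 1) / 2)" using c_le(2) by (intro mult_left_mono) auto
  then have "2 * c \<le> m - 1" by simp
  ultimately have c: "c > 0" "2 * c \<le> 1" "2 * c \<le> m - 1" by blast+
  \<comment> \<open>With \<open>n (p - q) = (\<alpha> - \<beta>) L\<close>, this makes an error of
    \<open>2 * \<epsilon> * n\<close> small enough for the margin
    \<open>\<kappa> * L\<close>.\<close>
  define \<epsilon> where "\<epsilon> = min (1/2) (\<kappa> / (\<alpha> - \<beta>))"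
  have \<epsilon>: "0 < \<epsilon>" "\<epsilon> < 1" "\<epsilon> * (\<alpha> - \<beta>) \<le> \<kappa>"
  proof -
    show "0 < \<epsilon>" "\<epsilon> < 1" using \<kappa> assms by (auto simp: \<epsilon>_def)
    have "\<epsilon> * (\<alpha> - \<beta>) \<le> \<kappa> / (\<alpha> - \<beta>) * (\<alpha> - \<beta>)" using assms by (intro mult_right_mono) (auto simp: \<epsilon>_def)
    then show "\<epsilon> * (\<alpha> - \<beta>) \<le> \<kappa>" using assms by simp
  qed
  define D where "D = 3 * \<alpha> + 2"
  define Cw where "Cw = 16 + 4 * D"
  have Cw: "Cw > 0" using assms by (simp add: Cw_def D_def)
  have lnlim: "filterlim (\<lambda>n. ln (real n)) at_top sequentially" by real_asymp
  have ev: "\<forall>\<^sub>F n in sequentially. n \<ge> 8 \<and> \<alpha> * ln (real n) / real n \<le> 1 \<and> 8 \<le> real n powr c \<and>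
      tail_regime \<alpha> D (ln (real n)) \<and> spectral_regime \<alpha> \<beta> \<kappa> \<epsilon> Cw (ln (real n)) \<and> 8 \<le> ln (real n) / ln (ln (real n))"
  proof (intro eventually_conj eventually_ge_at_top eventually_ratio_large)
    show "\<forall>\<^sub>F n in sequentially. \<alpha> * ln (real n) / real n \<le> 1" by real_asymp
    show "\<forall>\<^sub>F n in sequentially. 8 \<le> real n powr c" using c by real_asymp
    show "\<forall>\<^sub>F n in sequentially. tail_regime \<alpha> D (ln (real n))"
      by (rule eventually_compose_filterlim[OF eventually_tail_regime lnlim])
    show "\<forall>\<^sub>F n in sequentially. spectral_regime \<alpha> \<beta> \<kappa> \<epsilon> Cw (ln (real n))"
      using assms by (intro eventually_compose_filterlim[OF eventually_spectral_regime lnlim] \<kappa> \<epsilon> Cw)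
  qed
  have main: "\<exists>C. \<forall>\<^sub>F n in sequentially. even n \<longrightarrow>
        (\<forall>xs \<in> balanced_labels n.
          prob_at_least
            (measure_pmf (sbm n (\<alpha> * ln (real n) / real n) (\<beta> * ln (real n) / real n) xs)
              \<Otimes>\<^sub>M gaussian_entries n)
            {(A, Y). recovers_within cm n (num_iterations n) xs
                       (C * (real n * (ln (real n))\<^sup>2 / ln (ln (real n)))) A (mat n 2 Y)}
            (1 - real n powr (- c)))"
    if cm: "admissible_costs cm" for cm
  proof -
    obtain \<gamma> where \<gamma>: "\<And>n m. n \<ge> 1 \<Longrightarrow> matvec_cost cm n m \<le> \<gamma> * (m + n)"
      "\<And>n. n \<ge> 1 \<Longrightarrow> qr_cost cm n \<le> \<gamma> * n" "\<And>n. n \<ge> 1 \<Longrightarrow> select_cost cm n \<le> \<gamma> * n"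
      using cm unfolding admissible_costs_def by blast
    define c2 where "c2 = real (3 * \<gamma> + eig_cost cm + 40)"
    \<comment> \<open>The total number of phases is at most
      \<open>2 N + 4 \<le> 400 L / ln L\<close>, and each costs at most \<open>c2\<close> times
      \<open>nnz A + n\<close>, which is at most \<open>(2 \<alpha> + 3) L n\<close>. The cost model
      enters \<open>C\<close> but not the probability exponent \<open>c\<close>.\<close>
    define C where "C = 400 * c2 * (2 * \<alpha> + 3)"
    show ?thesis
    proof (intro exI[of _ C], rule eventually_mono[OF ev], intro impI ballI)
      fix n xs
      assume reg: "n \<ge> 8 \<and> \<alpha> * ln (real n) / real n \<le> 1 \<and> 8 \<le> real n powr c \<and>
        tail_regime \<alpha> D (ln (real n)) \<and> spectral_regime \<alpha> \<beta> \<kappa> \<epsilon> Cw (ln (real n)) \<and> 8 \<le> ln (real n) / ln (ln (real n))"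
        and xs: "xs \<in> balanced_labels n"
      define L where "L = ln (real n)"
      define p where "p = \<alpha> * L / real n"
      define q where "q = \<beta> * L / real n"
      define w where "w = Cw * L powr (11/12)"
      have n: "n \<ge> 1" "n \<ge> 8" using reg by auto
      have TR: "tail_regime \<alpha> D L" using reg by (simp add: L_def)
      have L: "L \<ge> 1" "ln L \<ge> 1" using TR by (auto simp: tail_regime_def)
      have L1: "L > 1"
      proof (rule ccontr)
        assume "\<not> L > 1"
        then have "L = 1" using L(1) by simp
        then show False using L(2) by simp
      qed
      have pq: "0 < q" "q < p" "p \<le> 1"
      proof -
        show "0 < q" using assms L n by (simp add: q_def)
        have "\<beta> * L < \<alpha> * L" using assms L by (intro mult_strict_right_mono) auto
        then show "q < p" using n by (simp add: p_def q_def divide_strict_right_mono)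
        show "p \<le> 1" using reg by (simp add: p_def L_def)
      qed
      have bm: "block_model n p q (\<lambda>i. xs $ i)"
        by unfold_locales (use pq xs in \<open>auto simp: balanced_labels_def\<close>)
      interpret bm: block_model n p q "\<lambda>i. xs $ i" by (rule bm)
      define la where "la = real n * (p + q) / 2"
      define lb where "lb = real n * (p - q) / 2"
      have la': "la = (\<alpha> + \<beta>) / 2 * L" using n by (simp add: la_def p_def q_def field_simps)
      have lb': "lb = (\<alpha> - \<beta>) / 2 * L" using n by (simp add: lb_def p_def q_def field_simps)
      define t where "t = 8 * w / lb"
      define \<eta> where "\<eta> = (2 * w + lb * t\<^sup>2) / (la - lb)"
      have SR: "8 * w \<le> lb" "t\<^sup>2 \<le> \<epsilon> / 2" "\<eta>\<^sup>2 + \<eta> \<le> (\<epsilon> / 2)\<^sup>2" "4 * w / lb \<le> L powr (- (1/24))"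
        "32 * w\<^sup>2 / (\<kappa> * L)\<^sup>2 \<le> L powr (- (1/12))"
        using reg unfolding spectral_regime_def Let_def L_def[symmetric] w_def[symmetric] la'[symmetric] lb'[symmetric]
          t_def[symmetric] \<eta>_def[symmetric] by blast+
      have w0: "0 \<le> w" using Cw by (simp add: w_def)
      have lb0: "lb > 0" using assms L by (simp add: lb')
      define N where "N = num_iterations n"
      have N1: "N \<ge> 1" by (simp add: N_def num_iterations_def)
      have Nge: "192 * L / ln L \<le> real (N - 1)" unfolding N_def L_def by (rule num_iterations_ge)
      have expL: "exp (- L) = 1 / real n" using n by (simp add: L_def exp_minus field_simps)
      \<comment> \<open>\<open>192 / 24 = 8\<close> gives \<open>n^(-8)\<close>, one power more than
        the loss; the remaining \<open>8 / n\<close> is the reason for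
        \<open>n \<ge> 8\<close>.\<close>
      have dec1: "8 * real n ^ 7 * (4 * w / lb) ^ (N - 1) \<le> 1"
      proof -
        have "(4 * w / lb) ^ (N - 1) \<le> exp (- (1/24 * 192 * L))"
          by (rule power_decay[OF _ SR(4) _ _ _ Nge]) (use w0 lb0 L1 in auto)
        also have "\<dots> = exp (- L) ^ 8" by (simp flip: exp_of_nat_mult)
        also have "\<dots> = 1 / real n ^ 8" by (simp add: expL power_one_over)
        finally have "8 * real n ^ 7 * (4 * w / lb) ^ (N - 1) \<le> 8 * real n ^ 7 * (1 / real n ^ 8)"
          by (intro mult_left_mono) auto
        also have "\<dots> = 8 / real n" using n by (simp add: power_eq_if)
        also have "\<dots> \<le> 1" using n by simp
        finally show ?thesis .
      qed
      have \<rho>1: "32 * w\<^sup>2 / (\<kappa> * L)\<^sup>2 < 1"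
      proof -
        have "L powr (- (1/12)) < L powr 0" using L1 by (intro powr_less_mono) auto
        then show ?thesis using SR(5) L by simp
      qed
      \<comment> \<open>The same number \<open>N\<close> also bounds the contraction steps of the
        second stage; \<open>192 / 12 = 16\<close> is more than enough.\<close>
      have \<rho>2: "(32 * w\<^sup>2 / (\<kappa> * L)\<^sup>2) ^ N * real n < 2"
      proof -
        have "192 * L / ln L \<le> real N" using Nge by simp
        then have "(32 * w\<^sup>2 / (\<kappa> * L)\<^sup>2) ^ N \<le> exp (- (1/12 * 192 * L))"
          by (intro power_decay[OF _ SR(5)]) (use L1 in auto)
        also have "\<dots> \<le> exp (- L)" using L by simp
        finally have "(32 * w\<^sup>2 / (\<kappa> * L)\<^sup>2) ^ N * real n \<le> 1 / real n * real n"
          unfolding expL by (intro mult_right_mono) auto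
        then show ?thesis using n by simp
      qed
      define F where "F a = mat n n (\<lambda>(i, j). of_bool (a (min i j, max i j)) :: real)" for a :: "nat \<times> nat \<Rightarrow> bool"
      \<comment> \<open>Good graphs as a set of matrices. Its preimage under \<open>F\<close>
        contains all good bit patterns, which suffices for the lower bound on its
        probability.\<close>
      define Good where "Good = F ` {a. bm.good_graph (\<kappa> * L) ((2 * \<alpha> + 2) * L) w a}"
      define T where "T = C * (real n * (ln (real n))\<^sup>2 / ln (ln (real n)))"
      have time: "real (run_time cm n (nnz A) N K') \<le> T" if A: "A \<in> Good" and K': "K' \<le> Suc N" for A K'
      proof -
        obtain a where a: "bm.good_graph (\<kappa> * L) ((2 * \<alpha> + 2) * L) w a" "A = F a" using A by (auto simp: Good_def)
        have nz: "real (nnz A) \<le> real n * ((2 * \<alpha> + 2) * L)"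
          unfolding a(2) F_def using a(1) by (intro nnz_le) (auto simp: bm.good_graph_def bm.adj_def bm.pair_def)
        have "run_time cm n (nnz A) N K' \<le> (N + K' + 3) * ((3 * \<gamma> + eig_cost cm + 40) * (nnz A + n))"
          using n by (intro run_time_le \<gamma>) auto
        also have "\<dots> \<le> (2 * N + 4) * ((3 * \<gamma> + eig_cost cm + 40) * (nnz A + n))"
          using K' by (intro mult_le_mono1) auto
        finally have "real (run_time cm n (nnz A) N K') \<le> real ((2 * N + 4) * ((3 * \<gamma> + eig_cost cm + 40) * (nnz A + n)))"
          by (simp only: of_nat_le_iff)
        also have "\<dots> = (2 * real N + 4) * (c2 * (real (nnz A) + real n))" by (simp add: c2_def)
        also have "\<dots> \<le> (400 * (L / ln L)) * (c2 * ((2 * \<alpha> + 3) * L * real n))"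
        proof (intro mult_mono mult_left_mono)
          have r8: "8 \<le> L / ln L" using reg by (simp add: L_def)
          have "real N \<le> 192 * (L / ln L) + 2" unfolding N_def L_def
            by (rule num_iterations_le) (use r8 in \<open>simp add: L_def\<close>)
          then show "2 * real N + 4 \<le> 400 * (L / ln L)" using r8 by linarith
          have "real n * 1 \<le> real n * L" using L by (intro mult_left_mono) auto
          then show "real (nnz A) + real n \<le> (2 * \<alpha> + 3) * L * real n" using nz by (simp add: algebra_simps)
        qed (use L in \<open>auto simp: c2_def\<close>)
        also have "\<dots> = T" by (simp add: T_def C_def L_def[symmetric] power2_eq_square)
        finally show ?thesis .
      qed
      have "\<forall>A\<in>Good. \<exists>K. 1 - 4 / real n \<le> measure (gaussian_entries n) (good_start n K) \<and>
          (\<forall>Y\<in>good_start n K. recovers_within cm n N xs T A (mat n 2 Y))"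
      proof
        fix A assume A: "A \<in> Good"
        then obtain a where a: "bm.good_graph (\<kappa> * L) ((2 * \<alpha> + 2) * L) w a" "A = F a" by (auto simp: Good_def)
        have "\<exists>K i0 j0. i0 < n \<and> j0 < n \<and> 1 / real n \<le> \<bar>K i0 j0\<bar> \<and>
          (\<forall>Y\<in>good_start n K. \<forall>cm T. (\<forall>K'\<le>Suc N. real (run_time cm n (nnz A) N K') \<le> T) \<longrightarrow>
             recovers_within cm n N xs T A (mat n 2 Y))"
          unfolding a(2) F_def
        proof (rule deterministic_recovery[OF n(1) xs pq a(1) _ la_def lb_def w0 SR(1) N1 dec1 t_def SR(2) \<eta>_def SR(3) \<epsilon>(1,2) _ \<rho>1 \<rho>2 N1])
          show "0 < \<kappa> * L" using \<kappa> L by simp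
          have "real n * (p - q) = (\<alpha> - \<beta>) * L" using n by (simp add: p_def q_def field_simps)
          moreover have "\<epsilon> * (\<alpha> - \<beta>) * L \<le> \<kappa> * L" using \<epsilon>(3) L by (intro mult_right_mono) auto
          ultimately show "\<epsilon> * (real n * (p - q)) \<le> \<kappa> * L" by (simp add: mult.assoc)
        qed
        then obtain K i0 j0 where K: "i0 < n" "j0 < n" "1 / real n \<le> \<bar>K i0 j0\<bar>"
          "\<And>Y. Y\<in>good_start n K \<Longrightarrow> recovers_within cm n N xs T A (mat n 2 Y)"
          using time[OF A] by blast
        then show "\<exists>K. 1 - 4 / real n \<le> measure (gaussian_entries n) (good_start n K) \<and>
          (\<forall>Y\<in>good_start n K. recovers_within cm n N xs T A (mat n 2 Y))"
          using K(4) good_start_prob[of n i0 j0 K, OF n(1) K(1) K(2) K(3)] by blast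
      qed
      \<comment> \<open>One bilinear form is selected for each good graph.\<close>
      then obtain K where K: "\<And>A. A \<in> Good \<Longrightarrow> 1 - 4 / real n \<le> measure (gaussian_entries n) (good_start n (K A))"
        "\<And>A Y. A \<in> Good \<Longrightarrow> Y \<in> good_start n (K A) \<Longrightarrow> recovers_within cm n N xs T A (mat n 2 Y)"
        using bchoice[of Good] by (metis (no_types, lifting))
      have law: "sbm n p q xs = map_pmf F bm.law" unfolding F_def by (rule sbm_eq[OF bm])
      have PG: "1 - (real n powr (1 - m) + 3 / real n) \<le> measure_pmf.prob (sbm n p q xs) Good"
      proof -
        have "measure_pmf.prob bm.law {a. \<not> bm.good_graph (\<kappa> * L) ((2 * \<alpha> + 2) * L) w a}
           \<le> real n powr (1 - m) + 3 / real n"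
          using bm.good_graph_prob[OF n(1) L_def p_def q_def assms(2,1) D_def TR m] by (simp add: w_def Cw_def)
        moreover have "measure_pmf.prob bm.law {a. \<not> bm.good_graph (\<kappa> * L) ((2 * \<alpha> + 2) * L) w a}
          = 1 - measure_pmf.prob bm.law {a. bm.good_graph (\<kappa> * L) ((2 * \<alpha> + 2) * L) w a}"
          using measure_pmf.prob_compl[of "{a. bm.good_graph (\<kappa> * L) ((2 * \<alpha> + 2) * L) w a}" bm.law]
          by (simp add: Compl_eq_Diff_UNIV[symmetric] Collect_neg_eq[symmetric])
        moreover have "measure_pmf.prob bm.law {a. bm.good_graph (\<kappa> * L) ((2 * \<alpha> + 2) * L) w a} \<le> measure_pmf.prob bm.law (F -` Good)"
          by (intro measure_pmf.finite_measure_mono) (auto simp: Good_def)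
        moreover have "measure_pmf.prob (sbm n p q xs) Good = measure_pmf.prob bm.law (F -` Good)"
          by (simp add: law)
        ultimately show ?thesis by linarith
      qed
      have "finite (set_pmf bm.law)" unfolding bm.law_def by (rule finite_set_Pi_pmf[OF bm.finite_edges]) auto
      then have fin: "finite (set_pmf (sbm n p q xs))" by (simp add: law)
      have "prob_at_least (measure_pmf (sbm n p q xs) \<Otimes>\<^sub>M gaussian_entries n)
          {(A, Y). recovers_within cm n N xs T A (mat n 2 Y)} (1 - (real n powr (1 - m) + 3 / real n) - 4 / real n)"
        by (rule prob_at_least_product[where B = "\<lambda>A. good_start n (K A)", OF fin prob_space_gaussian_entries _ good_start_sets K(1) _ PG])
           (use K(2) in auto)
      moreover have "1 - real n powr (- c) \<le> 1 - (real n powr (1 - m) + 3 / real n) - 4 / real n"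
      proof -
        have 1: "real n powr (1 - m) \<le> real n powr (- (2 * c))" using c n by (intro powr_mono) auto
        have "real n powr (-1) \<le> real n powr (- (2 * c))" using c n by (intro powr_mono) auto
        then have 2: "1 / real n \<le> real n powr (- (2 * c))" using n by (simp add: powr_minus_divide)
        \<comment> \<open>The failure terms amount to \<open>1 + 3 + 4 = 8\<close> times
          \<open>n^(- 2 c)\<close>, and \<open>8 \<le> n^c\<close> eventually.\<close>
        have "8 * real n powr (- (2 * c)) \<le> real n powr c * real n powr (- (2 * c))"
          using reg by (intro mult_right_mono) auto
        also have "\<dots> = real n powr (- c)" by (simp flip: powr_add)
        finally show ?thesis using 1 2 by simp
      qed
      ultimately have "prob_at_least (measure_pmf (sbm n p q xs) \<Otimes>\<^sub>M gaussian_entries n)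
          {(A, Y). recovers_within cm n N xs T A (mat n 2 Y)} (1 - real n powr (- c))"
        unfolding prob_at_least_def by (meson order_trans)
      then show "prob_at_least
            (measure_pmf (sbm n (\<alpha> * ln (real n) / real n) (\<beta> * ln (real n) / real n) xs)
              \<Otimes>\<^sub>M gaussian_entries n)
            {(A, Y). recovers_within cm n (num_iterations n) xs
                       (C * (real n * (ln (real n))\<^sup>2 / ln (ln (real n)))) A (mat n 2 Y)}
            (1 - real n powr (- c))"
        by (simp only: N_def T_def p_def q_def L_def)
    qed
  qed
  show ?thesis
    by (intro exI[of _ num_iterations] conjI allI exI[of _ c] impI num_iterations_bigtheta c main)
       (simp add: num_iterations_def)
qed

end
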